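(* Let $F$ be a totally real number field of degree $m$ with ring of integers $\mathfrak{o}_F$, real embeddings $\iota_1,\dots,\iota_m$, and different $\mathfrak{d}_F$ over $\mathbb{Q}$. Assume $\mathfrak{d}_F$ is a principal ideal generated by a totally positive element $\boldsymbol{\delta}$. Let $\kappa\ge 0$ be an integer and let $f\in M_{\kappa+1/2}(\Gamma)$. Define, for $z\in\mathfrak{h}$, \[ \mathcal{R}f(z)=f\left(\left(\frac{z}{\iota_1(\boldsymbol{\delta})},\frac{z}{\iota_2(\boldsymbol{\delta})},\dots,\frac{z}{\iota_m(\boldsymbol{\delta})}\right)\right). \] Then $\mathcal{R}f\in M_{m(\kappa+1/2)}(\Gamma_0(4))$.
   Context: $\mathfrak{h}=\{x+\sqrt{-1}y: x,y\in\mathbb{R},\ y>0\}$. Elements $x\in F$ are identified with $(\iota_1(x),\dots,\iota_m(x))\in\mathbb{R}^m$, and for $z=(z_1,\dots,z_m)\in\mathfrak{h}^m$ one writes $q^x=e^{2\pi\sqrt{-1}\sum_i z_i\iota_i(x)}$. The theta series of $F$ is $\theta_F(z)=\sum_{\xi\in\mathfrak{o}_F}q^{\xi^2}$. Let \[ \Gamma=\left\{\begin{pmatrix}a&b\\c&d\end{pmatrix}\in\mathrm{SL}_2(F): a,d\in\mathfrak{o}_F,\ b\in\mathfrak{d}_F^{-1},\ c\in4\mathfrak{d}_F\right\}, \] acting on $\mathfrak{h}^m$ componentwise via the embeddings $\iota_i$ by Möbius transformations, and put $j(\gamma,z)=\theta_F(\gamma z)/\theta_F(z)$. $M_{\kappa+1/2}(\Gamma)$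 denotes the space of Hilbert modular forms of (parallel) weight $\kappa+1/2$ for $\Gamma$: holomorphic functions $f$ on $\mathfrak{h}^m$ with $f(\gamma z)=j(\gamma,z)^{2\kappa+1}f(z)$ for all $\gamma\in\Gamma$ (and holomorphic at the cusps). For the field $\mathbb{Q}$, $\theta(z)=\sum_{n\in\mathbb{Z}}e^{2\pi\sqrt{-1}n^2z}$, and for a half-integer or integer $w=m(\kappa+1/2)$, $M_{w}(\Gamma_0(4))$ denotes the space of holomorphic functions $g$ on $\mathfrak{h}$, holomorphic at the cusps, with $g(\gamma z)=\left(\theta(\gamma z)/\theta(z)\right)^{2w}g(z)$ for all $\gamma\in\Gamma_0(4)$. *)

theory Defs
  imports "HOL-Analysis.Analysis" "HOL-Computational_Algebra.Polynomial"
begin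

section \<open>Number fields\<close>

text \<open>
  The field is the universe of a type \<open>'f\<close> of characteristic 0, viewed as a vector space over the
  rationals.
\<close>

interpretation rat_vs: vector_space "\<lambda>(r::rat) (x::'f::field_char_0). of_rat r * x"
  by unfold_locales (simp_all add: algebra_simps of_rat_add of_rat_mult)

definition number_field :: "'f::field_char_0 itself \<Rightarrow> bool" where
  "number_field _ \<longleftrightarrow> (\<exists>B::'f set. finite B \<and> rat_vs.span B = UNIV)"

definition field_degree :: "'f::field_char_0 itself \<Rightarrow> nat" where
  "field_degree _ = rat_vs.dim (UNIV :: 'f set)"

definition field_embedding :: "('f::field \<Rightarrow> 'k::field) \<Rightarrow> bool" where
  "field_embedding \<sigma> \<longleftrightarrow> \<sigma> 1 = 1 \<and> (\<forall>x y. \<sigma> (x + y) = \<sigma> x + \<sigma> y) \<and> (\<forall>x y. \<sigma> (x * y) = \<sigma> x * \<sigma> y)"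

definition totally_real :: "'f::field_char_0 itself \<Rightarrow> bool" where
  "totally_real _ \<longleftrightarrow> (\<forall>\<sigma> :: 'f \<Rightarrow> complex. field_embedding \<sigma> \<longrightarrow> range \<sigma> \<subseteq> \<real>)"

definition ring_of_integers :: "'f::field_char_0 set" where
  "ring_of_integers = {x. algebraic_int x}"

text \<open>
  The absolute trace is the sum of the conjugates; it is complex-valued here, but its values on a
  number field are rational.
\<close>

definition field_trace :: "'f::field_char_0 \<Rightarrow> complex" where
  "field_trace x = (\<Sum>\<sigma> | field_embedding \<sigma>. \<sigma> x)"

definition inverse_different :: "'f::field_char_0 set" where
  "inverse_different = {x. \<forall>y\<in>ring_of_integers. field_trace (x * y) \<in> \<int>}"

definition different :: "'f::field_char_0 set" where
  "different = {x. \<forall>y\<in>inverse_different. x * y \<in> ring_of_integers}"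

definition principal_ideal :: "'f::field_char_0 \<Rightarrow> 'f set" where
  "principal_ideal a = (\<lambda>x. a * x) ` ring_of_integers"

section \<open>Hilbert modular forms of half-integral weight\<close>

text \<open>
  Throughout, \<open>\<iota>\<close> is the family of real embeddings of \<open>'f\<close>, indexed by the finite type \<open>'n\<close>.
\<close>

definition upper_half_plane :: "complex set" where
  "upper_half_plane = {z. Im z > 0}"

definition upper_half_space :: "(complex ^ 'n::finite) set" where
  "upper_half_space = {z. \<forall>i. z $ i \<in> upper_half_plane}"

definition holomorphic_several_on ::
    "(complex ^ 'n::finite \<Rightarrow> complex) \<Rightarrow> (complex ^ 'n) set \<Rightarrow> bool" where
  "holomorphic_several_on f S \<longleftrightarrow>
     (\<forall>z\<in>S. \<exists>D. (f has_derivative D) (at z within S) \<and> (\<forall>c v. D (c *s v) = c * D v))"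

definition hilbert_q :: "('n::finite \<Rightarrow> 'f::field_char_0 \<Rightarrow> real) \<Rightarrow> complex ^ 'n \<Rightarrow> 'f \<Rightarrow> complex" where
  "hilbert_q \<iota> z x = exp (2 * of_real pi * \<i> * (\<Sum>i\<in>UNIV. z $ i * of_real (\<iota> i x)))"

definition hilbert_theta :: "('n::finite \<Rightarrow> 'f::field_char_0 \<Rightarrow> real) \<Rightarrow> complex ^ 'n \<Rightarrow> complex" where
  "hilbert_theta \<iota> z = (\<Sum>\<^sub>\<infinity>\<xi>\<in>ring_of_integers. hilbert_q \<iota> z (\<xi>\<^sup>2))"

definition hilbert_Gamma :: "('f::field_char_0 ^ 2 ^ 2) set" where
  "hilbert_Gamma = {\<gamma>. det \<gamma> = 1 \<and> \<gamma> $ 1 $ 1 \<in> ring_of_integers \<and> \<gamma> $ 2 $ 2 \<in> ring_of_integers \<and>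
     \<gamma> $ 1 $ 2 \<in> inverse_different \<and> \<gamma> $ 2 $ 1 \<in> (\<lambda>x. 4 * x) ` different}"

definition hilbert_denom ::
    "('n::finite \<Rightarrow> 'f::field_char_0 \<Rightarrow> real) \<Rightarrow> 'f ^ 2 ^ 2 \<Rightarrow> complex ^ 'n \<Rightarrow> 'n \<Rightarrow> complex" where
  "hilbert_denom \<iota> \<gamma> z i = of_real (\<iota> i (\<gamma> $ 2 $ 1)) * z $ i + of_real (\<iota> i (\<gamma> $ 2 $ 2))"

definition hilbert_act ::
    "('n::finite \<Rightarrow> 'f::field_char_0 \<Rightarrow> real) \<Rightarrow> 'f ^ 2 ^ 2 \<Rightarrow> complex ^ 'n \<Rightarrow> complex ^ 'n" where
  "hilbert_act \<iota> \<gamma> z =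
     (\<chi> i. (of_real (\<iota> i (\<gamma> $ 1 $ 1)) * z $ i + of_real (\<iota> i (\<gamma> $ 1 $ 2))) / hilbert_denom \<iota> \<gamma> z i)"

text \<open>
  For fields other than the rationals the theta series has zeros in the product of half-planes, and
  the quotient \<open>\<theta>(\<gamma>z)/\<theta>(z)\<close>, which is holomorphic and nowhere zero, has the form \<open>0/0\<close> there. The
  factor of automorphy is therefore the continuous extension of the quotient from the dense open
  set where the theta series does not vanish; on that set it is the quotient itself.
\<close>

definition hilbert_j ::
    "('n::finite \<Rightarrow> 'f::field_char_0 \<Rightarrow> real) \<Rightarrow> 'f ^ 2 ^ 2 \<Rightarrow> complex ^ 'n \<Rightarrow> complex" where
  "hilbert_j \<iota> \<gamma> z =
     Lim (at z within {w \<in> upper_half_space. hilbert_theta \<iota> w \<noteq> 0})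
       (\<lambda>w. hilbert_theta \<iota> (hilbert_act \<iota> \<gamma> w) / hilbert_theta \<iota> w)"

text \<open>
  Holomorphy at the cusps: for every \<open>\<alpha>\<close> in \<open>SL\<^sub>2(F)\<close>, the translate of \<open>f\<close> by \<open>\<alpha>\<close> in weight
  \<open>\<kappa> + 1/2\<close> has a Fourier expansion supported on totally nonnegative elements of some lattice in \<open>F\<close>.
  Every lattice lies in \<open>N\<^sup>-\<^sup>1\<close> times the ring of integers for some \<open>N\<close>, so lattices of this form
  suffice. The number \<open>cz + d\<close> is a nonzero real constant or stays off the branch cut, so the principal
  square root is a holomorphic branch; other branches change the translate by a constant only.
\<close>

definition hilbert_holomorphic_at_cusps ::
    "('n::finite \<Rightarrow> 'f::field_char_0 \<Rightarrow> real) \<Rightarrow> nat \<Rightarrow> (complex ^ 'n \<Rightarrow> complex) \<Rightarrow> bool" where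
  "hilbert_holomorphic_at_cusps \<iota> \<kappa> f \<longleftrightarrow>
     (\<forall>\<alpha> :: 'f ^ 2 ^ 2. det \<alpha> = 1 \<longrightarrow>
       (\<exists>N::nat. N > 0 \<and> (\<exists>a. \<forall>z\<in>upper_half_space.
         ((\<lambda>\<xi>. a \<xi> * hilbert_q \<iota> z (\<xi> / of_nat N)) has_sum
           (f (hilbert_act \<iota> \<alpha> z) / (\<Prod>i\<in>UNIV. csqrt (hilbert_denom \<iota> \<alpha> z i)) ^ (2 * \<kappa> + 1)))
         {\<xi> \<in> ring_of_integers. \<forall>i. \<iota> i \<xi> \<ge> 0})))"

definition hilbert_modular_forms ::
    "('n::finite \<Rightarrow> 'f::field_char_0 \<Rightarrow> real) \<Rightarrow> nat \<Rightarrow> (complex ^ 'n \<Rightarrow> complex) set" where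
  "hilbert_modular_forms \<iota> \<kappa> =
     {f. holomorphic_several_on f upper_half_space \<and>
         (\<forall>\<gamma>\<in>hilbert_Gamma. \<forall>z\<in>upper_half_space.
            f (hilbert_act \<iota> \<gamma> z) = hilbert_j \<iota> \<gamma> z ^ (2 * \<kappa> + 1) * f z) \<and>
         hilbert_holomorphic_at_cusps \<iota> \<kappa> f}"

section \<open>Elliptic modular forms of half-integral weight\<close>

text \<open>The weight is \<open>k/2\<close> throughout this section.\<close>

definition theta :: "complex \<Rightarrow> complex" where
  "theta z = (\<Sum>\<^sub>\<infinity>n::int. exp (2 * of_real pi * \<i> * of_int (n\<^sup>2) * z))"

definition Gamma0_4 :: "(int ^ 2 ^ 2) set" where
  "Gamma0_4 = {\<gamma>. det \<gamma> = 1 \<and> 4 dvd \<gamma> $ 2 $ 1}"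

definition moebius_denom :: "int ^ 2 ^ 2 \<Rightarrow> complex \<Rightarrow> complex" where
  "moebius_denom \<gamma> z = of_int (\<gamma> $ 2 $ 1) * z + of_int (\<gamma> $ 2 $ 2)"

definition moebius_act :: "int ^ 2 ^ 2 \<Rightarrow> complex \<Rightarrow> complex" where
  "moebius_act \<gamma> z = (of_int (\<gamma> $ 1 $ 1) * z + of_int (\<gamma> $ 1 $ 2)) / moebius_denom \<gamma> z"

definition holomorphic_at_cusps :: "nat \<Rightarrow> (complex \<Rightarrow> complex) \<Rightarrow> bool" where
  "holomorphic_at_cusps k g \<longleftrightarrow>
     (\<forall>\<alpha> :: int ^ 2 ^ 2. det \<alpha> = 1 \<longrightarrow>
       (\<exists>N::nat. N > 0 \<and> (\<exists>a. \<forall>z\<in>upper_half_plane.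
         (\<lambda>n. a n * exp (2 * of_real pi * \<i> * of_nat n * z / of_nat N)) sums
           (g (moebius_act \<alpha> z) / csqrt (moebius_denom \<alpha> z) ^ k))))"

definition modular_forms_Gamma0_4 :: "nat \<Rightarrow> (complex \<Rightarrow> complex) set" where
  "modular_forms_Gamma0_4 k =
     {g. g holomorphic_on upper_half_plane \<and>
         (\<forall>\<gamma>\<in>Gamma0_4. \<forall>z\<in>upper_half_plane.
            g (moebius_act \<gamma> z) = (theta (moebius_act \<gamma> z) / theta z) ^ k * g z) \<and>
         holomorphic_at_cusps k g}"

section \<open>Restriction to the diagonal\<close>

definition diagonal_restriction ::
    "('n::finite \<Rightarrow> 'f::field_char_0 \<Rightarrow> real) \<Rightarrow> 'f \<Rightarrow> (complex ^ 'n \<Rightarrow> complex) \<Rightarrow> complex \<Rightarrow> complex" where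
  "diagonal_restriction \<iota> \<delta> f z = f (\<chi> i. z / of_real (\<iota> i \<delta>))"

end

theory Submission
  imports Defs "Jordan_Normal_Form.Char_Poly" "HOL-Probability.Probability"
    "HOL-Complex_Analysis.Complex_Analysis"
begin

text \<open>
  On the diagonal, the theta series of the field is the theta series of the lattice of integers with
  the quadratic form \<open>Tr(\<xi>\<^sup>2/\<delta>)\<close>. Since \<open>\<delta>\<close> generates the different, this lattice is self-dual.
  It contains an orthogonal sublattice of finite index, so its inversion formula under
  \<open>z \<mapsto> -1/(4z)\<close> follows from one-dimensional Poisson summation on each coset and the orthogonality
  of characters; it is the formula for the \<open>m\<close>-th power of the classical theta function. The quotient
  of the two functions is therefore invariant under \<open>z \<mapsto> z + 1\<close> and \<open>z \<mapsto> -1/(4z)\<close>, whose group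
  contains \<open>\<Gamma>\<^sub>0(4)\<close> up to sign, and hence the two factors of automorphy agree wherever the
  restricted series does not vanish. The transformation law of the restricted form extends to the
  remaining points by the identity theorem.

  The classical theta function has no zeros because \<open>\<theta>(z) \<theta>(z + 1/2) = \<theta>(2z + 1/2)\<^sup>2\<close>: a zero
  would propagate to points with arbitrarily large imaginary part.
\<close>

section \<open>Algebraic integers\<close>

text \<open>The hypothesis yields only one half of self-duality at once: \<open>different\<close> is
  an ideal quotient, so \<delta> \<in> \<open>different\<close> says that \<delta> times
  \<open>inverse_different\<close> consists of integers. The other half is the invertibility of the
  codifferent: a proper dual ideal would have an annihilator modulo some natural number, and this
  annihilator would enlarge the principal ideal of \<delta>. The inversion formulas involve the
  factor sqrt(2y)^m. Poisson summation is carried out on the imaginary axis only, where this is a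
  positive real, and the factor has cancelled in the quotient of the two theta functions before the
  identity theorem extends the result to the half-plane. The 4 comes from the exponent 2 pi i n^2 z:
  at z = iy the Gaussian parameter is t = 2y, and t \<mapsto> 1/t becomes y \<mapsto> 1/(4y). Zeros
  of the restricted series are the obstacle at the end: the limit defining the factor of automorphy
  is evaluated only off them, whereas the classical theta function must be free of zeros for the
  quotient to be holomorphic.\<close>

no_notation vec_index (infixl "$" 100)

text \<open>The determinant trick: the \<open>b i\<close> form an eigenvector of an integer matrix,
  whose characteristic polynomial is monic with integer coefficients and vanishes at
  \<open>x\<close>. The entry \<open>b iz\<close> keeps the eigenvector from being zero.\<close>

lemma algebraic_int_eigenvalue:
  fixes x :: "'a::field_char_0" and b :: "nat \<Rightarrow> 'a" and A :: "nat \<Rightarrow> nat \<Rightarrow> int"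
  assumes eq: "\<And>i. i < n \<Longrightarrow> x * b i = (\<Sum>j<n. of_int (A i j) * b j)"
    and nz: "iz < n" "b iz \<noteq> 0"
  shows "algebraic_int x"
proof -
  define M :: "int mat" where "M = mat n n (\<lambda>(i,j). A i j)"
  define M' :: "'a mat" where "M' = map_mat of_int M"
  define v where "v = vec n b"
  have M: "M \<in> carrier_mat n n" and M': "M' \<in> carrier_mat n n" by (auto simp: M_def M'_def)
  interpret of_int_hom: comm_ring_hom "of_int :: int \<Rightarrow> 'a" by unfold_locales auto
  have "eigenvector M' v x"
    unfolding eigenvector_def
  proof (intro conjI)
    show "v \<in> carrier_vec (dim_row M')" using M' by (auto simp: v_def)
    show "v \<noteq> 0\<^sub>v (dim_row M')"
    proof
      assume "v = 0\<^sub>v (dim_row M')"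
      hence "vec_index v iz = vec_index (0\<^sub>v n) iz" using M' by simp
      thus False using nz by (simp add: v_def)
    qed
    show "M' *\<^sub>v v = x \<cdot>\<^sub>v v"
      by (rule eq_vecI)
         (auto simp: M'_def M_def v_def scalar_prod_def eq lessThan_atLeast0)
  qed
  hence "eigenvalue M' x" unfolding eigenvalue_def by blast
  hence root: "poly (char_poly M') x = 0" using eigenvalue_root_char_poly[OF M'] by blast
  have cp: "char_poly M' = map_poly of_int (char_poly M)"
    unfolding M'_def by (rule of_int_hom.char_poly_hom[OF M])
  show ?thesis
  proof (rule algebraic_int.intros)
    show "lead_coeff (char_poly M') = 1" using degree_monic_char_poly[OF M'] by simp
    show "\<forall>i. coeff (char_poly M') i \<in> \<int>" by (simp add: cp coeff_map_poly)
    show "poly (char_poly M') x = 0" by (fact root)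
  qed
qed

hide_const (open) Matrix.mat Matrix.vec Matrix.row Matrix.col Determinant.det
hide_fact (open) Matrix.vec_eq_iff Congruence.set_eqI

lemma algebraic_int_finite_module:
  fixes x :: "'a::field_char_0" and b :: "'i \<Rightarrow> 'a" and A :: "'i \<Rightarrow> 'i \<Rightarrow> int"
  assumes fin: "finite I" and eq: "\<And>i. i \<in> I \<Longrightarrow> x * b i = (\<Sum>j\<in>I. of_int (A i j) * b j)"
    and nz: "iz \<in> I" "b iz \<noteq> 0"
  shows "algebraic_int x"
proof -
  obtain f where f: "bij_betw f {..<card I} I"
    using ex_bij_betw_nat_finite[OF fin] by (auto simp: lessThan_atLeast0)
  obtain k where k: "k < card I" "f k = iz"
    using bij_betw_imp_surj_on[OF f] nz(1) by (metis imageE lessThan_iff)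
  show ?thesis
  proof (rule algebraic_int_eigenvalue[where b = "\<lambda>i. b (f i)" and A = "\<lambda>i j. A (f i) (f j)" and iz = k])
    fix i assume "i < card I"
    hence "f i \<in> I" using f by (auto simp: bij_betw_def)
    hence "x * b (f i) = (\<Sum>j\<in>I. of_int (A (f i) j) * b j)" by (rule eq)
    also have "\<dots> = (\<Sum>j<card I. of_int (A (f i) (f j)) * b (f j))"
      by (rule sum.reindex_bij_betw[OF f, symmetric])
    finally show "x * b (f i) = (\<Sum>j<card I. of_int (A (f i) (f j)) * b (f j))" .
  qed (use k nz in auto)
qed

text \<open>Powers of \<open>x\<close> below the degree of a monic integer polynomial span a module
  stable under \<open>x\<close>. The matrix \<open>A\<close> is the companion matrix: a shift, with
  the negated lower coefficients in its last row.\<close>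

lemma algebraic_int_power_module:
  fixes x :: "'a::field_char_0"
  assumes "algebraic_int x"
  obtains n :: nat and A :: "nat \<Rightarrow> nat \<Rightarrow> int"
  where "n > 0" "\<And>i. i < n \<Longrightarrow> x * x ^ i = (\<Sum>k<n. of_int (A i k) * x ^ k)"
proof -
  obtain p :: "int poly" where p: "poly (map_poly of_int p) x = 0" "lead_coeff p = 1"
    using assms by (auto simp: algebraic_int_altdef_ipoly)
  define n where "n = degree p"
  have "n > 0"
  proof (rule ccontr)
    assume "\<not> n > 0"
    hence "p = 1" using p(2) by (metis n_def degree_eq_zeroE gr0I lead_coeff_pCons(2) one_pCons pCons_0_0)
    thus False using p(1) by simp
  qed
  have "poly (map_poly of_int p) x = (\<Sum>k\<le>n. of_int (coeff p k) * x ^ k)"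
    by (simp add: poly_altdef n_def degree_map_poly coeff_map_poly)
  also have "\<dots> = (\<Sum>k<n. of_int (coeff p k) * x ^ k) + x ^ n"
    using p(2) by (simp add: n_def lessThan_Suc_atMost[symmetric])
  finally have top: "x ^ n = (\<Sum>k<n. of_int (- coeff p k) * x ^ k)"
    using p(1) by (simp add: sum_negf eq_neg_iff_add_eq_0 add.commute)
  define A where "A i k = (if Suc i < n then (if k = Suc i then 1 else 0) else - coeff p k)" for i k
  have "x * x ^ i = (\<Sum>k<n. of_int (A i k) * x ^ k)" if "i < n" for i
  proof (cases "Suc i < n")
    case True
    have "(\<Sum>k<n. of_int (A i k) * x ^ k) = (\<Sum>k<n. if k = Suc i then x ^ k else 0)"
      using True by (intro sum.cong) (auto simp: A_def)
    also have "\<dots> = x * x ^ i" using True by simp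
    finally show ?thesis ..
  next
    case False
    hence "Suc i = n" using that by simp
    hence "x * x ^ i = x ^ n" by auto
    also note top
    finally show ?thesis using False by (simp add: A_def)
  qed
  with \<open>n > 0\<close> show ?thesis by (rule that)
qed

text \<open>The products x^i y^j span a finite module stable under \<open>x\<close> and under
  \<open>y\<close>. Multiplication by x y acts through the Kronecker product of the two companion
  matrices, multiplication by x + y through their Kronecker sum.\<close>

lemma
  fixes x y :: "'a::field_char_0"
  assumes "algebraic_int x" "algebraic_int y"
  shows algebraic_int_add: "algebraic_int (x + y)"
    and algebraic_int_mult: "algebraic_int (x * y)"
proof -
  obtain n :: nat and A :: "nat \<Rightarrow> nat \<Rightarrow> int" where n: "n > 0"
    and A: "\<And>i. i < n \<Longrightarrow> x * x ^ i = (\<Sum>k<n. of_int (A i k) * x ^ k)"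
    using algebraic_int_power_module[OF assms(1)] by blast
  obtain m :: nat and B :: "nat \<Rightarrow> nat \<Rightarrow> int" where m: "m > 0"
    and B: "\<And>i. i < m \<Longrightarrow> y * y ^ i = (\<Sum>k<m. of_int (B i k) * y ^ k)"
    using algebraic_int_power_module[OF assms(2)] by blast
  define I where "I = {..<n} \<times> {..<m}"
  define b where "b = (\<lambda>(i, j). x ^ i * y ^ j)"
  have I: "finite I" "(0, 0) \<in> I" "b (0, 0) \<noteq> 0" using n m by (auto simp: I_def b_def)
  show "algebraic_int (x * y)"
  proof (rule algebraic_int_finite_module[where I = I and iz = "(0,0)" and b = b and A = "\<lambda>(i,j) (k,l). A i k * B j l"])
    fix p assume "p \<in> I"
    then obtain i j where p: "p = (i, j)" "i < n" "j < m" by (auto simp: I_def)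
    have "x * y * b p = (x * x ^ i) * (y * y ^ j)" by (simp add: p b_def)
    also have "\<dots> = (\<Sum>k<n. \<Sum>l<m. (of_int (A i k) * x ^ k) * (of_int (B j l) * y ^ l))"
      by (simp only: A[OF p(2)] B[OF p(3)] sum_product)
    also have "\<dots> = (\<Sum>q\<in>I. of_int ((\<lambda>(i,j) (k,l). A i k * B j l) p q) * b q)"
      by (simp add: I_def sum.cartesian_product p b_def case_prod_unfold mult_ac)
    finally show "x * y * b p = (\<Sum>q\<in>I. of_int ((\<lambda>(i,j) (k,l). A i k * B j l) p q) * b q)" .
  qed (use I in auto)
  show "algebraic_int (x + y)"
  proof (rule algebraic_int_finite_module[where I = I and iz = "(0,0)" and b = b and A = "\<lambda>(i,j) (k,l). (if l = j then A i k else 0) + (if k = i then B j l else 0)"])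
    fix p assume "p \<in> I"
    then obtain i j where p: "p = (i, j)" "i < n" "j < m" by (auto simp: I_def)
    have 1: "(\<Sum>k<n. \<Sum>l<m. of_int (if l = j then A i k else 0) * (x ^ k * y ^ l)) = (x * x ^ i) * y ^ j"
    proof -
      have "(\<Sum>k<n. \<Sum>l<m. of_int (if l = j then A i k else 0) * (x ^ k * y ^ l))
          = (\<Sum>k<n. \<Sum>l<m. if l = j then of_int (A i k) * (x ^ k * y ^ j) else 0)"
        by (intro sum.cong) auto
      also have "\<dots> = (\<Sum>k<n. of_int (A i k) * x ^ k) * y ^ j"
        using p by (simp add: sum_distrib_right mult.assoc)
      finally show ?thesis by (simp only: A[OF p(2)])
    qed
    have 2: "(\<Sum>k<n. \<Sum>l<m. of_int (if k = i then B j l else 0) * (x ^ k * y ^ l)) = x ^ i * (y * y ^ j)"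
    proof -
      have "(\<Sum>k<n. \<Sum>l<m. of_int (if k = i then B j l else 0) * (x ^ k * y ^ l))
          = (\<Sum>k<n. if k = i then (\<Sum>l<m. of_int (B j l) * (x ^ i * y ^ l)) else 0)"
        by (intro sum.cong) auto
      also have "\<dots> = x ^ i * (\<Sum>l<m. of_int (B j l) * y ^ l)"
        using p by (simp add: sum_distrib_left mult_ac)
      finally show ?thesis by (simp only: B[OF p(3)])
    qed
    have "(x + y) * b p = (x * x ^ i) * y ^ j + x ^ i * (y * y ^ j)"
      by (simp add: p b_def algebra_simps)
    also have "\<dots> = (\<Sum>k<n. \<Sum>l<m. of_int ((if l = j then A i k else 0) + (if k = i then B j l else 0)) * (x ^ k * y ^ l))"
      by (simp only: 1[symmetric] 2[symmetric] sum.distrib[symmetric] of_int_add distrib_right)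
    also have "\<dots> = (\<Sum>q\<in>I. of_int ((\<lambda>(i,j) (k,l). (if l = j then A i k else 0) + (if k = i then B j l else 0)) p q) * b q)"
      unfolding I_def sum.cartesian_product p b_def by (intro sum.cong) auto
    finally show "(x + y) * b p = (\<Sum>q\<in>I. of_int ((\<lambda>(i,j) (k,l). (if l = j then A i k else 0) + (if k = i then B j l else 0)) p q) * b q)" .
  qed (use I in auto)
qed

lemma algebraic_int_sum: "(\<And>i. i \<in> I \<Longrightarrow> algebraic_int (f i :: 'a::field_char_0)) \<Longrightarrow> algebraic_int (sum f I)"
  by (induction I rule: infinite_finite_induct) (auto intro: algebraic_int_add)

section \<open>Clearing denominators\<close>

lemma finite_rat_common_denominator:
  assumes "finite I"
  obtains N :: nat where "N > 0" "\<And>i. i \<in> I \<Longrightarrow> of_nat N * (r i :: rat) \<in> \<int>"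
proof -
  have "\<exists>N::nat. N > 0 \<and> (\<forall>i\<in>I. of_nat N * r i \<in> \<int>)"
    using assms
  proof (induction I)
    case empty
    show ?case by (intro exI[of _ 1]) auto
  next
    case (insert j I)
    then obtain N :: nat where N: "N > 0" "\<forall>i\<in>I. of_nat N * r i \<in> \<int>" by blast
    obtain a b where ab: "quotient_of (r j) = (a, b)" by fastforce
    have b: "b > 0" using quotient_of_denom_pos[OF ab] .
    have r: "r j = of_int a / of_int b" using quotient_of_div[OF ab] .
    have "of_nat (nat b) * r j = of_int a" using b by (simp add: r)
    hence "of_nat (N * nat b) * r j = of_int (int N * a)" by (simp add: mult.assoc)
    moreover have "of_nat (N * nat b) * r i \<in> \<int>" if "i \<in> I" for i
    proof -
      have "of_nat (N * nat b) * r i = of_nat (nat b) * (of_nat N * r i)" by simp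
      thus ?thesis using N(2) that by (metis Ints_mult Ints_of_nat)
    qed
    ultimately show ?case using N(1) b
      by (intro exI[of _ "N * nat b"]) (auto simp del: of_nat_mult)
  qed
  thus ?thesis using that by blast
qed

text \<open>Multiplication by \<open>x\<close> acts on a finite spanning set through a rational
  matrix; a common denominator \<open>N\<close> of its entries turns \<open>N x\<close> into an
  eigenvalue of an integer matrix.\<close>

lemma number_field_integral_multiple:
  assumes "number_field TYPE('f::field_char_0)"
  obtains N :: nat where "N > 0" "of_nat N * (x :: 'f) \<in> ring_of_integers"
proof -
  obtain B :: "'f set" where B: "finite B" "rat_vs.span B = UNIV"
    using assms by (auto simp: number_field_def)
  have "\<exists>u. x * b = (\<Sum>c\<in>B. of_rat (u c) * c)" for b
  proof -
    have "x * b \<in> range (\<lambda>u. \<Sum>c\<in>B. of_rat (u c) * c)"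
      using B(2) rat_vs.span_finite[OF B(1)] by simp
    thus ?thesis by blast
  qed
  then obtain u where u: "\<And>b. x * b = (\<Sum>c\<in>B. of_rat (u b c) * c)" by metis
  obtain N :: nat where N: "N > 0" "\<And>p. p \<in> B \<times> B \<Longrightarrow> of_nat N * (case p of (b, c) \<Rightarrow> u b c) \<in> \<int>"
    using finite_rat_common_denominator[of "B \<times> B" "\<lambda>(b, c). u b c"] B(1) by auto
  have "\<exists>k. of_nat N * u b c = of_int k" if "b \<in> B" "c \<in> B" for b c
    using N(2)[of "(b, c)"] that by (auto elim: Ints_cases)
  then obtain A where A: "\<And>b c. b \<in> B \<Longrightarrow> c \<in> B \<Longrightarrow> of_nat N * u b c = of_int (A b c)" by metis
  have "\<exists>b\<in>B. b \<noteq> 0"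
  proof (rule ccontr)
    assume "\<not> (\<exists>b\<in>B. b \<noteq> 0)"
    hence "B \<subseteq> {0}" by auto
    hence "rat_vs.span B \<subseteq> {0}" using rat_vs.span_mono[of B "{0}"] by simp
    thus False using B(2) by (metis UNIV_I singletonD subsetD zero_neq_one)
  qed
  then obtain b0 where b0: "b0 \<in> B" "b0 \<noteq> 0" by blast
  have "algebraic_int (of_nat N * x)"
  proof (rule algebraic_int_finite_module[where I = B and iz = b0 and b = "\<lambda>b. b" and A = A])
    fix b assume b: "b \<in> B"
    have "of_nat N * x * b = (\<Sum>c\<in>B. of_rat (of_nat N * u b c) * c)"
      by (simp add: mult.assoc u sum_distrib_left of_rat_mult)
    also have "\<dots> = (\<Sum>c\<in>B. of_int (A b c) * c)"
      using A b by (intro sum.cong) auto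
    finally show "of_nat N * x * b = (\<Sum>c\<in>B. of_int (A b c) * c)" .
  qed (use B b0 in auto)
  with N(1) show ?thesis using that by (auto simp: ring_of_integers_def)
qed

section \<open>Closure properties of the ring of integers\<close>

lemma
  shows ring_of_integers_0: "0 \<in> ring_of_integers"
    and ring_of_integers_1: "1 \<in> ring_of_integers"
    and ring_of_integers_of_int: "of_int k \<in> ring_of_integers"
    and ring_of_integers_of_nat: "of_nat n \<in> ring_of_integers"
  by (auto simp: ring_of_integers_def intro: int_imp_algebraic_int)

lemma
  fixes x y :: "'f::field_char_0"
  assumes "x \<in> ring_of_integers"
  shows ring_of_integers_add: "y \<in> ring_of_integers \<Longrightarrow> x + y \<in> ring_of_integers"
    and ring_of_integers_mult: "y \<in> ring_of_integers \<Longrightarrow> x * y \<in> ring_of_integers"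
    and ring_of_integers_minus: "- x \<in> ring_of_integers"
    and ring_of_integers_diff: "y \<in> ring_of_integers \<Longrightarrow> x - y \<in> ring_of_integers"
    and ring_of_integers_power: "x ^ n \<in> ring_of_integers"
proof -
  show *: "- x \<in> ring_of_integers" using assms by (auto simp: ring_of_integers_def)
  show "x + y \<in> ring_of_integers" "x * y \<in> ring_of_integers" if "y \<in> ring_of_integers" for y
    using assms that by (auto simp: ring_of_integers_def algebraic_int_add algebraic_int_mult)
  show "x ^ n \<in> ring_of_integers"
    by (induction n) (use assms in \<open>auto simp: ring_of_integers_def algebraic_int_mult\<close>)
  show "x - y \<in> ring_of_integers" if "y \<in> ring_of_integers"
    using assms that algebraic_int_add[of x "- y"] by (auto simp: ring_of_integers_def)
qed

lemma ring_of_integers_sum: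
  "(\<And>i. i \<in> I \<Longrightarrow> f i \<in> ring_of_integers) \<Longrightarrow> sum f I \<in> ring_of_integers"
  by (induction I rule: infinite_finite_induct) (auto intro: ring_of_integers_add ring_of_integers_0)

lemma ring_of_integers_prod:
  "(\<And>i. i \<in> I \<Longrightarrow> f i \<in> ring_of_integers) \<Longrightarrow> prod f I \<in> ring_of_integers"
  by (induction I rule: infinite_finite_induct) (auto intro: ring_of_integers_mult ring_of_integers_1)

section \<open>Totally real fields\<close>

locale totally_real_field =
  fixes \<iota> :: "'n::finite \<Rightarrow> 'f::field_char_0 \<Rightarrow> real"
  assumes number_field: "number_field TYPE('f)"
    and degree: "field_degree TYPE('f) = CARD('n)"
    and totally_real: "totally_real TYPE('f)"
    and embeddings: "bij_betw \<iota> UNIV {\<sigma>. field_embedding \<sigma>}"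
begin

lemma field_embedding_iota: "field_embedding (\<iota> i)"
  using embeddings by (auto simp: bij_betw_def)

lemma iota_1 [simp]: "\<iota> i 1 = 1"
  and iota_add: "\<iota> i (x + y) = \<iota> i x + \<iota> i y"
  and iota_mult: "\<iota> i (x * y) = \<iota> i x * \<iota> i y"
  using field_embedding_iota[of i] by (auto simp: field_embedding_def)

lemma iota_0 [simp]: "\<iota> i 0 = 0"
  using iota_add[of i 0 0] by simp

lemma iota_minus: "\<iota> i (- x) = - \<iota> i x"
  using iota_add[of i x "- x"] by simp

lemma iota_diff: "\<iota> i (x - y) = \<iota> i x - \<iota> i y"
  using iota_add[of i x "- y"] by (simp add: iota_minus)

lemma iota_sum: "\<iota> i (sum f S) = (\<Sum>s\<in>S. \<iota> i (f s))"
  by (induction S rule: infinite_finite_induct) (auto simp: iota_add)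

lemma iota_power: "\<iota> i (x ^ k) = \<iota> i x ^ k"
  by (induction k) (auto simp: iota_mult)

lemma iota_of_nat [simp]: "\<iota> i (of_nat k) = of_nat k"
  by (induction k) (auto simp: iota_add)

lemma iota_of_int [simp]: "\<iota> i (of_int k) = of_int k"
  by (cases k rule: int_cases2) (auto simp: iota_minus)

lemma iota_inverse: "\<iota> i (inverse x) = inverse (\<iota> i x)"
proof (cases "x = 0")
  case False
  hence "\<iota> i (inverse x) * \<iota> i x = 1" by (simp add: iota_mult[symmetric])
  thus ?thesis by (metis inverse_unique mult.commute)
qed simp

lemma iota_divide: "\<iota> i (x / y) = \<iota> i x / \<iota> i y"
  by (simp add: divide_inverse iota_mult iota_inverse)

lemma iota_of_rat [simp]: "\<iota> i (of_rat r) = of_rat r"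
proof (cases r)
  case (Fract a b)
  thus ?thesis by (simp add: Fract_of_int_quotient of_rat_divide iota_divide)
qed

lemma iota_eq_0_iff [simp]: "\<iota> i x = 0 \<longleftrightarrow> x = 0"
proof
  assume *: "\<iota> i x = 0"
  show "x = 0"
  proof (rule ccontr)
    assume "x \<noteq> 0"
    hence "\<iota> i x * \<iota> i (inverse x) = 1" by (simp add: iota_mult[symmetric])
    thus False using * by simp
  qed
qed simp

lemma iota_inj: "inj \<iota>"
  using embeddings by (auto simp: bij_betw_def)

text \<open>Total reality makes every complex embedding real-valued, so its real part is again
  multiplicative and is one of the \<iota> i. The sum over complex embeddings can thus be
  reindexed.\<close>

lemma field_trace_eq: "field_trace x = of_real (\<Sum>i\<in>UNIV. \<iota> i x)"
proof -
  have "bij_betw (\<lambda>i x. complex_of_real (\<iota> i x)) UNIV {\<sigma> :: 'f \<Rightarrow> complex. field_embedding \<sigma>}"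
    unfolding bij_betw_def
  proof (rule conjI[OF _ set_eqI[OF iffI]])
    show "inj (\<lambda>i x. complex_of_real (\<iota> i x))"
      using iota_inj by (auto simp: inj_on_def fun_eq_iff)
  next
    fix \<sigma> :: "'f \<Rightarrow> complex"
    assume "\<sigma> \<in> range (\<lambda>i x. complex_of_real (\<iota> i x))"
    thus "\<sigma> \<in> {\<sigma>. field_embedding \<sigma>}"
      by (auto simp: field_embedding_def iota_add iota_mult)
  next
    fix \<sigma> :: "'f \<Rightarrow> complex"
    assume "\<sigma> \<in> {\<sigma>. field_embedding \<sigma>}"
    hence \<sigma>: "field_embedding \<sigma>" by simp
    hence real: "of_real (Re (\<sigma> x)) = \<sigma> x" for x
      using totally_real unfolding totally_real_def by (metis of_real_Re range_subsetD)
    have im: "Im (\<sigma> x) = 0" for x by (metis real Im_complex_of_real)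
    have "field_embedding (\<lambda>x. Re (\<sigma> x))"
      using \<sigma> by (auto simp: field_embedding_def im)
    then obtain i where "\<iota> i = (\<lambda>x. Re (\<sigma> x))"
      using embeddings by (auto simp: bij_betw_def set_eq_iff image_iff) metis
    hence "\<sigma> = (\<lambda>x. complex_of_real (\<iota> i x))" using real by auto
    thus "\<sigma> \<in> range (\<lambda>i x. complex_of_real (\<iota> i x))" by blast
  qed
  from sum.reindex_bij_betw[OF this, of "\<lambda>\<sigma>. \<sigma> x"] show ?thesis
    by (simp add: field_trace_def)
qed

text \<open>Dedekind's argument: evaluate the relation at y x and subtract \<iota> j y times the
  relation at x. The j-th term disappears, and a \<open>y\<close> separating \<iota> k from \<iota>
  j shows that the k-th coefficient is 0.\<close>

lemma embeddings_independent:
  assumes "\<And>x. (\<Sum>i\<in>S. c i * \<iota> i x) = 0" "i \<in> S"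
  shows "c i = 0"
proof -
  have "finite S" by simp
  thus ?thesis using assms
  proof (induction S arbitrary: c i)
    case (insert j S c i)
    have zero: "c k = 0" if k: "k \<in> S" for k
    proof -
      have "k \<noteq> j" using k insert by auto
      hence "\<iota> k \<noteq> \<iota> j" using iota_inj by (auto simp: inj_on_def)
      then obtain y where y: "\<iota> k y \<noteq> \<iota> j y" by (auto simp: fun_eq_iff)
      have "c k * (\<iota> k y - \<iota> j y) = 0"
      proof (rule insert.IH[OF _ k, where c = "\<lambda>k. c k * (\<iota> k y - \<iota> j y)"])
        fix x
        have "(\<Sum>l\<in>S. c l * (\<iota> l y - \<iota> j y) * \<iota> l x) = (\<Sum>l\<in>insert j S. c l * (\<iota> l y - \<iota> j y) * \<iota> l x)"
          using insert.hyps by simp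
        also have "\<dots> = (\<Sum>l\<in>insert j S. c l * \<iota> l (y * x)) - \<iota> j y * (\<Sum>l\<in>insert j S. c l * \<iota> l x)"
          unfolding sum_distrib_left sum_subtractf[symmetric]
          by (intro sum.cong) (auto simp: iota_mult algebra_simps)
        also have "\<dots> = 0" by (simp only: insert.prems mult_zero_right diff_self)
        finally show "(\<Sum>l\<in>S. c l * (\<iota> l y - \<iota> j y) * \<iota> l x) = 0" .
      qed
      thus ?thesis using y by simp
    qed
    have "c j = 0" using insert.prems(1)[of 1] insert.hyps zero by simp
    thus ?case using zero insert.prems(2) by auto
  qed simp
qed

text \<open>In a rational basis, multiplication by \<open>x\<close> has a rational matrix
  \<open>A\<close>. The matrix \<open>M\<close> of conjugates of the basis conjugates
  \<open>A\<close> to the diagonal matrix \<open>D\<close> of conjugates of \<open>x\<close>, so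
  both have the same trace.\<close>

lemma trace_rational: "(\<Sum>i\<in>UNIV. \<iota> i x) \<in> \<rat>"
proof -
  obtain B :: "'f set" where B: "rat_vs.independent B" "rat_vs.span B = UNIV" "card B = CARD('n)"
  proof -
    obtain B :: "'f set" where "rat_vs.independent B" "UNIV \<subseteq> rat_vs.span B" "card B = rat_vs.dim (UNIV :: 'f set)"
      using rat_vs.basis_exists[of "UNIV :: 'f set"] by metis
    thus ?thesis using that[of B] degree by (auto simp: field_degree_def)
  qed
  have fin: "finite B" using B(3) by (metis card.infinite finite_UNIV_card_ge_0 finite_class.finite_UNIV less_irrefl)
  obtain b where b: "bij_betw b (UNIV :: 'n set) B"
    using finite_same_card_bij[of "UNIV :: 'n set" B] fin B(3) by auto
  have span: "\<exists>u. y = (\<Sum>k\<in>UNIV. of_rat (u k) * b k)" for y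
  proof -
    have "y \<in> range (\<lambda>u. \<Sum>c\<in>B. of_rat (u c) * c)"
      using B(2) rat_vs.span_finite[OF fin] by simp
    then obtain u where "y = (\<Sum>c\<in>B. of_rat (u c) * c)" by blast
    also have "\<dots> = (\<Sum>k\<in>UNIV. of_rat (u (b k)) * b k)"
      by (rule sum.reindex_bij_betw[OF b, symmetric])
    finally show ?thesis by (rule exI[of _ "\<lambda>k. u (b k)"])
  qed
  have "\<forall>j. \<exists>u. x * b j = (\<Sum>k\<in>UNIV. of_rat (u k) * b k)" using span by blast
  then obtain a where a: "\<And>j. x * b j = (\<Sum>k\<in>UNIV. of_rat (a j k) * b k)" by metis
  define M :: "real^'n^'n" where "M = (\<chi> i j. \<iota> i (b j))"
  define A :: "real^'n^'n" where "A = (\<chi> k j. of_rat (a j k))"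
  define D :: "real^'n^'n" where "D = (\<chi> i j. if i = j then \<iota> i x else 0)"
  have DM: "D ** M = M ** A"
  proof -
    have "(D ** M) $ i $ j = (M ** A) $ i $ j" for i j
    proof -
      have "(D ** M) $ i $ j = (\<Sum>k\<in>UNIV. if k = i then \<iota> i x * \<iota> i (b j) else 0)"
        unfolding matrix_matrix_mult_def D_def M_def vec_lambda_beta by (rule sum.cong) auto
      also have "\<dots> = \<iota> i (x * b j)" by (simp add: iota_mult)
      also have "\<dots> = (M ** A) $ i $ j"
        unfolding a iota_sum by (simp add: matrix_matrix_mult_def M_def A_def iota_mult mult.commute)
      finally show ?thesis .
    qed
    thus ?thesis by (simp add: vec_eq_iff)
  qed
  \<comment> \<open>A dependence among the rows is a relation between the embeddings on a rational
    basis, hence on the whole field, which \<open>embeddings_independent\<close> excludes.\<close>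
  have "\<exists>M'. M ** M' = mat 1"
    unfolding matrix_right_invertible_independent_rows
  proof (intro allI impI)
    fix c i assume c: "(\<Sum>i\<in>UNIV. c i *s row i M) = 0"
    show "c i = 0"
    proof (rule embeddings_independent[where S = UNIV])
      fix y
      obtain u where y: "y = (\<Sum>k\<in>UNIV. of_rat (u k) * b k)" using span by blast
      have col: "(\<Sum>i\<in>UNIV. c i * \<iota> i (b k)) = 0" for k
        using arg_cong[OF c, of "\<lambda>v. v $ k"] by (simp add: Finite_Cartesian_Product.row_def M_def)
      have "(\<Sum>i\<in>UNIV. c i * \<iota> i y) = (\<Sum>i\<in>UNIV. \<Sum>k\<in>UNIV. of_rat (u k) * (c i * \<iota> i (b k)))"
        unfolding y iota_sum sum_distrib_left by (simp add: iota_mult mult_ac)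
      also have "\<dots> = (\<Sum>k\<in>UNIV. of_rat (u k) * (\<Sum>i\<in>UNIV. c i * \<iota> i (b k)))"
        by (subst sum.swap) (simp add: sum_distrib_left)
      finally show "(\<Sum>i\<in>UNIV. c i * \<iota> i y) = 0" by (simp add: col)
    qed simp
  qed
  then obtain M' where M': "M ** M' = mat 1" by blast
  hence M'': "M' ** M = mat 1" using matrix_left_right_inverse by blast
  have "D = D ** (M ** M')" by (simp add: M')
  also have "\<dots> = M ** (A ** M')" by (simp add: matrix_mul_assoc DM)
  finally have "trace D = trace (M ** (A ** M'))" by simp
  also have "\<dots> = trace ((A ** M') ** M)" by (rule trace_mul_sym)
  also have "\<dots> = trace A" by (simp add: matrix_mul_assoc[symmetric] M'')
  finally have "(\<Sum>i\<in>UNIV. \<iota> i x) = (\<Sum>i\<in>UNIV. of_rat (a i i))"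
    by (simp add: Determinants.trace_def D_def A_def)
  moreover have "(\<Sum>i\<in>UNIV. real_of_rat (a i i)) \<in> \<rat>" by (intro Rats_sum) simp
  ultimately show ?thesis by simp
qed

lemma iota_algebraic_int:
  assumes "x \<in> ring_of_integers"
  shows "algebraic_int (\<iota> i x)"
proof -
  obtain p :: "int poly" where p: "poly (map_poly of_int p) x = 0" "lead_coeff p = 1"
    using assms by (auto simp: algebraic_int_altdef_ipoly ring_of_integers_def)
  have "poly (map_poly of_int p) (\<iota> i x) = \<iota> i (poly (map_poly of_int p) x)"
    by (simp add: poly_altdef coeff_map_poly degree_map_poly iota_sum iota_mult iota_power)
  thus ?thesis using p by (auto simp: algebraic_int_altdef_ipoly)
qed

lemma trace_int:
  assumes "x \<in> ring_of_integers"
  shows "(\<Sum>i\<in>UNIV. \<iota> i x) \<in> \<int>"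
  by (rule rational_algebraic_int_is_int[OF _ trace_rational])
     (intro algebraic_int_sum iota_algebraic_int assms)

lemma inverse_different_iff:
  "x \<in> inverse_different \<longleftrightarrow> (\<forall>y\<in>ring_of_integers. (\<Sum>i\<in>UNIV. \<iota> i (x * y)) \<in> \<int>)"
proof -
  have "complex_of_real r \<in> \<int> \<longleftrightarrow> r \<in> \<int>" for r
    by (metis Ints_cases Ints_of_int Re_complex_of_real of_real_of_int_eq)
  thus ?thesis by (simp add: inverse_different_def field_trace_eq del: of_real_sum)
qed
end

section \<open>The twisted trace form and its orthogonal bases\<close>

locale principal_different = totally_real_field \<iota>
  for \<iota> :: "'n::finite \<Rightarrow> 'f::field_char_0 \<Rightarrow> real" +
  fixes \<delta> :: 'f
  assumes different_eq: "different = principal_ideal \<delta>"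
    and iota_delta_pos: "\<iota> i \<delta> > 0"
begin

text \<open>This is Tr(xy/\<delta>). Total positivity of \<delta> keeps it positive definite, and
  its quadratic form supplies the exponents of the theta series on the diagonal.\<close>

definition pairing :: "'f \<Rightarrow> 'f \<Rightarrow> real" where
  "pairing x y = (\<Sum>i\<in>UNIV. \<iota> i x * \<iota> i y / \<iota> i \<delta>)"

lemma delta_nonzero: "\<delta> \<noteq> 0"
  using iota_delta_pos[of undefined] by auto

lemma pairing_eq_trace: "pairing x y = (\<Sum>i\<in>UNIV. \<iota> i (x * y / \<delta>))"
  by (simp add: pairing_def iota_mult iota_divide)

lemma pairing_commute: "pairing x y = pairing y x"
  by (simp add: pairing_def mult.commute)

lemma pairing_add_left: "pairing (x + y) z = pairing x z + pairing y z"
  by (simp add: pairing_def iota_add ring_distribs add_divide_distrib sum.distrib)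

lemma pairing_diff_left: "pairing (x - y) z = pairing x z - pairing y z"
  by (simp add: pairing_def iota_diff left_diff_distrib diff_divide_distrib sum_subtractf)

lemma pairing_scale_left: "pairing (of_rat r * x) z = of_rat r * pairing x z"
  by (simp add: pairing_def iota_mult sum_distrib_left mult.assoc)

lemma pairing_mult_left: "pairing (x * y) z = pairing x (y * z)"
  by (simp add: pairing_def iota_mult mult_ac)

lemma pairing_0_left [simp]: "pairing 0 z = 0"
  by (simp add: pairing_def)

lemma pairing_sum_left: "pairing (sum f S) z = (\<Sum>s\<in>S. pairing (f s) z)"
  by (induction S rule: infinite_finite_induct) (auto simp: pairing_add_left)

lemma pairing_rational: "pairing x y \<in> \<rat>"
  unfolding pairing_eq_trace by (rule trace_rational)

lemma pairing_pos: "x \<noteq> 0 \<Longrightarrow> pairing x x > 0"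
  unfolding pairing_def
proof (intro sum_pos divide_pos_pos iota_delta_pos)
  fix i assume "x \<noteq> 0"
  hence "(\<iota> i x)\<^sup>2 > 0" by simp
  thus "\<iota> i x * \<iota> i x > 0" by (simp only: power2_eq_square)
qed simp_all

text \<open>Without normalisation the process stays inside the rational vector space, since the
  projection coefficients are quotients of rational traces. A vector whose residue \<open>c\<close>
  vanishes is dropped, which keeps 0 out of \<open>V\<close>.\<close>

lemma gram_schmidt:
  assumes "finite S"
  shows "\<exists>V. finite V \<and> 0 \<notin> V \<and> pairwise (\<lambda>x y. pairing x y = 0) V \<and> rat_vs.span V = rat_vs.span S"
  using assms
proof (induction S)
  case empty
  show ?case by (intro exI[of _ "{}"]) auto
next
  case (insert b S)
  then obtain V where V: "finite V" "0 \<notin> V" "pairwise (\<lambda>x y. pairing x y = 0) V"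
    "rat_vs.span V = rat_vs.span S" by blast
  have "\<exists>r. of_rat r = pairing b v / pairing v v" for v
    using Rats_divide[OF pairing_rational pairing_rational] by (metis Rats_cases)
  then obtain r where r: "\<And>v. of_rat (r v) = pairing b v / pairing v v" by metis
  define p where "p = (\<Sum>v\<in>V. of_rat (r v) * v)"
  define c where "c = b - p"
  have p: "p \<in> rat_vs.span V"
    unfolding p_def by (intro rat_vs.span_sum rat_vs.span_scale rat_vs.span_base)
  have orth: "pairing c v = 0" if v: "v \<in> V" for v
  proof -
    have "pairing p v = (\<Sum>w\<in>V. of_rat (r w) * pairing w v)"
      by (simp add: p_def pairing_sum_left pairing_scale_left)
    also have "\<dots> = (\<Sum>w\<in>V. if w = v then pairing b v else 0)"
    proof (intro sum.cong refl)
      fix w assume "w \<in> V"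
      show "of_rat (r w) * pairing w v = (if w = v then pairing b v else 0)"
      proof (cases "w = v")
        case True
        moreover have "pairing v v > 0" using v V(2) by (intro pairing_pos) auto
        ultimately show ?thesis by (simp add: r)
      next
        case False
        hence "pairing w v = 0" using V(3) \<open>w \<in> V\<close> v by (auto simp: pairwise_def)
        thus ?thesis using False by simp
      qed
    qed
    also have "\<dots> = pairing b v" using v V(1) by simp
    finally show ?thesis by (simp add: c_def pairing_diff_left)
  qed
  have b_eq: "b = c + p" by (simp add: c_def)
  show ?case
  proof (cases "c = 0")
    case True
    hence "b \<in> rat_vs.span S" using p V(4) b_eq by simp
    hence "rat_vs.span (insert b S) = rat_vs.span S" by (rule rat_vs.span_redundant)
    thus ?thesis using V by auto
  next
    case False
    have "rat_vs.span (insert c V) = rat_vs.span (insert b S)"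
    proof -
      have "rat_vs.span (insert c V) = rat_vs.span (insert b V)"
        by (rule rat_vs.eq_span_insert_eq) (use p in \<open>simp add: c_def rat_vs.span_neg\<close>)
      also have "\<dots> = rat_vs.span (insert b S)"
        using V(4) by (simp add: rat_vs.span_insert)
      finally show ?thesis .
    qed
    moreover have "pairwise (\<lambda>x y. pairing x y = 0) (insert c V)"
      using V(3) orth by (auto simp: pairwise_insert) (metis pairing_commute)
    ultimately show ?thesis using V False by (intro exI[of _ "insert c V"]) auto
  qed
qed

lemma orthogonal_basis_exists:
  "\<exists>v :: 'n \<Rightarrow> 'f. (\<forall>j. v j \<in> ring_of_integers \<and> v j \<noteq> 0) \<and>
     (\<forall>j k. j \<noteq> k \<longrightarrow> pairing (v j) (v k) = 0) \<and>
     (\<forall>j. \<forall>y\<in>ring_of_integers. pairing (v j) y \<in> \<int>) \<and>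
     (\<forall>x. \<exists>r. x = (\<Sum>j\<in>UNIV. of_rat (r j) * v j))"
proof -
  obtain S :: "'f set" where S: "finite S" "rat_vs.span S = UNIV"
    using number_field by (auto simp: number_field_def)
  obtain V where V: "finite V" "0 \<notin> V" "pairwise (\<lambda>x y. pairing x y = 0) V" "rat_vs.span V = UNIV"
    using gram_schmidt[OF S(1)] S(2) by metis
  have "rat_vs.independent V"
  proof (rule rat_vs.independent_if_scalars_zero[OF V(1)])
    fix f x assume f: "(\<Sum>x\<in>V. of_rat (f x) * x) = 0" and x: "x \<in> V"
    have "0 = pairing (\<Sum>x\<in>V. of_rat (f x) * x) x" by (simp add: f)
    also have "\<dots> = (\<Sum>w\<in>V. of_rat (f w) * pairing w x)"
      by (simp add: pairing_sum_left pairing_scale_left)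
    also have "\<dots> = (\<Sum>w\<in>V. if w = x then of_rat (f x) * pairing x x else 0)"
      using V(3) x by (intro sum.cong) (auto simp: pairwise_def)
    also have "\<dots> = of_rat (f x) * pairing x x" using V(1) x by simp
    finally have "of_rat (f x) * pairing x x = 0" by simp
    moreover have "pairing x x > 0" using x V(2) by (intro pairing_pos) auto
    ultimately show "f x = 0" by simp
  qed
  hence "card V = rat_vs.dim (UNIV :: 'f set)"
    using rat_vs.dim_eq_card[of V UNIV] V(4) by simp
  hence "card V = CARD('n)" using degree by (simp add: field_degree_def)
  then obtain b where b: "bij_betw b (UNIV :: 'n set) V"
    using finite_same_card_bij[of "UNIV :: 'n set" V] V(1) by auto
  obtain M :: nat where M: "M > 0" "of_nat M * (1 / \<delta>) \<in> ring_of_integers"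
    by (rule number_field_integral_multiple[OF number_field, of "1 / \<delta>"])
  have "\<exists>N::nat. N > 0 \<and> of_nat N * b j \<in> ring_of_integers" for j
    by (rule number_field_integral_multiple[OF number_field, of "b j"]) blast
  then obtain N :: "'n \<Rightarrow> nat" where N: "\<And>j. N j > 0" "\<And>j. of_nat (N j) * b j \<in> ring_of_integers"
    by metis
  \<comment> \<open>The factor \<open>N j\<close> makes \<open>b j\<close> integral, and
    \<open>M\<close> absorbs 1/\<delta>: then v j / \<delta> is integral too, so the pairings of
    \<open>v j\<close> with integers are traces of integers.\<close>
  define v where "v j = of_nat (M * N j) * b j" for j
  have bV: "b j \<in> V" for j using b by (auto simp: bij_betw_def)
  show ?thesis
  proof (intro exI[of _ v] conjI allI impI ballI)
    fix j
    show "v j \<in> ring_of_integers"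
      using ring_of_integers_mult[OF ring_of_integers_of_nat[of M] N(2)[of j]]
      by (simp add: v_def mult.assoc)
    show "v j \<noteq> 0" using bV[of j] V(2) M N(1)[of j] by (auto simp: v_def)
    fix k assume "j \<noteq> k"
    hence "b j \<noteq> b k" using b by (auto simp: bij_betw_def inj_on_def)
    hence 0: "pairing (b j) (b k) = 0" using V(3) bV by (auto simp: pairwise_def)
    have "pairing (v j) (v k) = of_nat (M * N j) * (of_nat (M * N k) * pairing (b j) (b k))"
    proof -
      have v: "v l = of_rat (of_nat (M * N l)) * b l" for l by (simp add: v_def of_rat_mult)
      show ?thesis
        unfolding v pairing_scale_left pairing_commute[of "b j" "of_rat _ * _"]
        by (simp add: pairing_commute of_rat_mult)
    qed
    thus "pairing (v j) (v k) = 0" using 0 by simp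
  next
    fix j y assume y: "y \<in> (ring_of_integers :: 'f set)"
    have eq: "v j * y / \<delta> = of_nat (N j) * b j * (of_nat M * (1 / \<delta>)) * y"
      by (simp add: v_def)
    show "pairing (v j) y \<in> \<int>"
      unfolding pairing_eq_trace eq by (intro trace_int ring_of_integers_mult N M y)
  next
    fix x
    have "x \<in> range (\<lambda>u. \<Sum>c\<in>V. of_rat (u c) * c)"
      using V(4) rat_vs.span_finite[OF V(1)] by simp
    then obtain u where "x = (\<Sum>c\<in>V. of_rat (u c) * c)" by blast
    also have "\<dots> = (\<Sum>k\<in>UNIV. of_rat (u (b k)) * b k)"
      by (rule sum.reindex_bij_betw[OF b, symmetric])
    also have "\<dots> = (\<Sum>k\<in>UNIV. of_rat (u (b k) / of_nat (M * N k)) * v k)"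
    proof (rule sum.cong[OF refl])
      fix k
      have "of_nat (M * N k) \<noteq> (0 :: 'f)" using M(1) N(1)[of k] by simp
      thus "of_rat (u (b k)) * b k = of_rat (u (b k) / of_nat (M * N k)) * v k"
        unfolding v_def of_rat_divide of_rat_of_nat_eq
        by (metis (no_types, lifting) mult.assoc nonzero_eq_divide_eq)
    qed
    finally show "\<exists>r. x = (\<Sum>j\<in>UNIV. of_rat (r j) * v j)"
      by (rule exI[of _ "\<lambda>k. u (b k) / of_nat (M * N k)"])
  qed
qed

section \<open>Integer coordinates with respect to an orthogonal basis\<close>

definition obasis :: "'n \<Rightarrow> 'f" where
  "obasis = (SOME v. (\<forall>j. v j \<in> ring_of_integers \<and> v j \<noteq> 0) \<and>
     (\<forall>j k. j \<noteq> k \<longrightarrow> pairing (v j) (v k) = 0) \<and>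
     (\<forall>j. \<forall>y\<in>ring_of_integers. pairing (v j) y \<in> \<int>) \<and>
     (\<forall>x. \<exists>r. x = (\<Sum>j\<in>UNIV. of_rat (r j) * v j)))"

lemma obasis_integral: "obasis j \<in> ring_of_integers"
  and obasis_nonzero: "obasis j \<noteq> 0"
  and obasis_orthogonal: "j \<noteq> k \<Longrightarrow> pairing (obasis j) (obasis k) = 0"
  and pairing_obasis_int: "y \<in> ring_of_integers \<Longrightarrow> pairing (obasis j) y \<in> \<int>"
  and obasis_span: "\<exists>r. x = (\<Sum>j\<in>UNIV. of_rat (r j) * obasis j)"
proof -
  note * = someI_ex[OF orthogonal_basis_exists, folded obasis_def]
  show "obasis j \<in> ring_of_integers" "obasis j \<noteq> 0"
    using conjunct1[OF *] by simp_all
  show "pairing (obasis j) (obasis k) = 0" if "j \<noteq> k"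
    using conjunct1[OF conjunct2[OF *]] that by simp
  show "pairing (obasis j) y \<in> \<int>" if "y \<in> ring_of_integers"
    using conjunct1[OF conjunct2[OF conjunct2[OF *]]] that by simp
  show "\<exists>r. x = (\<Sum>j\<in>UNIV. of_rat (r j) * obasis j)"
    using conjunct2[OF conjunct2[OF conjunct2[OF *]]] by (rule spec)
qed

text \<open>The squared length is already an integer, by \<open>pairing_obasis_int\<close>; the
  floor merely gives it the type \<open>int\<close>.\<close>

definition sqlen :: "'n \<Rightarrow> int" where
  "sqlen j = \<lfloor>pairing (obasis j) (obasis j)\<rfloor>"

lemma of_int_sqlen: "of_int (sqlen j) = pairing (obasis j) (obasis j)"
  using pairing_obasis_int[OF obasis_integral[of j], of j] by (metis sqlen_def Ints_cases floor_of_int)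

lemma sqlen_pos: "sqlen j > 0"
  using pairing_pos[OF obasis_nonzero[of j]] unfolding of_int_sqlen[symmetric] by simp

text \<open>Coordinates in the basis dual to \<open>obasis\<close>. Every integer of the field has
  integral coordinates here, while the converse can fail: the coordinate vectors of integers form
  the lattice used later.\<close>

definition lattice_point :: "('n \<Rightarrow> int) \<Rightarrow> 'f" where
  "lattice_point n = (\<Sum>j\<in>UNIV. of_int (n j) / of_int (sqlen j) * obasis j)"

definition coords :: "'f \<Rightarrow> 'n \<Rightarrow> int" where
  "coords x j = \<lfloor>pairing x (obasis j)\<rfloor>"

lemma pairing_obasis_sum:
  "pairing (\<Sum>j\<in>UNIV. of_rat (r j) * obasis j) (obasis k) = of_rat (r k) * of_int (sqlen k)"
proof -
  have "pairing (\<Sum>j\<in>UNIV. of_rat (r j) * obasis j) (obasis k) = (\<Sum>j\<in>UNIV. of_rat (r j) * pairing (obasis j) (obasis k))"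
    by (simp add: pairing_sum_left pairing_scale_left)
  also have "\<dots> = (\<Sum>j\<in>UNIV. if j = k then of_rat (r k) * of_int (sqlen k) else 0)"
    by (intro sum.cong) (auto simp: obasis_orthogonal of_int_sqlen)
  finally show ?thesis by simp
qed

lemma lattice_point_altdef: "lattice_point n = (\<Sum>j\<in>UNIV. of_rat (of_int (n j) / of_int (sqlen j)) * obasis j)"
  by (simp add: lattice_point_def of_rat_divide)

lemma pairing_lattice_point_obasis: "pairing (lattice_point n) (obasis k) = of_int (n k)"
  using sqlen_pos[of k] unfolding lattice_point_altdef pairing_obasis_sum by (simp add: of_rat_divide)

lemma coords_lattice_point [simp]: "coords (lattice_point n) = n"
  by (simp add: coords_def pairing_lattice_point_obasis fun_eq_iff)

lemma lattice_point_coords: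
  assumes "x \<in> ring_of_integers"
  shows "lattice_point (coords x) = x"
proof -
  obtain r where r: "x = (\<Sum>j\<in>UNIV. of_rat (r j) * obasis j)" using obasis_span by blast
  have "of_rat (of_int (coords x j) / of_int (sqlen j)) = (of_rat (r j) :: real)" for j
  proof -
    have "real_of_int (coords x j) = pairing x (obasis j)"
      using pairing_obasis_int[OF assms, of j] by (auto simp: coords_def pairing_commute elim: Ints_cases)
    also have "\<dots> = of_rat (r j) * of_int (sqlen j)" unfolding r by (rule pairing_obasis_sum)
    finally show ?thesis using sqlen_pos[of j] by (simp add: of_rat_divide)
  qed
  hence "of_int (coords x j) / of_int (sqlen j) = r j" for j by (simp only: of_rat_eq_iff)
  thus ?thesis by (simp add: lattice_point_altdef r[symmetric])
qed

lemma pairing_lattice_points: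
  "pairing (lattice_point n) (lattice_point k) = (\<Sum>j\<in>UNIV. of_int (n j * k j) / of_int (sqlen j))"
proof -
  have "pairing (lattice_point n) (lattice_point k)
      = (\<Sum>j\<in>UNIV. of_rat (of_int (n j) / of_int (sqlen j)) * pairing (lattice_point k) (obasis j))"
    unfolding lattice_point_altdef[of n] pairing_sum_left pairing_scale_left
    by (simp only: pairing_commute[of "lattice_point k"])
  thus ?thesis by (simp add: pairing_lattice_point_obasis of_rat_divide mult_ac)
qed

lemma lattice_point_diff: "lattice_point (\<lambda>j. n j - k j) = lattice_point n - lattice_point k"
  by (simp add: lattice_point_def diff_divide_distrib left_diff_distrib sum_subtractf)

text \<open>Coordinates divisible by the squared lengths describe the sublattice spanned by the
  orthogonal basis itself, which consists of integers.\<close>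

lemma lattice_point_sqlen_mult: "lattice_point (\<lambda>j. sqlen j * k j) \<in> ring_of_integers"
proof -
  have nz: "of_int (sqlen j) \<noteq> (0 :: 'f)" for j
    using sqlen_pos[of j] by (metis less_irrefl of_int_eq_0_iff)
  have "lattice_point (\<lambda>j. sqlen j * k j) = (\<Sum>j\<in>UNIV. of_int (k j) * obasis j)"
    unfolding lattice_point_def of_int_mult
    by (rule sum.cong[OF refl]) (simp only: nonzero_mult_div_cancel_left[OF nz])
  also have "\<dots> \<in> ring_of_integers"
    by (intro ring_of_integers_sum ring_of_integers_mult ring_of_integers_of_int obasis_integral)
  finally show ?thesis .
qed

end

section \<open>Self-duality of the ring of integers\<close>

context principal_different
begin

definition dual_lattice :: "'f set" where
  "dual_lattice = {x. \<forall>y\<in>ring_of_integers. pairing x y \<in> \<int>}"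

lemma dual_lattice_iff: "x \<in> dual_lattice \<longleftrightarrow> x / \<delta> \<in> inverse_different"
  by (simp add: dual_lattice_def inverse_different_iff pairing_eq_trace)

lemma dual_lattice_subset: "dual_lattice \<subseteq> ring_of_integers"
proof
  fix x assume "x \<in> dual_lattice"
  hence x: "x / \<delta> \<in> inverse_different" by (simp add: dual_lattice_iff)
  have "\<delta> \<in> different"
    unfolding different_eq principal_ideal_def using ring_of_integers_1 by force
  hence "\<delta> * (x / \<delta>) \<in> ring_of_integers" using x by (auto simp: different_def)
  thus "x \<in> ring_of_integers" using delta_nonzero by simp
qed

lemma dual_lattice_add: "x \<in> dual_lattice \<Longrightarrow> y \<in> dual_lattice \<Longrightarrow> x + y \<in> dual_lattice"
  by (auto simp: dual_lattice_def pairing_add_left)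

lemma dual_lattice_mult: "x \<in> dual_lattice \<Longrightarrow> a \<in> ring_of_integers \<Longrightarrow> x * a \<in> dual_lattice"
  by (simp add: dual_lattice_def pairing_mult_left ring_of_integers_mult)

text \<open>This natural number will be the modulus of the finite ring in which the dual lattice
  becomes an ideal.\<close>

lemma dual_lattice_contains_nat: "\<exists>M::nat. M > 0 \<and> of_nat M \<in> dual_lattice"
proof -
  obtain M :: nat where M: "M > 0" "of_nat M * (1 / \<delta>) \<in> ring_of_integers"
    by (rule number_field_integral_multiple[OF number_field, of "1 / \<delta>"])
  have "pairing (of_nat M) y \<in> \<int>" if "y \<in> ring_of_integers" for y
    using trace_int[OF ring_of_integers_mult[OF M(2) that]] by (simp add: pairing_eq_trace)
  thus ?thesis using M(1) by (auto simp: dual_lattice_def)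
qed

text \<open>Reducing the j-th dual coordinate modulo M times \<open>sqlen j\<close> is finite, and
  vectors with equal reductions differ by M times a point of the orthogonal sublattice. The classes
  may be finer than those modulo M.\<close>

lemma finite_residue_classes:
  assumes M: "(M :: nat) > 0"
  obtains c :: "'f \<Rightarrow> 'n \<Rightarrow> int" where "finite (c ` ring_of_integers)"
    "\<And>x y. x \<in> ring_of_integers \<Longrightarrow> y \<in> ring_of_integers \<Longrightarrow> c x = c y \<Longrightarrow>
       \<exists>a\<in>ring_of_integers. x - y = of_nat M * a"
proof -
  define c where "c x j = coords x j mod (int M * sqlen j)" for x j
  have "c ` ring_of_integers \<subseteq> (\<Pi>\<^sub>E j\<in>UNIV. {0..<int M * sqlen j})"
    using M sqlen_pos by (auto simp: c_def)
  hence fin: "finite (c ` ring_of_integers)"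
    by (rule finite_subset) (auto intro!: finite_PiE)
  have "\<exists>a\<in>ring_of_integers. x - y = of_nat M * a"
    if xy: "x \<in> ring_of_integers" "y \<in> ring_of_integers" and eq: "c x = c y" for x y
  proof -
    have "int M * sqlen j dvd coords x j - coords y j" for j
      using fun_cong[OF eq, of j] unfolding c_def by (rule mod_eq_dvd_iff[THEN iffD1])
    hence "\<forall>j. \<exists>k. coords x j - coords y j = int M * sqlen j * k" by (auto simp: dvd_def)
    then obtain k where k: "\<And>j. coords x j - coords y j = int M * sqlen j * k j" by metis
    have "x - y = lattice_point (\<lambda>j. coords x j - coords y j)"
      by (simp add: lattice_point_diff lattice_point_coords xy)
    also have "\<dots> = of_nat M * lattice_point (\<lambda>j. sqlen j * k j)"
      unfolding lattice_point_def sum_distrib_left k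
      by (rule sum.cong[OF refl]) (simp only: of_int_mult of_int_of_nat_eq divide_inverse mult.assoc)
    finally show ?thesis using lattice_point_sqlen_mult by blast
  qed
  with fin show ?thesis by (rule that)
qed

text \<open>
  A proper ideal \<open>J\<close> of a finite ring has a nonzero annihilator. Every \<open>x \<in> J\<close> satisfies
  \<open>x\<^sup>i (1 - x\<^sup>p) = 0\<close> for some \<open>i\<close> and \<open>p > 0\<close>; the product of the factors \<open>1 - x\<^sup>p\<close> is nonzero, being
  congruent to 1 modulo \<open>J\<close>, and each \<open>x\<close> acts nilpotently on it.
\<close>

lemma one_in_dual_lattice: "1 \<in> dual_lattice"
proof (rule ccontr)
  assume notin: "1 \<notin> dual_lattice"
  obtain M :: nat where M: "M > 0" "of_nat M \<in> dual_lattice"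
    using dual_lattice_contains_nat by blast
  define I where "I = (\<lambda>a::'f. of_nat M * a) ` ring_of_integers"
  have I_mult: "x * a \<in> I" if "x \<in> I" "a \<in> ring_of_integers" for x a
    using that by (auto simp: I_def ring_of_integers_mult mult.assoc)
  have I_add: "x + y \<in> I" if xy: "x \<in> I" "y \<in> I" for x y
  proof -
    from xy obtain a b where "x = of_nat M * a" "y = of_nat M * b" "a \<in> ring_of_integers" "b \<in> ring_of_integers"
      by (auto simp: I_def)
    thus ?thesis by (auto simp: I_def ring_of_integers_add image_iff distrib_left[symmetric])
  qed
  have I_dual: "I \<subseteq> dual_lattice" using M(2) by (auto simp: I_def dual_lattice_mult)
  obtain c :: "'f \<Rightarrow> 'n \<Rightarrow> int" where c: "finite (c ` ring_of_integers)"
    "\<And>x y. x \<in> ring_of_integers \<Longrightarrow> y \<in> ring_of_integers \<Longrightarrow> c x = c y \<Longrightarrow>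
       \<exists>a\<in>ring_of_integers. x - y = of_nat M * a"
    using finite_residue_classes[OF M(1)] by blast
  have cI: "x - y \<in> I" if "x \<in> ring_of_integers" "y \<in> ring_of_integers" "c x = c y" for x y
    using c(2)[OF that] by (auto simp: I_def)
  \<comment> \<open>The finite set \<open>X\<close> meets every class of the dual lattice modulo
    \<open>I\<close>, so annihilating \<open>X\<close> modulo \<open>I\<close> annihilates the whole
    ideal.\<close>
  obtain X where X: "X \<subseteq> dual_lattice" "finite X" "c ` dual_lattice = c ` X"
  proof -
    have "finite (c ` dual_lattice)"
      by (rule finite_subset[OF image_mono[OF dual_lattice_subset] c(1)])
    from finite_subset_image[OF this subset_refl] show ?thesis using that by blast
  qed
  have cycle: "\<exists>i p. p > 0 \<and> x ^ i * (1 - x ^ p) \<in> I" if x: "x \<in> ring_of_integers" for x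
  proof -
    have "\<not> inj (\<lambda>n::nat. c (x ^ n))"
    proof
      assume "inj (\<lambda>n::nat. c (x ^ n))"
      hence "infinite (range (\<lambda>n::nat. c (x ^ n)))" by (rule range_inj_infinite)
      moreover have "range (\<lambda>n::nat. c (x ^ n)) \<subseteq> c ` ring_of_integers"
        using x by (auto intro!: ring_of_integers_power)
      ultimately show False using c(1) finite_subset by blast
    qed
    then obtain m n where mn: "m \<noteq> n" "c (x ^ m) = c (x ^ n)" by (auto simp: inj_on_def)
    have "\<exists>m n. m < n \<and> c (x ^ m) = c (x ^ n)"
      using mn by (metis linorder_neqE_nat)
    then obtain m n where mn: "m < n" "c (x ^ m) = c (x ^ n)" by blast
    have "x ^ m - x ^ n \<in> I" by (intro cI ring_of_integers_power x mn)
    moreover have "x ^ m - x ^ n = x ^ m * (1 - x ^ (n - m))"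
      using mn(1) by (simp add: right_diff_distrib power_add[symmetric])
    ultimately show ?thesis using mn(1) by (intro exI[of _ m] exI[of _ "n - m"]) auto
  qed
  have "\<forall>x. \<exists>i p. x \<in> ring_of_integers \<longrightarrow> p > 0 \<and> x ^ i * (1 - x ^ p) \<in> I" using cycle by blast
  then obtain e p where ep: "\<And>x. x \<in> ring_of_integers \<Longrightarrow> p x > (0::nat)"
    "\<And>x. x \<in> ring_of_integers \<Longrightarrow> x ^ e x * (1 - x ^ p x) \<in> I" by metis
  define u where "u = (\<Prod>x\<in>X. 1 - x ^ p x)"
  have X_int: "x \<in> ring_of_integers" if "x \<in> X" for x
    using that X(1) dual_lattice_subset by blast
  have u_int: "u \<in> ring_of_integers"
    unfolding u_def by (intro ring_of_integers_prod ring_of_integers_diff ring_of_integers_1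
        ring_of_integers_power X_int)
  have "1 - (\<Prod>x\<in>Y. 1 - x ^ p x) \<in> dual_lattice" if "Y \<subseteq> X" for Y
    using finite_subset[OF that X(2)] that
  proof (induction Y)
    case empty
    show ?case by (simp add: dual_lattice_def)
  next
    case (insert x Y)
    have x: "x \<in> dual_lattice" "x \<in> ring_of_integers" using insert.prems X(1) X_int by auto
    have "x * x ^ (p x - 1) \<in> dual_lattice"
      by (intro dual_lattice_mult x ring_of_integers_power)
    hence "x ^ p x \<in> dual_lattice" using ep(1)[OF x(2)] by (simp add: power_eq_if)
    moreover have "(\<Prod>x\<in>Y. 1 - x ^ p x) \<in> ring_of_integers"
      by (intro ring_of_integers_prod ring_of_integers_diff ring_of_integers_1
        ring_of_integers_power X_int) (use insert.prems in auto)
    ultimately have "x ^ p x * (\<Prod>x\<in>Y. 1 - x ^ p x) \<in> dual_lattice" by (rule dual_lattice_mult)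
    with insert.IH insert.prems
    have "(1 - (\<Prod>x\<in>Y. 1 - x ^ p x)) + x ^ p x * (\<Prod>x\<in>Y. 1 - x ^ p x) \<in> dual_lattice"
      by (intro dual_lattice_add) auto
    thus ?case using insert.hyps by (simp add: algebra_simps)
  qed
  hence "1 - u \<in> dual_lattice" by (simp add: u_def)
  hence u_notin: "u \<notin> I"
    using notin dual_lattice_add[of "1 - u" u] I_dual by auto
  have nilp: "u * x ^ e x \<in> I" if "x \<in> X" for x
  proof -
    have "u * x ^ e x = (x ^ e x * (1 - x ^ p x)) * (\<Prod>x\<in>X - {x}. 1 - x ^ p x)"
      using that X(2) by (simp add: u_def prod.remove[of X x] mult_ac)
    also have "\<dots> \<in> I"
      by (intro I_mult ep(2) X_int that ring_of_integers_prod ring_of_integers_diff ring_of_integers_1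
        ring_of_integers_power) auto
    finally show ?thesis .
  qed
  have "\<exists>w\<in>ring_of_integers. u * w \<notin> I \<and> (\<forall>x\<in>Y. u * w * x \<in> I)" if "Y \<subseteq> X" for Y
    using finite_subset[OF that X(2)] that
  proof (induction Y)
    case empty
    show ?case using u_notin by (intro bexI[of _ 1]) (auto simp: ring_of_integers_1)
  next
    case (insert x Y)
    then obtain w where w: "w \<in> ring_of_integers" "u * w \<notin> I" "\<And>y. y \<in> Y \<Longrightarrow> u * w * y \<in> I" by auto
    have x: "x \<in> X" "x \<in> ring_of_integers" using insert.prems X_int by auto
    have ex: "u * w * x ^ e x \<in> I"
      using I_mult[OF nilp[OF x(1)] w(1)] by (simp add: mult_ac)
    \<comment> \<open>The power just before the first one that falls into \<open>I\<close> keeps the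
      product outside \<open>I\<close>, and one further factor \<open>x\<close> puts it inside.
      Earlier elements of \<open>Y\<close> remain annihilated because \<open>I\<close> is an
      ideal.\<close>
    define k where "k = (LEAST k. u * w * x ^ k \<in> I)"
    have k: "u * w * x ^ k \<in> I" unfolding k_def by (rule LeastI[of _ "e x"]) (rule ex)
    have "k \<noteq> 0" using k w(2) by (auto intro: ccontr)
    then obtain l where l: "k = Suc l" by (cases k) auto
    have "u * w * x ^ l \<notin> I"
      using not_less_Least[of l "\<lambda>k. u * w * x ^ k \<in> I"] l by (simp add: k_def)
    moreover have "u * (w * x ^ l) * y \<in> I" if "y \<in> insert x Y" for y
    proof (cases "y = x")
      case True
      thus ?thesis using k l by (simp add: mult_ac)
    next
      case False
      hence "u * w * y * x ^ l \<in> I" using that by (intro I_mult w ring_of_integers_power x) auto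
      thus ?thesis by (simp add: mult_ac)
    qed
    ultimately show ?case
      by (intro bexI[of _ "w * x ^ l"]) (auto simp: mult.assoc intro!: ring_of_integers_mult ring_of_integers_power w x)
  qed
  from this[OF subset_refl] obtain w where w: "w \<in> ring_of_integers" "u * w \<notin> I" "\<And>x. x \<in> X \<Longrightarrow> u * w * x \<in> I"
    by blast
  define b where "b = u * w"
  have b_int: "b \<in> ring_of_integers" unfolding b_def by (intro ring_of_integers_mult u_int w)
  have bJ: "b * x \<in> I" if x: "x \<in> dual_lattice" for x
  proof -
    have "c x \<in> c ` X" using X(3) x by blast
    then obtain y where y: "y \<in> X" "c x = c y" by blast
    have "x - y \<in> I" by (intro cI y X_int subsetD[OF dual_lattice_subset x])
    hence "(x - y) * b + b * y \<in> I"
      using I_add[OF I_mult[OF _ b_int] w(3)[OF y(1), folded b_def]] by blast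
    thus ?thesis by (simp add: algebra_simps)
  qed
  have M0: "of_nat M \<noteq> (0 :: 'f)" using M(1) by simp
  \<comment> \<open>The annihilator contradicts the choice of \<delta>: since \<open>b\<close> sends
    the dual lattice into \<open>I\<close>, the element \<delta> b / M multiplies the codifferent
    into the integers. As \<delta> generates \<open>different\<close>, \<open>b\<close> is then a
    multiple of \<open>M\<close>.\<close>
  have "\<delta> * (b / of_nat M) \<in> different"
    unfolding different_def
  proof safe
    fix y assume "y \<in> (inverse_different :: 'f set)"
    hence "y * \<delta> \<in> dual_lattice" using delta_nonzero by (simp add: dual_lattice_iff)
    from bJ[OF this] obtain a where a: "a \<in> ring_of_integers" "b * (y * \<delta>) = of_nat M * a"
      by (auto simp: I_def)
    have "\<delta> * (b / of_nat M) * y = b * (y * \<delta>) / of_nat M" by (simp add: mult_ac)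
    also have "\<dots> = a" using a(2) M0 by simp
    finally show "\<delta> * (b / of_nat M) * y \<in> ring_of_integers" using a(1) by simp
  qed
  then obtain a where a: "a \<in> ring_of_integers" "\<delta> * (b / of_nat M) = \<delta> * a"
    unfolding different_eq principal_ideal_def by blast
  hence "b = of_nat M * a" using delta_nonzero M0 by (simp add: field_simps)
  hence "b \<in> I" using a(1) unfolding I_def by blast
  thus False using w(2) by (simp add: b_def)
qed

lemma dual_lattice_eq: "dual_lattice = ring_of_integers"
  using dual_lattice_subset dual_lattice_mult[OF one_in_dual_lattice] by auto

lemma integral_iff_pairing: "x \<in> ring_of_integers \<longleftrightarrow> (\<forall>y\<in>ring_of_integers. pairing x y \<in> \<int>)"
  using dual_lattice_eq by (auto simp: dual_lattice_def)

lemma inverse_delta_mult: "x \<in> ring_of_integers \<Longrightarrow> x / \<delta> \<in> inverse_different"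
  using dual_lattice_eq dual_lattice_iff by blast

end

section \<open>Poisson summation for Gaussians\<close>

definition fourier_null :: "(real \<Rightarrow> complex) \<Rightarrow> bool" where
  "fourier_null h \<longleftrightarrow> continuous_on UNIV h \<and>
     (\<forall>k::int. integral {0..1} (\<lambda>x. h x * cis (2 * pi * of_int k * x)) = 0)"

text \<open>A real-linear function of cis(2 pi x) is a combination of cis(2 pi x) and cis(-2 pi x).
  Multiplying by it only mixes the Fourier coefficients of neighbouring indices k + 1 and k -
  1.\<close>

lemma fourier_null_linear:
  assumes f: "bounded_linear (f :: complex \<Rightarrow> real)" and h: "fourier_null h"
  shows "fourier_null (\<lambda>x. h x * of_real (f (cis (2 * pi * x))))"
  unfolding fourier_null_def
proof (intro conjI allI)
  have [continuous_intros]: "continuous_on UNIV h" using h by (simp add: fourier_null_def)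
  show "continuous_on UNIV (\<lambda>x. h x * of_real (f (cis (2 * pi * x))))"
    by (intro continuous_intros bounded_linear.continuous_on[OF f])
  fix k :: int
  \<comment> \<open>These solve a cis t + b cis(-t) = f(1) cos t + f(\<i>) sin t.\<close>
  define a b where "a = (of_real (f 1) - \<i> * of_real (f \<i>)) / 2" and "b = (of_real (f 1) + \<i> * of_real (f \<i>)) / 2"
  have *: "of_real (f (cis t)) = a * cis t + b * cis (- t)" for t
  proof -
    have "cis t = cos t *\<^sub>R 1 + sin t *\<^sub>R \<i>" by (simp add: complex_eq_iff)
    hence "f (cis t) = cos t * f 1 + sin t * f \<i>"
      by (simp add: linear_add[OF bounded_linear.linear[OF f]] linear_cmul[OF bounded_linear.linear[OF f]])
    thus ?thesis by (simp add: a_def b_def complex_eq_iff field_simps)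
  qed
  have "integral {0..1} (\<lambda>x. h x * of_real (f (cis (2 * pi * x))) * cis (2 * pi * of_int k * x))
      = integral {0..1} (\<lambda>x. a * (h x * cis (2 * pi * of_int (k + 1) * x)) + b * (h x * cis (2 * pi * of_int (k - 1) * x)))"
    by (intro integral_cong) (simp add: * ring_distribs mult_ac cis_mult add.commute)
  also have "\<dots> = a * integral {0..1} (\<lambda>x. h x * cis (2 * pi * of_int (k + 1) * x))
     + b * integral {0..1} (\<lambda>x. h x * cis (2 * pi * of_int (k - 1) * x))"
  proof -
    have [continuous_intros]: "continuous_on {0..1} h"
      using \<open>continuous_on UNIV h\<close> by (rule continuous_on_subset) simp
    show ?thesis
      unfolding integral_mult_right[symmetric]
      by (intro integral_add integrable_continuous_real continuous_intros)
  qed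
  also have "\<dots> = 0" 
    using conjunct2[OF h[unfolded fourier_null_def]] by (simp only: mult_zero_right add_0)
  finally show "integral {0..1} (\<lambda>x. h x * of_real (f (cis (2 * pi * x))) * cis (2 * pi * of_int k * x)) = 0" .
qed

lemma fourier_null_cmult:
  assumes "fourier_null h"
  shows "fourier_null (\<lambda>x. h x * c)"
proof -
  have "integral {0..1} (\<lambda>x. h x * c * cis (2 * pi * of_int k * x))
      = c * integral {0..1} (\<lambda>x. h x * cis (2 * pi * of_int k * x))" for k :: int
    by (simp flip: integral_mult_right add: mult_ac)
  thus ?thesis using assms by (auto simp: fourier_null_def intro!: continuous_intros)
qed

lemma fourier_null_add:
  assumes "fourier_null g" "fourier_null h"
  shows "fourier_null (\<lambda>x. g x + h x)"
proof -
  have [continuous_intros]: "continuous_on {0..1} g" "continuous_on {0..1} h"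
    using assms by (auto simp: fourier_null_def intro: continuous_on_subset)
  have "integral {0..1} (\<lambda>x. (g x + h x) * cis (2 * pi * of_int k * x))
      = integral {0..1} (\<lambda>x. g x * cis (2 * pi * of_int k * x)) + integral {0..1} (\<lambda>x. h x * cis (2 * pi * of_int k * x))" for k :: int
    unfolding distrib_right by (intro integral_add integrable_continuous_real continuous_intros)
  thus ?thesis using assms by (auto simp: fourier_null_def intro!: continuous_intros)
qed

text \<open>The induction generalises over \<open>h\<close>, so that a product of polynomials is
  absorbed one factor at a time.\<close>

lemma fourier_null_polynomial:
  assumes "real_polynomial_function (p :: complex \<Rightarrow> real)" "fourier_null h"
  shows "fourier_null (\<lambda>x. h x * of_real (p (cis (2 * pi * x))))"
  using assms
proof (induction p arbitrary: h rule: real_polynomial_function.induct)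
  case (linear f)
  thus ?case by (rule fourier_null_linear)
next
  case (const c)
  thus ?case by (intro fourier_null_cmult)
next
  case (add p q)
  from fourier_null_add[OF add.IH(1)[OF add.prems] add.IH(2)[OF add.prems]]
  show ?case by (simp add: distrib_left)
next
  case (mult p q)
  from mult.IH(2)[OF mult.IH(1)[OF mult.prems]]
  show ?case by (simp add: mult.assoc)
qed

lemma periodic_int_shift:
  assumes "\<And>x. h (x + 1) = h (x :: real)"
  shows "h (x + of_int n) = h x"
proof -
  have nat: "h (x + real k) = h x" for k x
  proof (induction k)
    case (Suc k)
    have "h (x + real (Suc k)) = h ((x + real k) + 1)" by (simp add: add_ac)
    thus ?case using assms Suc by simp
  qed simp
  show ?thesis
  proof (cases n rule: int_cases2)
    case (nonneg k)
    thus ?thesis using nat by simp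
  next
    case (nonpos k)
    thus ?thesis using nat[of "x - real k" k] by simp
  qed
qed

text \<open>By Stone-Weierstrass the conjugate of \<open>h\<close> is a uniform limit of polynomials
  on the unit circle, and the integral of \<open>h\<close> against each of them is 0. Hence the
  integral of |h|^2 over a period vanishes.\<close>

lemma fourier_unique:
  assumes per: "\<And>x. h (x + 1) = h x" and null: "fourier_null h"
  shows "h x = 0"
proof -
  have cont: "continuous_on UNIV h" using null by (simp add: fourier_null_def)
  have shift: "h a = h b" if eq: "cis (2 * pi * a) = cis (2 * pi * b)" for a b
  proof -
    obtain n :: int where "\<i> * of_real (2 * pi * a) = \<i> * of_real (2 * pi * b) + of_real (of_int (2 * n) * pi) * \<i>"
      using eq unfolding cis_conv_exp exp_eq by blast
    hence "2 * pi * a = 2 * pi * b + 2 * pi * of_int n"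
      by (simp add: complex_eq_iff mult_ac)
    hence "2 * pi * a = 2 * pi * (b + of_int n)" by (simp add: distrib_left)
    hence "a = b + of_int n" by simp
    thus ?thesis using periodic_int_shift[of h, OF per] by simp
  qed
  \<comment> \<open>The conjugate of \<open>h\<close> carried to the circle. \<open>Arg\<close>
    jumps on the negative real axis; there \<open>Arg2pi\<close>, which by periodicity gives the
    same values of \<open>H\<close>, is used for continuity.\<close>
  define H where "H w = cnj (h (Arg w / (2 * pi)))" for w
  have cisArg: "cis (2 * pi * (Arg w / (2 * pi))) = w" "cis (2 * pi * (Arg2pi w / (2 * pi))) = w"
    if "w \<in> sphere 0 1" for w
  proof -
    have w: "w \<noteq> 0" "norm w = 1" using that by auto
    show "cis (2 * pi * (Arg w / (2 * pi))) = w" using cis_Arg[OF w(1)] w by (simp add: sgn_div_norm)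
    show "cis (2 * pi * (Arg2pi w / (2 * pi))) = w" using Arg2pi_eq[of w] w by (simp add: cis_conv_exp mult.commute)
  qed
  have H': "H w = cnj (h (Arg2pi w / (2 * pi)))" if "w \<in> sphere 0 1" for w
    unfolding H_def by (intro arg_cong[of _ _ cnj] shift) (simp only: cisArg[OF that])
  have isCont: "isCont h t" for t using cont by (simp add: continuous_on_eq_continuous_at)
  have contH: "continuous_on (sphere 0 1) H"
    unfolding continuous_on_eq_continuous_within
  proof
    fix w :: complex assume w: "w \<in> sphere 0 1"
    show "continuous (at w within sphere 0 1) H"
    proof (cases "w \<in> \<real>\<^sub>\<le>\<^sub>0")
      case False
      show ?thesis
        unfolding H_def
        by (intro continuous_intros continuous_within_compose3[OF isCont] continuous_within_Arg False) auto
    next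
      case True
      moreover have "w \<noteq> 0" using w by auto
      ultimately have "w \<notin> \<real>\<^sub>\<ge>\<^sub>0"
        by (auto simp: complex_nonneg_Reals_iff complex_nonpos_Reals_iff complex_eq_iff)
      hence "continuous (at w within sphere 0 1) Arg2pi"
        using continuous_at_Arg2pi continuous_at_imp_continuous_within by blast
      hence "continuous (at w within sphere 0 1) (\<lambda>w. cnj (h (Arg2pi w / (2 * pi))))"
        by (intro continuous_intros continuous_within_compose3[OF isCont]) auto
      thus ?thesis
        by (rule continuous_transform_within[OF _ less_numeral_extra(1) w]) (simp add: H')
    qed
  qed
  have H_cis: "H (cis (2 * pi * y)) = cnj (h y)" for y
    unfolding H_def by (intro arg_cong[of _ _ cnj] shift cisArg(1)) simp
  have [continuous_intros]: "continuous_on {0..1} h" using cont by (rule continuous_on_subset) simp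
  obtain K where K: "\<And>y. y \<in> {0..1} \<Longrightarrow> norm (h y) \<le> K"
    using compact_imp_bounded[OF compact_continuous_image[OF \<open>continuous_on {0..1} h\<close> compact_Icc]]
    unfolding bounded_iff by blast
  have K0: "K \<ge> 0" using order_trans[OF norm_ge_zero K[of 0]] by simp
  define J where "J = integral {0..1} (\<lambda>y. h y * cnj (h y))"
  have "norm J \<le> e" if e: "e > 0" for e
  proof -
    define e' where "e' = e / (K + 1)"
    have e': "e' > 0" using e K0 by (simp add: e'_def)
    obtain g where g: "polynomial_function g" "\<And>w. w \<in> sphere 0 1 \<Longrightarrow> norm (H w - g w) < e'"
      using Stone_Weierstrass_polynomial_function[OF compact_sphere contH e'] by blast
    define G where "G y = g (cis (2 * pi * y))" for y
    have rp: "real_polynomial_function (\<lambda>w. Re (g w))" "real_polynomial_function (\<lambda>w. Im (g w))"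
      using g(1) bounded_linear_Re bounded_linear_Im unfolding polynomial_function_def comp_def by blast+
    have "fourier_null (\<lambda>y. h y * of_real (Re (G y)) + h y * of_real (Im (G y)) * \<i>)"
      unfolding G_def by (intro fourier_null_add fourier_null_cmult fourier_null_polynomial[OF rp(1)]
          fourier_null_polynomial[OF rp(2)] null)
    also have "(\<lambda>y. h y * of_real (Re (G y)) + h y * of_real (Im (G y)) * \<i>) = (\<lambda>y. h y * G y)"
      by (simp add: fun_eq_iff complex_eq_iff algebra_simps)
    finally have null': "fourier_null (\<lambda>y. h y * G y)" .
    have 0: "integral {0..1} (\<lambda>y. h y * G y) = 0"
      using null' unfolding fourier_null_def by (auto dest!: spec[of _ 0])
    have [continuous_intros]: "continuous_on {0..1} (\<lambda>y. h y * G y)"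
      using null' unfolding fourier_null_def by (auto intro: continuous_on_subset)
    have "J = integral {0..1} (\<lambda>y. h y * cnj (h y)) - integral {0..1} (\<lambda>y. h y * G y)" by (simp add: J_def 0)
    also have "\<dots> = integral {0..1} (\<lambda>y. h y * cnj (h y) - h y * G y)"
      by (intro integral_diff[symmetric] integrable_continuous_real continuous_intros)
    finally have J: "J = integral {0..1} (\<lambda>y. h y * cnj (h y) - h y * G y)" .
    have "norm J \<le> K * e' * (1 - 0)"
      unfolding J
    proof (rule integral_bound)
      show "continuous_on {0..1} (\<lambda>y. h y * cnj (h y) - h y * G y)" by (intro continuous_intros)
      fix y :: real assume y: "y \<in> {0..1}"
      have "norm (h y * cnj (h y) - h y * G y) = norm (h y) * norm (H (cis (2 * pi * y)) - g (cis (2 * pi * y)))"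
        by (simp add: H_cis G_def right_diff_distrib[symmetric] norm_mult)
      also have "\<dots> \<le> K * e'"
        using g(2)[of "cis (2 * pi * y)"] by (intro mult_mono K y K0) auto
      finally show "norm (h y * cnj (h y) - h y * G y) \<le> K * e'" .
    qed simp
    also have "K * e' * (1 - 0) \<le> e"
    proof -
      have "K * e' \<le> (K + 1) * e'" using e' by simp
      also have "\<dots> = e" using K0 by (simp add: e'_def)
      finally show ?thesis by simp
    qed
    finally show ?thesis .
  qed
  hence "J = 0" by (metis norm_le_zero_iff field_le_epsilon add_0)
  moreover have "J = of_real (integral {0..1} (\<lambda>y. (norm (h y))\<^sup>2))"
  proof -
    have "((\<lambda>y. (norm (h y))\<^sup>2) has_integral integral {0..1} (\<lambda>y. (norm (h y))\<^sup>2)) {0..1}"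
      by (intro integrable_integral integrable_continuous_real continuous_intros)
    from has_integral_of_real[OF this]
    show ?thesis unfolding J_def complex_norm_square[symmetric] by (rule integral_unique)
  qed
  ultimately have 0: "integral {0..1} (\<lambda>y. (norm (h y))\<^sup>2) = 0" by simp
  have zero: "h y = 0" if "y \<in> {0..1}" for y
  proof -
    have "(norm (h y))\<^sup>2 = 0"
      using integral_cbox_eq_0_iff[of 0 "1::real" "\<lambda>y. (norm (h y))\<^sup>2"] 0 that
      by (simp add: continuous_intros)
    thus ?thesis by simp
  qed
  have "h x = h (frac x)"
    using periodic_int_shift[of h "frac x" "\<lfloor>x\<rfloor>", OF per] by (simp add: frac_def)
  also have "\<dots> = 0" using frac_ge_0[of x] frac_lt_1[of x] by (intro zero) auto
  finally show ?thesis .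
qed

section \<open>Gaussian series and integrals\<close>

lemma gaussian_summable:
  assumes "c > 0"
  shows "(\<lambda>n::int. exp (- c * (of_int n)\<^sup>2) :: real) summable_on UNIV"
proof -
  have nat: "(\<lambda>n::nat. exp (- c * (of_nat n)\<^sup>2) :: real) summable_on UNIV"
  proof (rule norm_summable_imp_summable_on)
    have geo: "summable (\<lambda>n. exp (- c) ^ n)" using assms by (intro summable_geometric) auto
    show "summable (\<lambda>n. norm (exp (- c * (of_nat n)\<^sup>2) :: real))"
    proof (rule summable_comparison_test[OF _ geo], intro exI[of _ 0] allI impI)
      fix n :: nat
      have "real n \<le> (real n)\<^sup>2" by (cases n) (auto simp: power2_eq_square)
      thus "norm (norm (exp (- c * (of_nat n)\<^sup>2) :: real)) \<le> exp (- c) ^ n"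
        using assms by (simp add: exp_of_nat_mult[symmetric] mult.commute)
    qed
  qed
  have "(\<lambda>n::int. exp (- c * (of_int n)\<^sup>2) :: real) summable_on range int"
    by (subst summable_on_reindex) (use nat in \<open>auto simp: o_def\<close>)
  moreover have "(\<lambda>n::int. exp (- c * (of_int n)\<^sup>2) :: real) summable_on range (\<lambda>n. - int n)"
    by (subst summable_on_reindex) (use nat in \<open>auto simp: o_def inj_on_def\<close>)
  ultimately have "(\<lambda>n::int. exp (- c * (of_int n)\<^sup>2) :: real) summable_on (range int \<union> range (\<lambda>n. - int n))"
    by (rule summable_on_union)
  also have "range int \<union> range (\<lambda>n. - int n) = UNIV"
  proof -
    have "n \<in> range int \<union> range (\<lambda>n. - int n)" for n
      by (cases n rule: int_cases2) auto
    thus ?thesis by blast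
  qed
  finally show ?thesis .
qed

text \<open>From (n + 2x)^2 \<ge> 0 one gets (n + x)^2 \<ge> n^2/2 - x^2. Half of the decay
  therefore dominates all shifts by |x| \<le> K at once.\<close>

lemma gaussian_shift_bound:
  fixes n x :: real
  assumes "\<bar>x\<bar> \<le> K" "t > 0"
  shows "exp (- pi * t * (n + x)\<^sup>2) \<le> exp (pi * t * K\<^sup>2) * exp (- (pi * t / 2) * n\<^sup>2)"
proof -
  have "x\<^sup>2 \<le> K\<^sup>2" using assms(1) by (simp add: abs_le_square_iff[symmetric])
  moreover have "n\<^sup>2 / 2 - x\<^sup>2 \<le> (n + x)\<^sup>2"
    using zero_le_power2[of "n + 2 * x"] by (simp add: power2_eq_square algebra_simps)
  ultimately have "n\<^sup>2 / 2 - K\<^sup>2 \<le> (n + x)\<^sup>2" by simp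
  hence "pi * t * (n\<^sup>2 / 2 - K\<^sup>2) \<le> pi * t * (n + x)\<^sup>2" using assms(2) by (intro mult_left_mono) auto
  thus ?thesis unfolding exp_add[symmetric] by (simp add: algebra_simps)
qed

lemma continuous_on_infsum:
  fixes f :: "'i \<Rightarrow> 'a::topological_space \<Rightarrow> 'b::banach"
  assumes "M summable_on I" "\<And>i x. i \<in> I \<Longrightarrow> x \<in> S \<Longrightarrow> norm (f i x) \<le> M i"
    and "\<And>i. i \<in> I \<Longrightarrow> continuous_on S (f i)"
  shows "continuous_on S (\<lambda>x. \<Sum>\<^sub>\<infinity>i\<in>I. f i x)"
proof (rule uniform_limit_theorem[OF _ Weierstrass_m_test_general[OF assms(2,1)]])
  show "\<forall>\<^sub>F X in finite_subsets_at_top I. continuous_on S (\<lambda>x. \<Sum>i\<in>X. f i x)"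
    by (rule eventually_finite_subsets_at_top_weakI) (auto intro!: continuous_on_sum assms(3))
qed auto

lemma integral_infsum:
  fixes f :: "'i \<Rightarrow> real \<Rightarrow> complex"
  assumes "M summable_on UNIV" "\<And>i x. x \<in> {a..b} \<Longrightarrow> norm (f i x) \<le> M i"
    and "\<And>i. continuous_on {a..b} (f i)"
  shows "((\<lambda>i. integral {a..b} (f i)) has_sum integral {a..b} (\<lambda>x. \<Sum>\<^sub>\<infinity>i. f i x)) UNIV"
proof -
  have "uniform_limit {a..b} (\<lambda>X y. \<Sum>i\<in>X. f i y) (\<lambda>y. \<Sum>\<^sub>\<infinity>i. f i y) (finite_subsets_at_top UNIV)"
    by (rule Weierstrass_m_test_general[OF assms(2,1)])
  then obtain I J where IJ: "\<And>X. ((\<lambda>y. \<Sum>i\<in>X. f i y) has_integral I X) {a..b}"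
    "((\<lambda>y. \<Sum>\<^sub>\<infinity>i. f i y) has_integral J) {a..b}" "(I \<longlongrightarrow> J) (finite_subsets_at_top UNIV)"
    by (rule uniform_limit_integral) (auto intro!: continuous_on_sum assms(3))
  have "I X = (\<Sum>i\<in>X. integral {a..b} (f i))" if "finite X" for X
    using IJ(1)[of X] that
    by (subst integral_sum[symmetric]) (auto intro!: integrable_continuous_real assms(3) simp: integral_unique)
  hence "((\<lambda>X. \<Sum>i\<in>X. integral {a..b} (f i)) \<longlongrightarrow> J) (finite_subsets_at_top UNIV)"
    by (intro Lim_transform_eventually[OF IJ(3)] eventually_finite_subsets_at_top_weakI) auto
  thus ?thesis using IJ(2) by (simp add: has_sum_def integral_unique)
qed

text \<open>A rescaling of the characteristic function of the standard normal distribution.\<close>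

lemma gaussian_fourier_integral:
  fixes t s :: real
  assumes t: "t > 0"
  shows "integrable lborel (\<lambda>x. exp (- pi * t * x\<^sup>2) * cis (s * x))"
    and "(\<integral>x. exp (- pi * t * x\<^sup>2) * cis (s * x) \<partial>lborel) = of_real (exp (- s\<^sup>2 / (4 * pi * t)) / sqrt t)"
proof -
  \<comment> \<open>With this scale, exp(-pi t x^2) is sqrt(2 pi) times the normal density at c
    x.\<close>
  define c where "c = sqrt (2 * pi * t)"
  have c: "c > 0" "c\<^sup>2 = 2 * pi * t" using t by (auto simp: c_def)
  have dens: "std_normal_density (c * x) = exp (- pi * t * x\<^sup>2) / sqrt (2 * pi)" for x
    unfolding std_normal_density_def using c by (simp add: power_mult_distrib)
  define g where "g x = std_normal_density x *\<^sub>R cis (s / c * x)" for x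
  have int_g: "integrable lborel g"
  proof (rule Bochner_Integration.integrable_bound)
    show "integrable lborel std_normal_density" by simp
    show "g \<in> borel_measurable lborel" unfolding g_def measurable_lborel2 std_normal_density_def
      by (intro borel_measurable_continuous_onI continuous_intros) auto
    show "AE x in lborel. norm (g x) \<le> norm (std_normal_density x)" by (auto simp: g_def)
  qed
  have "exp (- (s / c)\<^sup>2 / 2) = char std_normal_distribution (s / c)"
    by (simp add: char_std_normal_distribution)
  also have "\<dots> = (\<integral>x. g x \<partial>lborel)"
    unfolding char_def g_def
    by (subst integral_density) (auto simp: cis_conv_exp mult_ac)
  also have "\<dots> = \<bar>c\<bar> *\<^sub>R (\<integral>x. g (0 + c * x) \<partial>lborel)"
    by (rule lborel_integral_real_affine) (use c in auto)
  also have "(\<lambda>x. g (0 + c * x)) = (\<lambda>x. (1 / sqrt (2 * pi)) *\<^sub>R (exp (- pi * t * x\<^sup>2) * cis (s * x)))"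
    using c(1) by (simp add: g_def dens fun_eq_iff scaleR_conv_of_real)
  finally have eq: "complex_of_real (exp (- (s / c)\<^sup>2 / 2))
      = (c / sqrt (2 * pi)) *\<^sub>R (\<integral>x. exp (- pi * t * x\<^sup>2) * cis (s * x) \<partial>lborel)"
    using c(1) by simp
  have "c / sqrt (2 * pi) = sqrt t" using t by (simp add: c_def real_sqrt_mult)
  moreover have "(s / c)\<^sup>2 / 2 = s\<^sup>2 / (4 * pi * t)" using c by (simp add: power_divide)
  ultimately show "(\<integral>x. exp (- pi * t * x\<^sup>2) * cis (s * x) \<partial>lborel) = of_real (exp (- s\<^sup>2 / (4 * pi * t)) / sqrt t)"
    using eq t by (simp add: scaleR_conv_of_real field_simps)
  have "integrable lborel (\<lambda>x. sqrt (2 * pi) *\<^sub>R g (0 + c * x))"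
    using lborel_integrable_real_affine[OF int_g, of c 0] c by auto
  also have "(\<lambda>x. sqrt (2 * pi) *\<^sub>R g (0 + c * x)) = (\<lambda>x. exp (- pi * t * x\<^sup>2) * cis (s * x))"
    using c(1) by (simp add: g_def dens fun_eq_iff scaleR_conv_of_real)
  finally show "integrable lborel (\<lambda>x. exp (- pi * t * x\<^sup>2) * cis (s * x))" .
qed

text \<open>The unconditional sum is evaluated along symmetric ranges of integers, where the unit
  intervals glue together; dominated convergence with majorant |f| gives the integral over the
  line.\<close>

lemma has_sum_unit_integrals:
  fixes f :: "real \<Rightarrow> complex"
  assumes int: "integrable lborel f" and cont: "continuous_on UNIV f"
    and sum: "((\<lambda>n::int. integral {0..1} (\<lambda>x. f (of_int n + x))) has_sum S) UNIV"
  shows "S = (\<integral>x. f x \<partial>lborel)"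
proof -
  \<comment> \<open>The index N is excluded: the intervals [n, n + 1] with -N \<le> n < N tile
    exactly [-N, N].\<close>
  define B where "B N = {- int N..<int N}" for N
  have [continuous_intros]: "continuous_on X f" for X using cont by (rule continuous_on_subset) simp
  have "filterlim B (finite_subsets_at_top UNIV) sequentially"
    unfolding filterlim_finite_subsets_at_top
  proof (intro allI impI)
    fix X :: "int set" assume X: "finite X \<and> X \<subseteq> UNIV"
    define m where "m = Max ((\<lambda>n. nat \<bar>n\<bar>) ` X)"
    have m: "\<bar>n\<bar> \<le> int m" if "n \<in> X" for n
    proof -
      have "nat \<bar>n\<bar> \<le> m" unfolding m_def using X that by (intro Max_ge) auto
      thus ?thesis by simp
    qed
    have "X \<subseteq> B N" if "N \<ge> Suc m" for N
      using m that by (fastforce simp: B_def)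
    thus "\<forall>\<^sub>F N in sequentially. finite (B N) \<and> X \<subseteq> B N \<and> B N \<subseteq> UNIV"
      by (intro eventually_sequentiallyI[of "Suc m"]) (auto simp: B_def)
  qed
  hence lim1: "(\<lambda>N. \<Sum>n\<in>B N. integral {0..1} (\<lambda>x. f (of_int n + x))) \<longlonglongrightarrow> S"
    using sum unfolding has_sum_def by (rule filterlim_compose[rotated])
  have unit: "integral {0..1} (\<lambda>x. f (of_int n + x)) = integral {of_int n..of_int n + 1} f" for n :: int
    using integral_shift_Icc_real[of 0 1 f "of_int n"] by (simp add: o_def add.commute)
  have "(\<Sum>n\<in>B N. integral {0..1} (\<lambda>x. f (of_int n + x))) = integral {- real N..real N} f" for N
  proof (induction N)
    case 0
    show ?case by (simp add: B_def)
  next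
    case (Suc N)
    have B: "B (Suc N) = insert (- int (Suc N)) (insert (int N) (B N))" by (auto simp: B_def)
    have "(\<Sum>n\<in>B (Suc N). integral {0..1} (\<lambda>x. f (of_int n + x)))
       = integral {- real (Suc N)..- real N} f + (integral {real N..real (Suc N)} f + integral {- real N..real N} f)"
    proof -
      have nin: "- int (Suc N) \<notin> insert (int N) (B N)" "int N \<notin> B N" "finite (B N)"
        by (auto simp: B_def)
      have "integral {0..1} (\<lambda>x. f (of_int (- int (Suc N)) + x)) = integral {- real (Suc N)..- real N} f"
        using unit[of "- int (Suc N)"] by simp
      moreover have "integral {0..1} (\<lambda>x. f (of_int (int N) + x)) = integral {real N..real (Suc N)} f"
        using unit[of "int N"] by (simp add: add.commute)
      ultimately show ?thesis
        unfolding B using nin by (simp only: sum.insert finite_insert Suc.IH not_False_eq_True)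
    qed
    also have "\<dots> = integral {- real (Suc N)..- real N} f + integral {- real N..real (Suc N)} f"
      using Henstock_Kurzweil_Integration.integral_combine[of "- real N" "real N" "real (Suc N)" f]
      by (simp add: add_ac integrable_continuous_real continuous_intros)
    also have "\<dots> = integral {- real (Suc N)..real (Suc N)} f"
      by (rule Henstock_Kurzweil_Integration.integral_combine)
         (auto intro!: integrable_continuous_real continuous_intros)
    finally show ?case .
  qed
  moreover have "(\<lambda>N. integral {- real N..real N} f) \<longlonglongrightarrow> (\<integral>x. f x \<partial>lborel)"
  proof -
    have eq: "integral {- real N..real N} f = (\<integral>x. indicator {- real N..real N} x *\<^sub>R f x \<partial>lborel)" for N
    proof -
      have "set_integrable lborel {- real N..real N} f"
        by (intro borel_integrable_atLeastAtMost' continuous_intros)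
      from set_borel_integral_eq_integral(2)[OF this] show ?thesis
        by (simp add: set_lebesgue_integral_def)
    qed
    have "(\<lambda>N. \<integral>x. indicator {- real N..real N} x *\<^sub>R f x \<partial>lborel) \<longlonglongrightarrow> (\<integral>x. f x \<partial>lborel)"
    proof (rule integral_dominated_convergence[where w = "\<lambda>x. norm (f x)"])
      show "f \<in> borel_measurable lborel" using int by auto
      show "(\<lambda>x. indicator {- real N..real N} x *\<^sub>R f x) \<in> borel_measurable lborel" for N
        using int by auto
      show "integrable lborel (\<lambda>x. norm (f x))" using int by auto
      show "AE x in lborel. (\<lambda>N. indicator {- real N..real N} x *\<^sub>R f x) \<longlonglongrightarrow> f x"
      proof (rule AE_I2)
        fix x :: real
        have "\<forall>\<^sub>F N in sequentially. indicator {- real N..real N} x *\<^sub>R f x = f x"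
          using eventually_ge_at_top[of "nat \<lceil>\<bar>x\<bar>\<rceil>"]
        proof eventually_elim
          case (elim N)
          hence "\<bar>x\<bar> \<le> real N" by linarith
          thus ?case by (auto simp: indicator_def)
        qed
        thus "(\<lambda>N. indicator {- real N..real N} x *\<^sub>R f x) \<longlonglongrightarrow> f x"
          by (rule tendsto_eventually)
      qed
      show "AE x in lborel. norm (indicator {- real N..real N} x *\<^sub>R f x) \<le> norm (f x)" for N
        by (auto simp: indicator_def)
    qed
    thus ?thesis by (simp only: eq)
  qed
  ultimately show ?thesis using lim1 by (simp add: LIMSEQ_unique)
qed

lemma integral_cis_int: "integral {0..1} (\<lambda>x. cis (2 * pi * of_int k * x)) = (if k = 0 then 1 else 0)"
proof (cases "k = 0")
  case False
  define c where "c = 2 * pi * of_int k * \<i>"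
  have c: "c \<noteq> 0" using False by (simp add: c_def)
  have "((\<lambda>x. cis (2 * pi * of_int k * x)) has_integral
      exp (c * of_real 1) / c - exp (c * of_real 0) / c) {0..1}"
  proof (rule fundamental_theorem_of_calculus)
    fix x :: real
    have "((\<lambda>z. exp (c * z) / c) has_field_derivative exp (c * of_real x)) (at (of_real x))"
      using c by (auto intro!: derivative_eq_intros)
    from has_vector_derivative_real_field[OF this, of "{0..1}"]
    show "((\<lambda>x. exp (c * of_real x) / c) has_vector_derivative cis (2 * pi * of_int k * x)) (at x within {0..1})"
      by (simp add: cis_conv_exp c_def mult_ac)
  qed simp
  moreover have "exp (c * of_real 1) = 1"
    unfolding exp_eq_1 c_def by (auto intro!: exI[of _ k])
  ultimately show ?thesis using False by (simp add: integral_unique)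
qed simp

text \<open>As functions of x, both sides are continuous, have period 1 and have the same Fourier
  coefficients, so \<open>fourier_unique\<close> applies to their difference.\<close>

lemma poisson_gaussian:
  fixes t x :: real
  assumes t: "t > 0"
  shows "(\<Sum>\<^sub>\<infinity>n::int. complex_of_real (exp (- pi * t * (of_int n + x)\<^sup>2)))
       = of_real (1 / sqrt t) * (\<Sum>\<^sub>\<infinity>n::int. of_real (exp (- pi / t * (of_int n)\<^sup>2)) * cis (2 * pi * of_int n * x))"
proof -
  define \<Phi> where "\<Phi> x = (\<Sum>\<^sub>\<infinity>n::int. complex_of_real (exp (- pi * t * (of_int n + x)\<^sup>2)))" for x :: real
  define \<Psi> where "\<Psi> x = (\<Sum>\<^sub>\<infinity>n::int. of_real (exp (- pi / t * (of_int n)\<^sup>2)) * cis (2 * pi * of_int n * x))" for x :: real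
  have sumM: "(\<lambda>n::int. exp (pi * t * K\<^sup>2) * exp (- (pi * t / 2) * (of_int n)\<^sup>2)) summable_on UNIV" for K
    using t by (intro summable_on_cmult_right gaussian_summable) auto
  have bound: "norm (complex_of_real (exp (- pi * t * (of_int n + x)\<^sup>2)))
      \<le> exp (pi * t * K\<^sup>2) * exp (- (pi * t / 2) * (of_int n)\<^sup>2)" if "\<bar>x\<bar> \<le> K" for n :: int and x K
    using gaussian_shift_bound[OF that t, of "of_int n"] by simp
  have sumN: "(\<lambda>n::int. exp (- pi / t * (of_int n)\<^sup>2)) summable_on UNIV"
    using gaussian_summable[of "pi / t"] t by simp
  have cont\<Phi>: "continuous_on UNIV \<Phi>"
  proof (rule continuous_at_imp_continuous_on, intro ballI)
    fix y :: real
    \<comment> \<open>The majorant depends on a bound for x, so the M-test is applied on a bounded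
      interval around \<open>y\<close>.\<close>
    have "continuous_on {-(\<bar>y\<bar>+1)<..<\<bar>y\<bar>+1} \<Phi>"
      unfolding \<Phi>_def
      by (rule continuous_on_infsum[OF sumM[of "\<bar>y\<bar>+1"] bound]) (auto intro!: continuous_intros)
    thus "isCont \<Phi> y" by (rule continuous_on_interior) auto
  qed
  have cont\<Psi>: "continuous_on UNIV \<Psi>"
    unfolding \<Psi>_def
    by (rule continuous_on_infsum[OF sumN]) (auto intro!: continuous_intros simp: norm_mult)
  have per\<Phi>: "\<Phi> (x + 1) = \<Phi> x" for x
  proof -
    have "\<Phi> x = (\<Sum>\<^sub>\<infinity>n\<in>range (\<lambda>n::int. n + 1). complex_of_real (exp (- pi * t * (of_int n + x)\<^sup>2)))"
      unfolding \<Phi>_def by (simp add: surj_plus_right)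
    also have "\<dots> = \<Phi> (x + 1)"
      unfolding \<Phi>_def by (subst infsum_reindex) (auto simp: o_def inj_on_def add_ac)
    finally show ?thesis ..
  qed
  have per\<Psi>: "\<Psi> (x + 1) = \<Psi> x" for x
  proof -
    have "cis (2 * pi * of_int n * (x + 1)) = cis (2 * pi * of_int n * x)" for n :: int
    proof -
      have "cis (2 * pi * of_int n * (x + 1)) = cis (2 * pi * of_int n * x) * cis (2 * pi * of_int n)"
        unfolding cis_mult by (simp add: ring_distribs)
      also have "cis (2 * pi * of_int n) = 1" by (rule cis_multiple_2pi) simp
      finally show ?thesis by simp
    qed
    thus ?thesis by (simp add: \<Psi>_def)
  qed
  have coeff\<Phi>: "integral {0..1} (\<lambda>x. \<Phi> x * cis (2 * pi * of_int k * x)) = of_real (exp (- pi / t * (of_int k)\<^sup>2) / sqrt t)" for k :: int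
  proof -
    \<comment> \<open>The exponential is unchanged when x moves by an integer, so all terms are
      translates of this single function and the unit integrals reassemble its integral over the
      line.\<close>
    define f where "f x = exp (- pi * t * x\<^sup>2) * cis (2 * pi * of_int k * x)" for x
    have f_shift: "complex_of_real (exp (- pi * t * (of_int n + x)\<^sup>2)) * cis (2 * pi * of_int k * x) = f (of_int n + x)" for n :: int and x
    proof -
      have "cis (2 * pi * of_int k * (of_int n + x)) = cis (2 * pi * of_int (k * n)) * cis (2 * pi * of_int k * x)"
        unfolding cis_mult by (simp add: ring_distribs mult_ac)
      also have "cis (2 * pi * of_int (k * n)) = 1" by (rule cis_multiple_2pi) (simp only: Ints_of_int)
      finally show ?thesis by (simp add: f_def)
    qed
    have "\<Phi> x * cis (2 * pi * of_int k * x) = (\<Sum>\<^sub>\<infinity>n::int. f (of_int n + x))" for x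
      unfolding \<Phi>_def f_shift[symmetric] by (rule infsum_cmult_left'[symmetric])
    hence eq: "integral {0..1} (\<lambda>x. \<Phi> x * cis (2 * pi * of_int k * x)) = integral {0..1} (\<lambda>x. \<Sum>\<^sub>\<infinity>n::int. f (of_int n + x))"
      by simp
    have "((\<lambda>n::int. integral {0..1} (\<lambda>x. f (of_int n + x))) has_sum integral {0..1} (\<lambda>x. \<Sum>\<^sub>\<infinity>n::int. f (of_int n + x))) UNIV"
    proof (rule integral_infsum[OF sumM[of 1]])
      fix n :: int and x :: real assume "x \<in> {0..1}"
      thus "norm (f (of_int n + x)) \<le> exp (pi * t * 1\<^sup>2) * exp (- (pi * t / 2) * (of_int n)\<^sup>2)"
        unfolding f_shift[symmetric] norm_mult norm_cis mult_1_right by (intro bound) auto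
    next
      show "continuous_on {0..1} (\<lambda>x. f (of_int n + x))" for n :: int
        unfolding f_def by (intro continuous_intros)
    qed
    hence "integral {0..1} (\<lambda>x. \<Sum>\<^sub>\<infinity>n::int. f (of_int n + x)) = (\<integral>x. f x \<partial>lborel)"
    proof (rule has_sum_unit_integrals[rotated 2])
      show "integrable lborel f" unfolding f_def by (rule gaussian_fourier_integral(1)[OF t])
      show "continuous_on UNIV f" unfolding f_def by (intro continuous_intros)
    qed
    also have "\<dots> = of_real (exp (- (2 * pi * of_int k)\<^sup>2 / (4 * pi * t)) / sqrt t)"
      unfolding f_def by (rule gaussian_fourier_integral(2)[OF t])
    also have "- (2 * pi * of_int k)\<^sup>2 / (4 * pi * t) = - pi / t * (of_int k)\<^sup>2"
      using t by (simp add: power2_eq_square field_simps)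
    finally show ?thesis unfolding eq .
  qed
  have coeff\<Psi>: "integral {0..1} (\<lambda>x. \<Psi> x * cis (2 * pi * of_int k * x)) = of_real (exp (- pi / t * (of_int k)\<^sup>2))" for k :: int
  proof -
    define g where "g n x = of_real (exp (- pi / t * (of_int n)\<^sup>2)) * cis (2 * pi * of_int (n + k) * x)" for n :: int and x
    have "of_real (exp (- pi / t * (of_int n)\<^sup>2)) * cis (2 * pi * of_int n * x) * cis (2 * pi * of_int k * x) = g n x" for n :: int and x
      by (simp add: g_def mult.assoc cis_mult ring_distribs)
    hence "\<Psi> x * cis (2 * pi * of_int k * x) = (\<Sum>\<^sub>\<infinity>n::int. g n x)" for x
      unfolding \<Psi>_def by (subst infsum_cmult_left'[symmetric]) simp
    hence eq: "integral {0..1} (\<lambda>x. \<Psi> x * cis (2 * pi * of_int k * x)) = integral {0..1} (\<lambda>x. \<Sum>\<^sub>\<infinity>n::int. g n x)"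
      by simp
    have "((\<lambda>n::int. integral {0..1} (g n)) has_sum integral {0..1} (\<lambda>x. \<Sum>\<^sub>\<infinity>n::int. g n x)) UNIV"
      by (rule integral_infsum[OF sumN]) (auto simp: g_def norm_mult intro!: continuous_intros)
    \<comment> \<open>Coefficients are taken against cis(2 pi k x) instead of its conjugate, so the
      surviving index is -k; the weights are even in n.\<close>
    moreover have "integral {0..1} (g n) = (if n = - k then of_real (exp (- pi / t * (of_int k)\<^sup>2)) else 0)" for n
    proof -
      have "integral {0..1} (g n) = of_real (exp (- pi / t * (of_int n)\<^sup>2)) * integral {0..1} (\<lambda>x. cis (2 * pi * of_int (n + k) * x))"
        unfolding g_def by (rule integral_mult_right)
      thus ?thesis unfolding integral_cis_int by auto
    qed
    ultimately have "((\<lambda>n. if n = - k then complex_of_real (exp (- pi / t * (of_int k)\<^sup>2)) else 0) has_sum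
        integral {0..1} (\<lambda>x. \<Sum>\<^sub>\<infinity>n::int. g n x)) UNIV" by simp
    moreover have "((\<lambda>n. if n = - k then complex_of_real (exp (- pi / t * (of_int k)\<^sup>2)) else 0) has_sum
        of_real (exp (- pi / t * (of_int k)\<^sup>2))) UNIV"
      by (rule has_sum_finite_neutralI[of "{- k}"]) auto
    ultimately show ?thesis unfolding eq by (rule has_sum_unique)
  qed
  have "\<Phi> x - of_real (1 / sqrt t) * \<Psi> x = 0"
  proof (rule fourier_unique)
    show "\<Phi> (x + 1) - of_real (1 / sqrt t) * \<Psi> (x + 1) = \<Phi> x - of_real (1 / sqrt t) * \<Psi> x" for x
      by (simp only: per\<Phi> per\<Psi>)
    have [continuous_intros]: "continuous_on {0..1} \<Phi>" "continuous_on {0..1} \<Psi>"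
      using cont\<Phi> cont\<Psi> by (auto intro: continuous_on_subset)
    have "integral {0..1} (\<lambda>x. (\<Phi> x - of_real (1 / sqrt t) * \<Psi> x) * cis (2 * pi * of_int k * x))
       = integral {0..1} (\<lambda>x. \<Phi> x * cis (2 * pi * of_int k * x)) - of_real (1 / sqrt t) * integral {0..1} (\<lambda>x. \<Psi> x * cis (2 * pi * of_int k * x))" for k :: int
      unfolding left_diff_distrib mult.assoc integral_mult_right[symmetric]
      by (intro integral_diff integrable_continuous_real continuous_intros)
    hence "integral {0..1} (\<lambda>x. (\<Phi> x - of_real (1 / sqrt t) * \<Psi> x) * cis (2 * pi * of_int k * x)) = 0" for k :: int
      unfolding coeff\<Phi> coeff\<Psi> by simp
    thus "fourier_null (\<lambda>x. \<Phi> x - of_real (1 / sqrt t) * \<Psi> x)"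
      unfolding fourier_null_def by (intro conjI allI continuous_intros cont\<Phi> cont\<Psi>)
  qed
  thus ?thesis by (simp add: \<Phi>_def \<Psi>_def)
qed

section \<open>Theta series of self-dual lattices\<close>

lemma gaussian_summable_multi:
  fixes c :: "'n::finite \<Rightarrow> real"
  assumes "\<And>j. c j > 0"
  shows "(\<lambda>n::'n \<Rightarrow> int. exp (- (\<Sum>j\<in>UNIV. c j * (of_int (n j))\<^sup>2))) summable_on UNIV"
proof -
  have "Infinite_Set_Sum.abs_summable_on (\<lambda>g. \<Prod>j\<in>UNIV. exp (- c j * (of_int (g j))\<^sup>2))
      (PiE (UNIV :: 'n set) (\<lambda>_. UNIV :: int set))"
  proof (rule abs_summable_on_prod_PiE)
    fix j
    have "(\<lambda>n::int. norm (exp (- c j * (of_int n)\<^sup>2))) summable_on UNIV"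
      using gaussian_summable[OF assms] by simp
    thus "Infinite_Set_Sum.abs_summable_on (\<lambda>n::int. exp (- c j * (of_int n)\<^sup>2)) UNIV"
      by (rule abs_summable_equivalent[THEN iffD1])
  qed auto
  hence "(\<lambda>g. norm (\<Prod>j\<in>UNIV. exp (- c j * (of_int (g j))\<^sup>2))) summable_on (UNIV :: ('n \<Rightarrow> int) set)"
    by (simp add: abs_summable_equivalent[symmetric] PiE_UNIV_domain Pi_UNIV)
  thus ?thesis by (simp add: exp_sum[symmetric] sum_negf)
qed

lemma infsum_prod_UNIV:
  fixes f :: "'n::finite \<Rightarrow> 'b \<Rightarrow> complex"
  assumes "\<And>j. (\<lambda>n. norm (f j n)) summable_on UNIV"
  shows "(\<Sum>\<^sub>\<infinity>g. \<Prod>j\<in>UNIV. f j (g j)) = (\<Prod>j\<in>UNIV. \<Sum>\<^sub>\<infinity>n. f j n)"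
  using infsum_prod_PiE_abs[of UNIV f "\<lambda>_. UNIV"] assms by (simp add: PiE_UNIV_domain Pi_UNIV)

lemma infsum_finite_sum:
  fixes f :: "'a \<Rightarrow> 'b \<Rightarrow> complex"
  assumes "finite R" "\<And>r. r \<in> R \<Longrightarrow> f r summable_on A"
  shows "(\<Sum>\<^sub>\<infinity>x\<in>A. \<Sum>r\<in>R. f r x) = (\<Sum>r\<in>R. infsum (f r) A)"
proof -
  have "((\<lambda>x. \<Sum>r\<in>R. f r x) has_sum (\<Sum>r\<in>R. infsum (f r) A)) A"
    using assms by (induction R) (auto intro!: has_sum_add has_sum_0)
  thus ?thesis by (rule infsumI)
qed

text \<open>Dual coordinates for an orthogonal basis with squared lengths \<open>q j\<close>, where
  the form is the sum of n_j k_j / q_j. The assumption \<open>N_mult\<close> says that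
  \<open>N\<close> contains the span of that basis, and \<open>N_dual\<close> is
  self-duality.\<close>

locale selfdual_lattice =
  fixes q :: "'n::finite \<Rightarrow> int" and N :: "('n \<Rightarrow> int) set"
  assumes q_pos: "q j > 0"
    and N_diff: "m \<in> N \<Longrightarrow> k \<in> N \<Longrightarrow> (\<lambda>j. m j - k j) \<in> N"
    and N_mult: "(\<lambda>j. q j * k j) \<in> N"
    and N_dual: "n \<in> N \<longleftrightarrow> (\<forall>k\<in>N. (\<Sum>j\<in>UNIV. real_of_int (n j * k j) / real_of_int (q j)) \<in> \<int>)"
begin

definition pr :: "('n \<Rightarrow> int) \<Rightarrow> ('n \<Rightarrow> int) \<Rightarrow> real" where
  "pr n k = (\<Sum>j\<in>UNIV. real_of_int (n j * k j) / real_of_int (q j))"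

lemma N_0: "(\<lambda>_. 0) \<in> N"
  using N_mult[of "\<lambda>_. 0"] by simp

lemma N_add:
  assumes "m \<in> N" "k \<in> N"
  shows "(\<lambda>j. m j + k j) \<in> N"
  using N_diff[OF assms(1) N_diff[OF N_0 assms(2)]] by simp

lemma pr_add_right: "pr n (\<lambda>j. k j + l j) = pr n k + pr n l"
  by (simp add: pr_def distrib_left add_divide_distrib sum.distrib)

lemma pr_mult_right: "pr n (\<lambda>j. q j * k j) = of_int (\<Sum>j\<in>UNIV. n j * k j)"
  unfolding pr_def of_int_sum
proof (intro sum.cong refl)
  fix j show "real_of_int (n j * (q j * k j)) / real_of_int (q j) = of_int (n j * k j)"
    using q_pos[of j] by simp
qed

lemma theta_summable:
  assumes "c > 0"
  shows "(\<lambda>n. exp (- c * pr n n)) summable_on UNIV"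
proof -
  have "(\<lambda>n::'n \<Rightarrow> int. exp (- (\<Sum>j\<in>UNIV. c / of_int (q j) * (of_int (n j))\<^sup>2))) summable_on UNIV"
    using assms q_pos by (intro gaussian_summable_multi) auto
  moreover have "(\<Sum>j\<in>UNIV. c / of_int (q j) * (of_int (n j))\<^sup>2) = c * pr n n" for n
    by (simp add: pr_def sum_distrib_left power2_eq_square)
  ultimately show ?thesis by simp
qed

text \<open>Representatives of \<open>N\<close> modulo the orthogonal sublattice of vectors whose
  coordinates are divisible by the \<open>q j\<close>.\<close>

definition reps :: "('n \<Rightarrow> int) set" where
  "reps = {r \<in> N. \<forall>j. 0 \<le> r j \<and> r j < q j}"

lemma finite_reps: "finite reps"
proof -
  have "reps \<subseteq> (\<Pi>\<^sub>E j\<in>UNIV. {0..<q j})" by (auto simp: reps_def)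
  thus ?thesis by (rule finite_subset) (auto intro!: finite_PiE)
qed

lemma mod_in_reps:
  assumes "n \<in> N"
  shows "(\<lambda>j. n j mod q j) \<in> reps"
proof -
  have "(\<lambda>j. n j - q j * (n j div q j)) \<in> N" by (intro N_diff assms N_mult)
  thus ?thesis using q_pos by (auto simp: reps_def minus_mult_div_eq_mod)
qed

lemma bij_reps: "bij_betw (\<lambda>(r, k) j. r j + q j * k j) (reps \<times> UNIV) N"
proof (rule bij_betw_byWitness[where f' = "\<lambda>n. (\<lambda>j. n j mod q j, \<lambda>j. n j div q j)"])
  show "\<forall>a\<in>reps \<times> UNIV. (\<lambda>n. (\<lambda>j. n j mod q j, \<lambda>j. n j div q j)) (case a of (r, k) \<Rightarrow> \<lambda>j. r j + q j * k j) = a"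
  proof (clarify, intro conjI ext)
    fix r k j assume "r \<in> reps"
    hence "0 \<le> r j" "r j < q j" by (auto simp: reps_def)
    thus "(r j + q j * k j) mod q j = r j" "(r j + q j * k j) div q j = k j" by auto
  qed
  show "\<forall>n\<in>N. (case (\<lambda>j. n j mod q j, \<lambda>j. n j div q j) of (r, k) \<Rightarrow> \<lambda>j. r j + q j * k j) = n"
    by auto
  show "(\<lambda>(r, k) j. r j + q j * k j) ` (reps \<times> UNIV) \<subseteq> N"
    by (auto simp: reps_def intro!: N_add N_mult)
  show "(\<lambda>n. (\<lambda>j. n j mod q j, \<lambda>j. n j div q j)) ` N \<subseteq> reps \<times> UNIV"
    using mod_in_reps by auto
qed

text \<open>Pairing with n induces a character of the finite quotient of \<open>N\<close> by the
  orthogonal sublattice, and self-duality makes it trivial exactly for n in \<open>N\<close>.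
  Otherwise translation by some \<open>s\<close> multiplies the sum by a number other than
  1.\<close>

lemma character_sum: "(\<Sum>r\<in>reps. cis (2 * pi * pr n r)) = (if n \<in> N then of_nat (card reps) else 0)"
proof (cases "n \<in> N")
  case True
  have "cis (2 * pi * pr n r) = 1" if "r \<in> reps" for r
    using True that N_dual[of n] by (intro cis_multiple_2pi) (auto simp: pr_def reps_def)
  thus ?thesis using True by simp
next
  case False
  then obtain s where s: "s \<in> N" "pr n s \<notin> \<int>" using N_dual[of n] by (auto simp: pr_def)
  \<comment> \<open>Translation by \<open>s\<close>, brought back to the chosen
    representatives.\<close>
  define sh where "sh r = (\<lambda>j. (r j + s j) mod q j)" for r
  have inj: "inj_on sh reps"
  proof (rule inj_onI, rule ext)
    fix r r' j assume r: "r \<in> reps" "r' \<in> reps" and eq: "sh r = sh r'"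
    have "(r j + s j) mod q j = (r' j + s j) mod q j" using fun_cong[OF eq, of j] by (simp add: sh_def)
    hence "q j dvd (r j + s j) - (r' j + s j)" by (simp only: mod_eq_dvd_iff)
    hence "q j dvd r j - r' j" by simp
    hence "r j mod q j = r' j mod q j" by (simp only: mod_eq_dvd_iff)
    thus "r j = r' j" using r by (simp add: reps_def)
  qed
  have sub: "sh ` reps \<subseteq> reps"
    unfolding sh_def using mod_in_reps N_add s(1) by (auto simp: reps_def)
  hence "sh ` reps = reps" using endo_inj_surj[OF finite_reps _ inj] by blast
  hence bij: "bij_betw sh reps reps" using inj by (simp add: bij_betw_def)
  have cis_sh: "cis (2 * pi * pr n (sh r)) = cis (2 * pi * pr n s) * cis (2 * pi * pr n r)" for r
  proof -
    define k where "k = (\<lambda>j. (r j + s j) div q j)"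
    have "(\<lambda>j. r j + s j) = (\<lambda>j. sh r j + q j * k j)" by (simp add: sh_def k_def fun_eq_iff)
    hence "pr n r + pr n s = pr n (sh r) + of_int (\<Sum>j\<in>UNIV. n j * k j)"
      by (metis pr_add_right pr_mult_right)
    hence "2 * pi * pr n s + 2 * pi * pr n r = 2 * pi * pr n (sh r) + 2 * pi * of_int (\<Sum>j\<in>UNIV. n j * k j)"
      by (simp add: distrib_left[symmetric] add.commute)
    hence "cis (2 * pi * pr n s) * cis (2 * pi * pr n r) = cis (2 * pi * pr n (sh r)) * cis (2 * pi * of_int (\<Sum>j\<in>UNIV. n j * k j))"
      by (simp only: cis_mult)
    also have "cis (2 * pi * of_int (\<Sum>j\<in>UNIV. n j * k j)) = 1" by (rule cis_multiple_2pi) (rule Ints_of_int)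
    finally show ?thesis by simp
  qed
  have "(\<Sum>r\<in>reps. cis (2 * pi * pr n r)) = (\<Sum>r\<in>reps. cis (2 * pi * pr n (sh r)))"
    by (rule sum.reindex_bij_betw[OF bij, symmetric])
  also have "\<dots> = cis (2 * pi * pr n s) * (\<Sum>r\<in>reps. cis (2 * pi * pr n r))"
    by (simp add: cis_sh sum_distrib_left)
  finally have "(1 - cis (2 * pi * pr n s)) * (\<Sum>r\<in>reps. cis (2 * pi * pr n r)) = 0"
    by (simp add: left_diff_distrib)
  moreover have "cis (2 * pi * pr n s) \<noteq> 1"
  proof
    assume "cis (2 * pi * pr n s) = 1"
    hence "cos (2 * pi * pr n s) = 1" by (simp add: complex_eq_iff)
    then obtain k :: int where "2 * pi * pr n s = of_int k * 2 * pi" by (auto simp: cos_one_2pi_int)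
    hence "pr n s = of_int k" by simp
    thus False using s(2) by simp
  qed
  ultimately show ?thesis using False by simp
qed

definition thetasum :: "real \<Rightarrow> complex" where
  "thetasum t = (\<Sum>\<^sub>\<infinity>n\<in>N. complex_of_real (exp (- pi * t * pr n n)))"

lemma thetasum_transform:
  assumes t: "t > 0"
  shows "thetasum t = of_real ((\<Prod>j\<in>UNIV. 1 / sqrt (t * of_int (q j))) * of_nat (card reps)) * thetasum (1 / t)"
proof -
  \<comment> \<open>One coordinate of the coset of r: (r + q k)^2 / q = q (k + r/q)^2 has the shape
    required by \<open>poisson_gaussian\<close>, with parameter t q and shift r/q.\<close>
  define e where "e = (\<lambda>r k j. complex_of_real (exp (- pi * (t * of_int (q j)) * (of_int k + of_int (r j) / of_int (q j))\<^sup>2)))"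
  have qt: "t * of_int (q j) > 0" for j using t q_pos[of j] by simp
  have term_eq: "complex_of_real (exp (- pi * t * pr (\<lambda>j. r j + q j * k j) (\<lambda>j. r j + q j * k j))) = (\<Prod>j\<in>UNIV. e r (k j) j)" for r k
  proof -
    have "- pi * t * pr (\<lambda>j. r j + q j * k j) (\<lambda>j. r j + q j * k j)
        = (\<Sum>j\<in>UNIV. - pi * (t * of_int (q j)) * (of_int (k j) + of_int (r j) / of_int (q j))\<^sup>2)"
      unfolding pr_def sum_distrib_left
    proof (intro sum.cong refl)
      fix j
      have "of_int (q j) \<noteq> (0::real)" using q_pos[of j] by simp
      thus "- pi * t * (real_of_int ((r j + q j * k j) * (r j + q j * k j)) / of_int (q j))
          = - pi * (t * of_int (q j)) * (of_int (k j) + of_int (r j) / of_int (q j))\<^sup>2"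
        by (simp add: power2_eq_square field_simps)
    qed
    thus ?thesis by (simp only: e_def exp_sum[OF finite] of_real_prod)
  qed
  have e_summable: "(\<lambda>k. norm (e r k j)) summable_on UNIV" for r j
  proof (rule summable_on_comparison_test)
    define K where "K = \<bar>of_int (r j) / real_of_int (q j)\<bar>"
    show "(\<lambda>k::int. exp (pi * (t * of_int (q j)) * K\<^sup>2) * exp (- (pi * (t * of_int (q j)) / 2) * (of_int k)\<^sup>2)) summable_on UNIV"
      using qt[of j] by (intro summable_on_cmult_right gaussian_summable) auto
    show "norm (e r k j) \<le> exp (pi * (t * of_int (q j)) * K\<^sup>2) * exp (- (pi * (t * of_int (q j)) / 2) * (of_int k)\<^sup>2)" for k
      using gaussian_shift_bound[OF _ qt[of j], of "of_int (r j) / real_of_int (q j)" K "of_int k"]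
      by (simp add: e_def K_def)
  qed auto
  \<comment> \<open>The terms on the dual side of the one-dimensional formula; their product over
    the coordinates is a Gaussian in \<open>pr n n\<close> times the character of n at r.\<close>
  define d where "d = (\<lambda>r k j. of_real (exp (- pi / (t * of_int (q j)) * (of_int k)\<^sup>2)) * cis (2 * pi * of_int k * (of_int (r j) / of_int (q j))))"
  have d_summable: "(\<lambda>k. norm (d r k j)) summable_on UNIV" for r j
    using gaussian_summable[of "pi / (t * of_int (q j))"] qt[of j] by (simp add: d_def norm_mult)
  have d_prod: "(\<Prod>j\<in>UNIV. d r (n j) j) = of_real (exp (- pi * (1 / t) * pr n n)) * cis (2 * pi * pr n r)" for r n
  proof -
    have "(\<Prod>j\<in>UNIV. d r (n j) j) = of_real (\<Prod>j\<in>UNIV. exp (- pi / (t * of_int (q j)) * (of_int (n j))\<^sup>2))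
        * (\<Prod>j\<in>UNIV. cis (2 * pi * of_int (n j) * (of_int (r j) / of_int (q j))))"
      by (simp add: d_def prod.distrib)
    also have "(\<Prod>j\<in>UNIV. exp (- pi / (t * of_int (q j)) * (of_int (n j))\<^sup>2)) = exp (- pi * (1 / t) * pr n n)"
      by (simp add: exp_sum[symmetric] pr_def sum_distrib_left power2_eq_square mult_ac)
    also have "(\<Prod>j\<in>UNIV. cis (2 * pi * of_int (n j) * (of_int (r j) / of_int (q j)))) = cis (2 * pi * pr n r)"
      by (simp add: cis_conv_exp exp_sum[symmetric] pr_def sum_distrib_left mult_ac)
    finally show ?thesis .
  qed
  define g where "g = (\<lambda>r n. complex_of_real (exp (- pi * (1 / t) * pr n n)) * cis (2 * pi * pr n r))"
  have g_summable: "g r summable_on UNIV" for r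
  proof (rule abs_summable_summable)
    show "(\<lambda>n. norm (g r n)) summable_on UNIV"
      using theta_summable[of "pi * (1 / t)"] t by (simp add: g_def norm_mult)
  qed
  define C where "C = (\<Prod>j\<in>UNIV. 1 / sqrt (t * of_int (q j)))"
  have coset: "(\<Sum>\<^sub>\<infinity>k. \<Prod>j\<in>UNIV. e r (k j) j) = of_real C * infsum (g r) UNIV" for r
  proof -
    have "(\<Sum>\<^sub>\<infinity>k. \<Prod>j\<in>UNIV. e r (k j) j) = (\<Prod>j\<in>UNIV. \<Sum>\<^sub>\<infinity>k. e r k j)"
      by (rule infsum_prod_UNIV[of "\<lambda>j k. e r k j"]) (rule e_summable)
    also have "\<dots> = (\<Prod>j\<in>UNIV. of_real (1 / sqrt (t * of_int (q j))) * (\<Sum>\<^sub>\<infinity>k. d r k j))"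
      unfolding e_def d_def by (intro prod.cong refl poisson_gaussian qt)
    also have "\<dots> = of_real C * (\<Prod>j\<in>UNIV. \<Sum>\<^sub>\<infinity>k. d r k j)"
      by (simp only: prod.distrib C_def of_real_prod)
    also have "(\<Prod>j\<in>UNIV. \<Sum>\<^sub>\<infinity>k. d r k j) = (\<Sum>\<^sub>\<infinity>n. \<Prod>j\<in>UNIV. d r (n j) j)"
      by (rule infsum_prod_UNIV[of "\<lambda>j k. d r k j", symmetric]) (rule d_summable)
    also have "\<dots> = infsum (g r) UNIV"
      by (simp only: d_prod g_def)
    finally show ?thesis .
  qed
  have N_summable: "(\<lambda>n. complex_of_real (exp (- pi * t * pr n n))) summable_on N"
  proof (rule abs_summable_summable)
    have "(\<lambda>n. exp (- (pi * t) * pr n n)) summable_on N"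
      by (rule summable_on_subset_banach[OF theta_summable]) (use t in auto)
    thus "(\<lambda>n. norm (complex_of_real (exp (- pi * t * pr n n)))) summable_on N" by simp
  qed
  have "thetasum t = (\<Sum>\<^sub>\<infinity>(r, k)\<in>reps \<times> UNIV. \<Prod>j\<in>UNIV. e r (k j) j)"
    unfolding thetasum_def infsum_reindex_bij_betw[OF bij_reps, symmetric]
    by (simp only: case_prod_unfold term_eq)
  also have "\<dots> = (\<Sum>\<^sub>\<infinity>r\<in>reps. \<Sum>\<^sub>\<infinity>k. \<Prod>j\<in>UNIV. e r (k j) j)"
  proof (rule infsum_Sigma'_banach[symmetric])
    have "(\<lambda>x. complex_of_real (exp (- pi * t * pr (case x of (r, k) \<Rightarrow> \<lambda>j. r j + q j * k j) (case x of (r, k) \<Rightarrow> \<lambda>j. r j + q j * k j)))) summable_on reps \<times> UNIV"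
      using N_summable by (rule summable_on_reindex_bij_betw[OF bij_reps, THEN iffD2])
    thus "(\<lambda>(r, k). \<Prod>j\<in>UNIV. e r (k j) j) summable_on reps \<times> UNIV"
      by (simp only: case_prod_unfold term_eq)
  qed
  also have "\<dots> = (\<Sum>r\<in>reps. of_real C * infsum (g r) UNIV)"
    by (simp only: coset infsum_finite[OF finite_reps])
  also have "\<dots> = of_real C * (\<Sum>\<^sub>\<infinity>n. \<Sum>r\<in>reps. g r n)"
    using infsum_finite_sum[OF finite_reps g_summable] by (simp add: sum_distrib_left)
  \<comment> \<open>The only use of self-duality in this computation: summing the characters over
    the cosets removes every n outside \<open>N\<close>.\<close>
  also have "(\<lambda>n. \<Sum>r\<in>reps. g r n) = (\<lambda>n. of_real (exp (- pi * (1 / t) * pr n n)) * (if n \<in> N then of_nat (card reps) else 0))"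
    by (simp only: g_def sum_distrib_left[symmetric] character_sum)
  also have "(\<Sum>\<^sub>\<infinity>n. of_real (exp (- pi * (1 / t) * pr n n)) * (if n \<in> N then of_nat (card reps) else 0))
      = (\<Sum>\<^sub>\<infinity>n\<in>N. of_real (exp (- pi * (1 / t) * pr n n)) * of_nat (card reps))"
    by (rule infsum_cong_neutral) auto
  also have "\<dots> = thetasum (1 / t) * of_nat (card reps)"
    unfolding thetasum_def by (rule infsum_cmult_left')
  finally show ?thesis by (simp add: C_def mult_ac)
qed

text \<open>All terms are positive and the one at 0 equals 1. This allows cancelling
  \<open>thetasum\<close> at t = 1, and shows later that the diagonal series does not vanish at
  \<i>.\<close>

lemma thetasum_pos:
  assumes "t > 0"
  shows "Re (thetasum t) > 0"
proof -
  have s: "(\<lambda>n. exp (- pi * t * pr n n)) summable_on N"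
    using summable_on_subset_banach[OF theta_summable[of "pi * t"] subset_UNIV] assms by simp
  have "thetasum t = of_real (\<Sum>\<^sub>\<infinity>n\<in>N. exp (- pi * t * pr n n))"
    unfolding thetasum_def using has_sum_of_real[OF has_sum_infsum[OF s]] by (rule infsumI)
  moreover have "(\<Sum>\<^sub>\<infinity>n\<in>{\<lambda>_. 0}. exp (- pi * t * pr n n)) \<le> (\<Sum>\<^sub>\<infinity>n\<in>N. exp (- pi * t * pr n n))"
    by (rule infsum_mono_neutral) (use s N_0 in auto)
  ultimately show ?thesis by (simp add: pr_def)
qed

text \<open>The constant \<open>K\<close>, the index of the orthogonal sublattice over the root of
  the product of the \<open>q j\<close>, does not depend on t. The transformation fixes t = 1, and
  comparing both sides there forces \<open>K\<close> to be 1.\<close>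

theorem thetasum_inversion:
  assumes t: "t > 0"
  shows "of_real (sqrt t) ^ CARD('n) * thetasum t = thetasum (1 / t)"
proof -
  define K where "K = (\<Prod>j\<in>UNIV. 1 / sqrt (of_int (q j))) * of_nat (card reps)"
  have C: "(\<Prod>j\<in>UNIV. 1 / sqrt (t * of_int (q j))) * of_nat (card reps) = K / sqrt t ^ CARD('n)" for t
    by (simp add: K_def real_sqrt_mult prod_dividef prod.distrib)
  have "thetasum 1 = of_real K * thetasum 1"
    using thetasum_transform[OF less_numeral_extra(1)] unfolding C[of 1] by simp
  moreover have "thetasum 1 \<noteq> 0" using thetasum_pos[of 1] by auto
  ultimately have "complex_of_real K = 1" by simp
  hence "thetasum t = thetasum (1 / t) / of_real (sqrt t ^ CARD('n))"
    using thetasum_transform[OF t] unfolding C[of t] by simp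
  thus ?thesis using t by (simp add: field_simps)
qed

end

section \<open>The theta function\<close>

lemma summable_on_prod_mult:
  fixes f :: "'a \<Rightarrow> complex" and g :: "'b \<Rightarrow> complex"
  assumes f: "(\<lambda>x. norm (f x)) summable_on A" and g: "(\<lambda>x. norm (g x)) summable_on B"
  shows "(\<lambda>(x, y). f x * g y) summable_on A \<times> B"
    and "infsum f A * infsum g B = (\<Sum>\<^sub>\<infinity>(x, y)\<in>A \<times> B. f x * g y)"
proof -
  have "(\<lambda>p. norm ((\<lambda>(x, y). f x * g y) p)) summable_on A \<times> B"
    unfolding Infinite_Sum.abs_summable_on_Sigma_iff
    using f g by (auto simp: norm_mult infsum_cmult_right' infsum_nonneg abs_mult
        intro!: summable_on_cmult_right summable_on_cmult_left)
  thus *: "(\<lambda>(x, y). f x * g y) summable_on A \<times> B" by (rule abs_summable_summable)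
  show "infsum f A * infsum g B = (\<Sum>\<^sub>\<infinity>(x, y)\<in>A \<times> B. f x * g y)"
    using infsum_Sigma'_banach[OF *] by (simp add: infsum_cmult_right' infsum_cmult_left')
qed

definition theta_term :: "complex \<Rightarrow> int \<Rightarrow> complex" where
  "theta_term z n = exp (2 * of_real pi * \<i> * of_int (n\<^sup>2) * z)"

lemma theta_eq: "theta z = (\<Sum>\<^sub>\<infinity>n. theta_term z n)"
  by (simp add: theta_def theta_term_def)

lemma norm_theta_term: "norm (theta_term z n) = exp (- (2 * pi * Im z) * (of_int n)\<^sup>2)"
  by (simp add: theta_term_def mult_ac)

lemma theta_term_summable:
  assumes "Im z > 0"
  shows "(\<lambda>n. norm (theta_term z n)) summable_on UNIV"
  unfolding norm_theta_term using assms by (intro gaussian_summable) auto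

lemma theta_term_half: "theta_term (z + 1/2) n = (if even n then 1 else -1) * theta_term z n"
proof -
  have "theta_term (z + 1/2) n = exp (of_real pi * \<i> * of_int (n\<^sup>2)) * theta_term z n"
    by (simp add: theta_term_def exp_add[symmetric] algebra_simps)
  also have "exp (of_real pi * \<i> * of_int (n\<^sup>2)) = (if even n then 1 else -1)"
  proof (cases "even n")
    case True
    then obtain k where k: "n = 2 * k" by blast
    have "exp (of_real pi * \<i> * of_int (n\<^sup>2)) = 1"
      unfolding exp_eq_1 by (auto simp: k power2_eq_square intro!: exI[of _ "2 * k * k"])
    thus ?thesis using True by simp
  next
    case False
    then obtain k where k: "n = 2 * k + 1" using oddE by blast
    have "of_real pi * \<i> * of_int (n\<^sup>2) = of_real pi * \<i> * of_int (4 * k * k + 4 * k) + of_real pi * \<i>"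
      by (simp add: k power2_eq_square algebra_simps)
    moreover have "exp (of_real pi * \<i> * of_int (4 * k * k + 4 * k)) = 1"
      unfolding exp_eq_1 by (auto intro!: exI[of _ "2 * k * k + 2 * k"])
    ultimately show ?thesis using False by (simp add: exp_add)
  qed
  finally show ?thesis .
qed

text \<open>In the double sum, exchanging m and n reverses the sign of the terms with m + n odd, so
  these cancel. The others are m = a + b, n = a - b, where m^2 + n^2 = 2a^2 + 2b^2 and the sign
  (-1)^n splits as (-1)^a (-1)^b.\<close>

lemma theta_duplication:
  assumes z: "Im z > 0"
  shows "theta z * theta (z + 1/2) = (theta (2 * z + 1/2))\<^sup>2"
proof -
  define s :: "int \<Rightarrow> complex" where "s n = (if even n then 1 else -1)" for n
  define g where "g = (\<lambda>(m, n). theta_term z m * (s n * theta_term z n))"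
  have half: "theta_term (w + 1/2) n = s n * theta_term w n" for w n
    by (simp add: theta_term_half s_def)
  have sum1: "g summable_on UNIV \<times> UNIV" "theta z * theta (z + 1/2) = infsum g (UNIV \<times> UNIV)"
    using summable_on_prod_mult[OF theta_term_summable[OF z] theta_term_summable[of "z + 1/2"]] z
    unfolding theta_eq g_def half by simp_all
  define P where "P = {(m, n::int). even (m + n)}"
  define D where "D = {(m, n::int). odd (m + n)}"
  have PD: "UNIV \<times> UNIV = P \<union> D" "P \<inter> D = {}" by (auto simp: P_def D_def)
  have sumP: "g summable_on P" and sumD: "g summable_on D"
    using sum1(1) by (auto intro: summable_on_subset_banach)
  have "infsum g D = infsum (\<lambda>p. g (prod.swap p)) D"
  proof (rule infsum_reindex_bij_betw[symmetric])
    show "bij_betw prod.swap D D"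
      by (rule bij_betw_byWitness[where f' = prod.swap]) (auto simp: D_def add.commute)
  qed
  also have "\<dots> = infsum (\<lambda>p. - g p) D"
    by (rule infsum_cong) (auto simp: g_def D_def s_def)
  also have "\<dots> = - infsum g D" by (rule infsum_uminus)
  finally have D0: "infsum g D = 0" by simp
  have "theta z * theta (z + 1/2) = infsum g P"
    unfolding sum1(2) PD(1) infsum_Un_disjoint[OF sumP sumD PD(2)] D0 by simp
  also have "\<dots> = infsum (\<lambda>(a, b). g (a + b, a - b)) (UNIV \<times> UNIV)"
  proof -
    have "bij_betw (\<lambda>(a, b). (a + b, a - b)) (UNIV \<times> UNIV) P"
    proof (rule bij_betw_byWitness[where f' = "\<lambda>(m, n). ((m + n) div 2, (m - n) div 2)"])
      show "\<forall>p\<in>P. (\<lambda>(a, b). (a + b, a - b)) (case p of (m, n) \<Rightarrow> ((m + n) div 2, (m - n) div 2)) = p"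
        unfolding P_def by clarsimp presburger
    qed (auto simp: P_def)
    from infsum_reindex_bij_betw[OF this, of g] show ?thesis by (simp add: case_prod_unfold)
  qed
  also have "(\<lambda>(a, b). g (a + b, a - b)) = (\<lambda>(a, b). theta_term (2 * z + 1/2) a * theta_term (2 * z + 1/2) b)"
  proof (rule ext, clarify)
    fix a b :: int
    have "theta_term z (a + b) * theta_term z (a - b) = theta_term (2 * z) a * theta_term (2 * z) b"
      by (simp add: theta_term_def exp_add[symmetric] power2_eq_square algebra_simps)
    moreover have "s (a - b) = s a * s b" by (auto simp: s_def)
    ultimately show "g (a + b, a - b) = theta_term (2 * z + 1/2) a * theta_term (2 * z + 1/2) b"
      by (simp add: g_def half mult_ac)
  qed
  also have "infsum (\<lambda>(a, b). theta_term (2 * z + 1/2) a * theta_term (2 * z + 1/2) b) (UNIV \<times> UNIV) = (theta (2 * z + 1/2))\<^sup>2"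
    using summable_on_prod_mult(2)[OF theta_term_summable theta_term_summable, of "2 * z + 1/2" "2 * z + 1/2"] z
    unfolding theta_eq power2_eq_square by simp
  finally show ?thesis .
qed

lemma theta_nonzero_large: "\<exists>Y>0. \<forall>z. Im z \<ge> Y \<longrightarrow> theta z \<noteq> 0"
proof -
  define S where "S = (\<Sum>\<^sub>\<infinity>n::int. exp (- (2 * pi) * (of_int n)\<^sup>2))"
  have sumS: "(\<lambda>n::int. exp (- (2 * pi) * (of_int n)\<^sup>2)) summable_on UNIV"
    by (rule gaussian_summable) simp
  have S0: "S \<ge> 0" unfolding S_def by (rule infsum_nonneg) simp
  \<comment> \<open>For n nonzero, n^2 \<ge> 1 lets exp(-2 pi (Im z - 1)) be extracted from each
    term, leaving at most \<open>S\<close> in total. At this height the extracted factor is at most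
    exp(-S), and S exp(-S) < 1 while the term at 0 is 1.\<close>
  define Y where "Y = 1 + S"
  have "theta z \<noteq> 0" if Y: "Im z \<ge> Y" for z
  proof
    assume 0: "theta z = 0"
    have z: "Im z > 0" using Y S0 by (simp add: Y_def)
    define A where "A = UNIV - {0::int}"
    have sumA: "(\<lambda>n. norm (theta_term z n)) summable_on A"
      by (rule summable_on_subset_banach[OF theta_term_summable[OF z]]) simp
    have "theta z = infsum (theta_term z) ({0} \<union> A)" by (simp add: theta_eq A_def)
    also have "\<dots> = theta_term z 0 + infsum (theta_term z) A"
      using infsum_Un_disjoint[OF _ abs_summable_summable[OF sumA], of "{0}"] by (simp add: A_def)
    finally have "infsum (theta_term z) A = - 1" using 0 by (simp add: theta_term_def eq_neg_iff_add_eq_0 add.commute)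
    hence "1 \<le> (\<Sum>\<^sub>\<infinity>n\<in>A. norm (theta_term z n))" using norm_infsum_bound[OF sumA] by simp
    also have "\<dots> \<le> (\<Sum>\<^sub>\<infinity>n\<in>A. exp (- (2 * pi * (Im z - 1))) * exp (- (2 * pi) * (of_int n)\<^sup>2))"
    proof (rule infsum_mono[OF sumA])
      show "(\<lambda>n::int. exp (- (2 * pi * (Im z - 1))) * exp (- (2 * pi) * (of_int n)\<^sup>2)) summable_on A"
        by (intro summable_on_cmult_right summable_on_subset_banach[OF sumS]) simp
      fix n :: int assume "n \<in> A"
      hence "n\<^sup>2 \<ge> 1" by (simp add: A_def int_one_le_iff_zero_less)
      hence n: "(real_of_int n)\<^sup>2 \<ge> 1" by (metis of_int_1_le_iff of_int_power)
      have "2 * pi * (Im z - 1) * 1 \<le> 2 * pi * (Im z - 1) * (real_of_int n)\<^sup>2"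
        using n Y S0 by (intro mult_left_mono) (auto simp: Y_def)
      thus "norm (theta_term z n) \<le> exp (- (2 * pi * (Im z - 1))) * exp (- (2 * pi) * (of_int n)\<^sup>2)"
        unfolding norm_theta_term exp_add[symmetric] by (simp add: algebra_simps)
    qed
    also have "\<dots> = exp (- (2 * pi * (Im z - 1))) * (\<Sum>\<^sub>\<infinity>n\<in>A. exp (- (2 * pi) * (of_int n)\<^sup>2))"
      by (rule infsum_cmult_right')
    also have "\<dots> \<le> exp (- (2 * pi * (Im z - 1))) * S"
      unfolding S_def
      by (intro mult_left_mono infsum_mono2 summable_on_subset_banach[OF sumS] sumS) auto
    also have "\<dots> \<le> exp (- S) * S"
    proof (intro mult_right_mono S0)
      have "1 * S \<le> 2 * pi * (Im z - 1)" using Y S0 pi_gt3 by (intro mult_mono) (auto simp: Y_def)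
      thus "exp (- (2 * pi * (Im z - 1))) \<le> exp (- S)" by simp
    qed
    also have "\<dots> < 1"
    proof -
      have "S < exp S" using exp_ge_add_one_self[of S] by linarith
      thus ?thesis by (simp add: exp_minus field_simps)
    qed
    finally show False by simp
  qed
  moreover have "Y > 0" using S0 by (simp add: Y_def)
  ultimately show ?thesis by blast
qed

lemma theta_nonzero:
  assumes z: "Im z > 0"
  shows "theta z \<noteq> 0"
proof -
  obtain Y where Y: "Y > 0" "\<And>z. Im z \<ge> Y \<Longrightarrow> theta z \<noteq> 0" using theta_nonzero_large by blast
  \<comment> \<open>Stated at w + 1/2 so that the induction closes: duplication at w leads to 2w +
    1/2, a point of the same form with twice the height.\<close>
  have *: "theta (w + 1/2) \<noteq> 0" if "Im w > 0" "2 ^ k * Im w \<ge> Y" for k w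
    using that
  proof (induction k arbitrary: w)
    case 0
    thus ?case by (intro Y(2)) simp
  next
    case (Suc k)
    have "theta (2 * w + 1/2) \<noteq> 0" using Suc.prems by (intro Suc.IH) (auto simp: mult_ac)
    thus ?case using theta_duplication[OF Suc.prems(1)] by auto
  qed
  obtain k where "Y / Im z < 2 ^ k" using real_arch_pow[of 2] by auto
  hence "2 ^ k * Im z \<ge> Y" using z by (simp add: field_simps)
  hence "2 ^ k * Im (2 * z) \<ge> Y" using Y(1) by simp
  hence "theta (2 * z + 1/2) \<noteq> 0" using z by (intro *[of "2 * z" k]) auto
  thus ?thesis using theta_duplication[OF z] by auto
qed

text \<open>Serves both theta series, with \<open>Q\<close> equal to n^2 or to the twisted trace
  form. The convergence is locally uniform because the terms decay uniformly at heights bounded away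
  from 0.\<close>

lemma theta_series_holomorphic:
  fixes Q :: "'i \<Rightarrow> real"
  assumes nonneg: "\<And>i. i \<in> I \<Longrightarrow> Q i \<ge> 0"
    and summable: "\<And>c. c > 0 \<Longrightarrow> (\<lambda>i. exp (- c * Q i)) summable_on I"
  shows "(\<lambda>z. \<Sum>\<^sub>\<infinity>i\<in>I. exp (2 * of_real pi * \<i> * of_real (Q i) * z)) holomorphic_on {z. Im z > 0}"
  unfolding holomorphic_on_open[OF open_halfspace_Im_gt]
proof
  fix z0 :: complex assume "z0 \<in> {z. Im z > 0}"
  hence z0: "Im z0 > 0" by simp
  define r where "r = Im z0 / 2"
  define F where "F = finite_subsets_at_top I"
  have bound: "norm (exp (2 * of_real pi * \<i> * of_real (Q i) * z)) \<le> exp (- (2 * pi * r) * Q i)"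
    if "i \<in> I" "z \<in> cball z0 r" for i z
  proof -
    have "\<bar>Im (z0 - z)\<bar> \<le> r" using abs_Im_le_cmod[of "z0 - z"] that(2) by (simp add: dist_norm)
    hence "r \<le> Im z" unfolding r_def minus_complex.sel by linarith
    hence "r * Q i \<le> Im z * Q i" using nonneg[OF that(1)] by (rule mult_right_mono)
    thus ?thesis by (simp add: mult_ac)
  qed
  have ul: "uniform_limit (cball z0 r) (\<lambda>X z. \<Sum>i\<in>X. exp (2 * of_real pi * \<i> * of_real (Q i) * z))
      (\<lambda>z. \<Sum>\<^sub>\<infinity>i\<in>I. exp (2 * of_real pi * \<i> * of_real (Q i) * z)) F"
    unfolding F_def using bound summable[of "2 * pi * r"] z0
    by (intro Weierstrass_m_test_general[where M = "\<lambda>i. exp (- (2 * pi * r) * Q i)"]) (auto simp: r_def)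
  have ev: "\<forall>\<^sub>F X in F. continuous_on (cball z0 r) (\<lambda>z. \<Sum>i\<in>X. exp (2 * of_real pi * \<i> * of_real (Q i) * z)) \<and>
      (\<lambda>z. \<Sum>i\<in>X. exp (2 * of_real pi * \<i> * of_real (Q i) * z)) holomorphic_on ball z0 r"
    by (intro always_eventually allI conjI continuous_intros holomorphic_intros)
  have "(\<lambda>z. \<Sum>\<^sub>\<infinity>i\<in>I. exp (2 * of_real pi * \<i> * of_real (Q i) * z)) holomorphic_on ball z0 r"
    by (rule holomorphic_uniform_limit[OF ev ul]) (simp_all add: F_def)
  thus "\<exists>f'. ((\<lambda>z. \<Sum>\<^sub>\<infinity>i\<in>I. exp (2 * of_real pi * \<i> * of_real (Q i) * z)) has_field_derivative f') (at z0)"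
    using holomorphic_on_imp_differentiable_at[OF _ open_ball] z0
    by (auto simp: field_differentiable_def r_def)
qed

lemma theta_holomorphic: "theta holomorphic_on {z. Im z > 0}"
proof -
  have "theta = (\<lambda>z. \<Sum>\<^sub>\<infinity>n::int. exp (2 * of_real pi * \<i> * of_real ((of_int n)\<^sup>2) * z))"
    by (simp add: theta_def fun_eq_iff)
  thus ?thesis
    using theta_series_holomorphic[of "UNIV :: int set" "\<lambda>n. (of_int n)\<^sup>2"] gaussian_summable by simp
qed

lemma theta_inversion_imaginary:
  assumes y: "y > 0"
  shows "of_real (sqrt (2 * y)) * theta (\<i> * of_real y) = theta (\<i> * of_real (1 / (4 * y)))"
proof -
  have term_eq: "exp (2 * of_real pi * \<i> * of_int (n\<^sup>2) * (\<i> * of_real c)) = complex_of_real (exp (- pi * (2 * c) * (of_int n + 0)\<^sup>2))"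
    for n :: int and c :: real
    by (simp add: exp_of_real[symmetric] mult_ac)
  have "theta (\<i> * of_real y) = (\<Sum>\<^sub>\<infinity>n::int. complex_of_real (exp (- pi * (2 * y) * (of_int n + 0)\<^sup>2)))"
    by (simp only: theta_def term_eq)
  also have "\<dots> = of_real (1 / sqrt (2 * y)) * (\<Sum>\<^sub>\<infinity>n::int. of_real (exp (- pi / (2 * y) * (of_int n)\<^sup>2)) * cis (2 * pi * of_int n * 0))"
    using y by (intro poisson_gaussian) simp
  also have "(\<Sum>\<^sub>\<infinity>n::int. of_real (exp (- pi / (2 * y) * (of_int n)\<^sup>2)) * cis (2 * pi * of_int n * 0)) = theta (\<i> * of_real (1 / (4 * y)))"
    unfolding theta_def term_eq by simp
  finally show ?thesis using y by simp
qed

section \<open>Invariance under congruence transformations\<close>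

lemma Im_moebius:
  fixes a b c d :: real
  assumes "a * d - b * c = 1" "Im z > 0"
  shows "Im ((of_real a * z + of_real b) / (of_real c * z + of_real d)) > 0"
    and "of_real c * z + of_real d \<noteq> 0"
proof -
  show nz: "of_real c * z + of_real d \<noteq> 0"
  proof
    assume 0: "of_real c * z + of_real d = 0"
    hence "c * Im z = 0" by (simp add: complex_eq_iff)
    hence "c = 0" using assms(2) by simp
    moreover from this have "d = 0" using 0 by simp
    ultimately show False using assms(1) by simp
  qed
  have "Im ((of_real a * z + of_real b) * cnj (of_real c * z + of_real d)) = (a * d - b * c) * Im z"
    by (simp add: algebra_simps)
  hence "Im ((of_real a * z + of_real b) / (of_real c * z + of_real d)) = Im z / (norm (of_real c * z + of_real d))\<^sup>2"
    using assms(1) unfolding complex_div_cnj[of "of_real a * z + of_real b"] by simp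
  thus "Im ((of_real a * z + of_real b) / (of_real c * z + of_real d)) > 0"
    using assms(2) nz by simp
qed

lemma Im_moebius_int:
  fixes a b c d :: int
  assumes "a * d - b * c = 1" "Im z > 0"
  shows "Im ((of_int a * z + of_int b) / (of_int c * z + of_int d)) > 0"
    and "of_int c * z + of_int d \<noteq> 0"
proof -
  have "real_of_int a * of_int d - of_int b * of_int c = 1"
    by (metis assms(1) of_int_1 of_int_diff of_int_mult)
  from Im_moebius[OF this assms(2)]
  show "Im ((of_int a * z + of_int b) / (of_int c * z + of_int d)) > 0" "of_int c * z + of_int d \<noteq> 0"
    by simp_all
qed

text \<open>Euclidean descent on |c| + |d|: translations replace d by d + c s, and their conjugates
  under z \<mapsto> -1/(4z) replace c by c + 4 d s. One of the two moves lowers the sum until c =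
  0.\<close>

lemma Gamma0_4_invariant:
  fixes R :: "complex \<Rightarrow> complex" and a b c d :: int
  assumes T: "\<And>z. Im z > 0 \<Longrightarrow> R (z + 1) = R z"
    and W: "\<And>z. Im z > 0 \<Longrightarrow> R (- 1 / (4 * z)) = R z"
    and "a * d - b * c = 1" "4 dvd c" "Im z > 0"
  shows "R ((of_int a * z + of_int b) / (of_int c * z + of_int d)) = R z"
proof -
  have Tn: "R (z + of_int k) = R z" if z: "Im z > 0" for z k
  proof -
    have nat: "R (z + of_nat n) = R z" if "Im z > 0" for n z
    proof (induction n)
      case (Suc n)
      have "R (z + of_nat (Suc n)) = R (z + of_nat n + 1)" by (simp add: add_ac)
      thus ?case using T[of "z + of_nat n"] that Suc by simp
    qed simp
    show ?thesis
    proof (cases k rule: int_cases2)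
      case (nonneg n)
      thus ?thesis using nat[OF z] by simp
    next
      case (nonpos n)
      thus ?thesis using nat[of "z - of_nat n" n] z by simp
    qed
  qed
  \<comment> \<open>The translation by -s conjugated by z \<mapsto> -1/(4z).\<close>
  have U: "R (z / (4 * of_int s * z + 1)) = R z" if z: "Im z > 0" for z s
  proof -
    have z0: "z \<noteq> 0" using z by auto
    have nz: "4 * of_int s * z + 1 \<noteq> 0" using Im_moebius_int(2)[of 1 1 0 "4 * s" z] z by simp
    define w where "w = - 1 / (4 * z)"
    \<comment> \<open>The matrix of z \<mapsto> -1/(4z) is scaled by 1/2 to have determinant 1, as
      \<open>Im_moebius\<close> requires.\<close>
    have "w = (of_real 0 * z + of_real (- 1 / 2)) / (of_real 2 * z + of_real 0)"
      by (simp add: w_def field_simps)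
    hence w: "Im w > 0" using Im_moebius(1)[of 0 0 "- 1 / 2" 2 z] z by simp
    have eq: "z / (4 * of_int s * z + 1) = - 1 / (4 * (w + of_int (- s)))"
    proof -
      have "4 * (w + of_int (- s)) * z = - (4 * of_int s * z + 1)" using z0 by (simp add: w_def field_simps)
      hence "4 * (w + of_int (- s)) = - (4 * of_int s * z + 1) / z" using z0 by (simp add: eq_divide_eq)
      moreover have "- 1 / (- x / z) = z / x" for x by simp
      ultimately show ?thesis by (simp only:)
    qed
    have "R (z / (4 * of_int s * z + 1)) = R (w + of_int (- s))"
      unfolding eq by (rule W) (use w in simp)
    also have "\<dots> = R w" by (rule Tn[OF w])
    also have "\<dots> = R z" unfolding w_def by (rule W[OF z])
    finally show ?thesis .
  qed
  show ?thesis using assms(3-5)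
  proof (induction "nat (\<bar>c\<bar> + \<bar>d\<bar>)" arbitrary: a b c d z rule: less_induct)
    case less
    note det = less.prems(1) and c4 = less.prems(2) and z = less.prems(3)
    have "odd d"
    proof
      assume "even d"
      moreover have "even c" using c4 by auto
      ultimately have "even (a * d - b * c)" by simp
      thus False using det by simp
    qed
    show ?case
    proof (cases "c = 0")
      case True
      hence "a * d = 1" using det by simp
      hence "(a = 1 \<and> d = 1) \<or> (a = -1 \<and> d = -1)" using zmult_eq_1_iff by blast
      thus ?thesis
      proof
        assume "a = 1 \<and> d = 1"
        thus ?thesis using True Tn[OF z, of b] by simp
      next
        assume "a = -1 \<and> d = -1"
        thus ?thesis using True Tn[OF z, of "- b"] by simp
      qed
    next
      case False
      \<comment> \<open>Since 4 divides c and d is odd, the borderline case in which neither move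
        would descend is impossible.\<close>
      have ne: "\<bar>c\<bar> \<noteq> 2 * \<bar>d\<bar>" using c4 \<open>odd d\<close> by (cases "c \<ge> 0"; cases "d \<ge> 0") (simp_all, presburger+)
      show ?thesis
      proof (cases "\<bar>c\<bar> < 2 * \<bar>d\<bar>")
        case True
        \<comment> \<open>The sign makes c s and d opposite, so the new lower right entry has
          absolute value ||d| - |c||, which is below |d| for 0 < |c| < 2|d|.\<close>
        define s where "s = (if c > 0 \<longleftrightarrow> d > 0 then -1 else 1 :: int)"
        have lt: "\<bar>d + c * s\<bar> < \<bar>d\<bar>" using True False by (auto simp: s_def abs_if split: if_splits)
        have "R ((of_int a * (z - of_int s) + of_int (b + a * s)) / (of_int c * (z - of_int s) + of_int (d + c * s))) = R (z - of_int s)"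
        proof (rule less.hyps)
          show "nat (\<bar>c\<bar> + \<bar>d + c * s\<bar>) < nat (\<bar>c\<bar> + \<bar>d\<bar>)" using lt by linarith
          show "a * (d + c * s) - (b + a * s) * c = 1" using det by (simp add: algebra_simps)
        qed (use c4 z in auto)
        moreover have "R (z - of_int s) = R z" using Tn[OF z, of "- s"] by simp
        ultimately show ?thesis by (simp add: algebra_simps)
      next
        case False2: False
        define s where "s = (if c > 0 \<longleftrightarrow> d > 0 then -1 else 1 :: int)"
        have "d \<noteq> 0" using \<open>odd d\<close> by auto
        hence lt: "\<bar>c + 4 * d * s\<bar> < \<bar>c\<bar>" using False2 ne False by (auto simp: s_def abs_if split: if_splits)
        \<comment> \<open>The inverse of the conjugated translation, applied to z: rewriting the
          Moebius image of z in terms of \<open>w\<close> is what changes c to c + 4 d s.\<close>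
        define w where "w = z / (4 * of_int (- s) * z + 1)"
        have nz: "4 * of_int (- s) * z + 1 \<noteq> 0"
          using Im_moebius_int(2)[of 1 1 0 "4 * (- s)" z] z by simp
        have w: "Im w > 0" using Im_moebius_int(1)[of 1 1 0 "4 * (- s)" z] z by (simp add: w_def)
        have nz': "4 * of_int s * w + 1 \<noteq> 0" using Im_moebius_int(2)[of 1 1 0 "4 * s" w] w by simp
        have zw: "z = w / (4 * of_int s * w + 1)"
        proof -
          have "4 * of_int s * w + 1 = 1 / (4 * of_int (- s) * z + 1)"
            using nz by (simp add: w_def field_simps)
          thus ?thesis using nz by (simp add: w_def)
        qed
        have "R ((of_int (a + 4 * b * s) * w + of_int b) / (of_int (c + 4 * d * s) * w + of_int d)) = R w"
        proof (rule less.hyps)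
          show "nat (\<bar>c + 4 * d * s\<bar> + \<bar>d\<bar>) < nat (\<bar>c\<bar> + \<bar>d\<bar>)" using lt by linarith
          show "(a + 4 * b * s) * d - b * (c + 4 * d * s) = 1" using det by (simp add: algebra_simps)
          show "4 dvd c + 4 * d * s" using c4 by simp
        qed (use w in auto)
        moreover have "(of_int a * z + of_int b) / (of_int c * z + of_int d)
            = (of_int (a + 4 * b * s) * w + of_int b) / (of_int (c + 4 * d * s) * w + of_int d)"
        proof -
          define D where "D = 4 * of_int s * w + 1"
          have "of_int a * z + of_int b = (of_int (a + 4 * b * s) * w + of_int b) / D"
            using nz' unfolding zw D_def[symmetric] by (simp add: field_simps D_def)
          moreover have "of_int c * z + of_int d = (of_int (c + 4 * d * s) * w + of_int d) / D"
            using nz' unfolding zw D_def[symmetric] by (simp add: field_simps D_def)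
          ultimately show ?thesis using nz' by (simp add: D_def)
        qed
        moreover have "R w = R z" using U[OF w, of s] zw by simp
        ultimately show ?thesis by simp
      qed
    qed
  qed
qed

lemma Im_moebius_act:
  assumes "det \<gamma> = 1" "Im z > 0"
  shows "Im (moebius_act \<gamma> z) > 0" "moebius_denom \<gamma> z \<noteq> 0"
proof -
  have "\<gamma> $ 1 $ 1 * \<gamma> $ 2 $ 2 - \<gamma> $ 1 $ 2 * \<gamma> $ 2 $ 1 = 1"
    using assms(1) by (simp add: det_2)
  from Im_moebius_int[OF this assms(2)] show "Im (moebius_act \<gamma> z) > 0" "moebius_denom \<gamma> z \<noteq> 0"
    by (simp_all add: moebius_act_def moebius_denom_def)
qed

section \<open>Restriction to the diagonal\<close>

context principal_different
begin

section \<open>The theta series of the field along the diagonal\<close>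

interpretation lat: selfdual_lattice sqlen "{n. lattice_point n \<in> ring_of_integers}"
proof
  show "sqlen j > 0" for j by (rule sqlen_pos)
  show "(\<lambda>j. m j - k j) \<in> {n. lattice_point n \<in> ring_of_integers}"
    if "m \<in> {n. lattice_point n \<in> ring_of_integers}" "k \<in> {n. lattice_point n \<in> ring_of_integers}" for m k
    using that by (simp add: lattice_point_diff ring_of_integers_diff)
  show "(\<lambda>j. sqlen j * k j) \<in> {n. lattice_point n \<in> ring_of_integers}" for k
    using lattice_point_sqlen_mult by simp
  fix n
  have "lattice_point n \<in> ring_of_integers \<longleftrightarrow> (\<forall>y\<in>ring_of_integers. pairing (lattice_point n) y \<in> \<int>)"
    by (rule integral_iff_pairing)
  also have "\<dots> \<longleftrightarrow> (\<forall>k. lattice_point k \<in> ring_of_integers \<longrightarrow> pairing (lattice_point n) (lattice_point k) \<in> \<int>)"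
    using lattice_point_coords by metis
  finally show "n \<in> {n. lattice_point n \<in> ring_of_integers} \<longleftrightarrow>
     (\<forall>k\<in>{n. lattice_point n \<in> ring_of_integers}. (\<Sum>j\<in>UNIV. real_of_int (n j * k j) / real_of_int (sqlen j)) \<in> \<int>)"
    by (simp add: pairing_lattice_points)
qed

lemma bij_lattice_point: "bij_betw lattice_point {n. lattice_point n \<in> ring_of_integers} ring_of_integers"
  by (rule bij_betw_byWitness[where f' = coords]) (auto simp: lattice_point_coords)

lemma pr_eq_pairing: "lat.pr n k = pairing (lattice_point n) (lattice_point k)"
  by (simp add: lat.pr_def pairing_lattice_points)

lemma pairing_nonneg: "pairing x x \<ge> 0"
  using pairing_pos[of x] by (cases "x = 0") auto

lemma pairing_summable:
  assumes "c > 0"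
  shows "(\<lambda>\<xi>. exp (- c * pairing \<xi> \<xi>)) summable_on ring_of_integers"
proof -
  have "(\<lambda>n. exp (- c * pairing (lattice_point n) (lattice_point n))) summable_on {n. lattice_point n \<in> ring_of_integers}"
    using lat.theta_summable[OF assms] unfolding pr_eq_pairing by (rule summable_on_subset_banach) simp
  thus ?thesis by (rule summable_on_reindex_bij_betw[OF bij_lattice_point, THEN iffD1])
qed

text \<open>The theta series of the field at the diagonal point of z; see
  \<open>hilbert_theta_diag\<close>.\<close>

definition trace_theta :: "complex \<Rightarrow> complex" where
  "trace_theta z = (\<Sum>\<^sub>\<infinity>\<xi>\<in>ring_of_integers. exp (2 * of_real pi * \<i> * of_real (pairing \<xi> \<xi>) * z))"

lemma trace_theta_holomorphic: "trace_theta holomorphic_on {z. Im z > 0}"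
  using theta_series_holomorphic[OF pairing_nonneg pairing_summable]
  unfolding trace_theta_def[abs_def] by blast

lemma trace_theta_imaginary: "trace_theta (\<i> * of_real y) = lat.thetasum (2 * y)"
proof -
  have "trace_theta (\<i> * of_real y) = (\<Sum>\<^sub>\<infinity>\<xi>\<in>ring_of_integers. complex_of_real (exp (- pi * (2 * y) * pairing \<xi> \<xi>)))"
    by (simp add: trace_theta_def exp_of_real[symmetric] mult_ac)
  also have "\<dots> = lat.thetasum (2 * y)"
    unfolding lat.thetasum_def pr_eq_pairing by (rule infsum_reindex_bij_betw[OF bij_lattice_point, symmetric])
  finally show ?thesis .
qed

lemma trace_theta_ii_nonzero: "trace_theta \<i> \<noteq> 0"
  using lat.thetasum_pos[of 2] trace_theta_imaginary[of 1] by auto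

lemma trace_theta_inversion_imaginary:
  assumes "y > 0"
  shows "of_real (sqrt (2 * y)) ^ CARD('n) * trace_theta (\<i> * of_real y) = trace_theta (\<i> * of_real (1 / (4 * y)))"
  using lat.thetasum_inversion[of "2 * y"] assms unfolding trace_theta_imaginary by simp

lemma trace_theta_periodic: "trace_theta (z + 1) = trace_theta z"
  unfolding trace_theta_def
proof (rule infsum_cong)
  fix \<xi> :: 'f assume "\<xi> \<in> ring_of_integers"
  hence "pairing \<xi> \<xi> \<in> \<int>" using integral_iff_pairing by blast
  then obtain k where k: "pairing \<xi> \<xi> = of_int k" by (auto simp: Ints_def)
  have "exp (2 * of_real pi * \<i> * of_real (pairing \<xi> \<xi>) :: complex) = 1"
    unfolding exp_eq_1 k by (auto intro!: exI[of _ k])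
  thus "exp (2 * of_real pi * \<i> * of_real (pairing \<xi> \<xi>) * (z + 1)) = exp (2 * of_real pi * \<i> * of_real (pairing \<xi> \<xi>) * z)"
    by (simp add: distrib_left exp_add)
qed

definition theta_ratio :: "complex \<Rightarrow> complex" where
  "theta_ratio z = trace_theta z / theta z ^ CARD('n)"

lemma theta_ratio_holomorphic: "theta_ratio holomorphic_on {z. Im z > 0}"
  unfolding theta_ratio_def[abs_def]
  by (intro holomorphic_intros trace_theta_holomorphic theta_holomorphic) (auto simp: theta_nonzero)

text \<open>On the imaginary axis numerator and denominator acquire the same factor sqrt(2y)^m. What
  remains is an identity between holomorphic functions, which extends from the half-line
  \<open>U\<close>.\<close>

lemma theta_ratio_inversion:
  assumes z: "Im z > 0"
  shows "theta_ratio (- 1 / (4 * z)) = theta_ratio z"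
proof -
  define H where "H = {z. Im z > 0}"
  have inv: "Im (- 1 / (4 * w)) > 0" if "Im w > 0" for w
  proof -
    have "- 1 / (4 * w) = (of_real 0 * w + of_real (- 1 / 2)) / (of_real 2 * w + of_real 0)"
      by (simp add: field_simps)
    thus ?thesis using Im_moebius(1)[of 0 0 "- 1 / 2" 2 w] that by simp
  qed
  define g where "g w = theta_ratio (- 1 / (4 * w)) - theta_ratio w" for w
  define U where "U = (\<lambda>y. \<i> * complex_of_real y) ` {0<..}"
  have "g z = 0"
  proof (rule analytic_continuation[where f = g and S = H and U = U and \<xi> = \<i>])
    have "(theta_ratio \<circ> (\<lambda>w. - 1 / (4 * w))) holomorphic_on H"
      using inv unfolding H_def
      by (intro holomorphic_on_compose_gen[OF _ theta_ratio_holomorphic] holomorphic_intros) auto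
    thus "g holomorphic_on H"
      unfolding g_def[abs_def] H_def o_def by (intro holomorphic_intros theta_ratio_holomorphic)
    show "open H" unfolding H_def by (rule open_halfspace_Im_gt)
    show "connected H" unfolding H_def by (intro convex_connected convex_halfspace_Im_gt)
    show "U \<subseteq> H" "\<i> \<in> H" "z \<in> H" using z by (auto simp: U_def H_def)
    show "\<i> islimpt U"
    proof (rule connected_imp_perfect)
      show "connected U" unfolding U_def by (intro connected_continuous_image continuous_intros) auto
      show "\<i> \<in> U" unfolding U_def by (rule image_eqI[of _ _ 1]) auto
      have "\<i> * complex_of_real 2 \<in> U" unfolding U_def by (rule imageI) simp
      moreover have "\<i> * complex_of_real 2 \<noteq> \<i>" by (simp add: complex_eq_iff)
      ultimately show "U \<noteq> {x}" for x using \<open>\<i> \<in> U\<close> by (metis singletonD)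
    qed
    fix w assume "w \<in> U"
    then obtain y where y: "y > 0" "w = \<i> * of_real y" by (auto simp: U_def)
    have eq: "- 1 / (4 * w) = \<i> * of_real (1 / (4 * y))"
      using y by (simp add: complex_eq_iff Re_divide Im_divide power2_eq_square)
    define C where "C = complex_of_real (sqrt (2 * y)) ^ CARD('n)"
    have "C \<noteq> 0" using y by (simp add: C_def)
    have tt: "trace_theta (- 1 / (4 * w)) = C * trace_theta w"
      unfolding eq unfolding C_def y(2) by (rule trace_theta_inversion_imaginary[OF y(1), symmetric])
    have th: "theta (- 1 / (4 * w)) = of_real (sqrt (2 * y)) * theta w"
      unfolding eq unfolding y(2) by (rule theta_inversion_imaginary[OF y(1), symmetric])
    have "theta_ratio (- 1 / (4 * w)) = (C * trace_theta w) / (C * theta w ^ CARD('n))"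
      unfolding theta_ratio_def tt th power_mult_distrib C_def ..
    also have "\<dots> = theta_ratio w" using \<open>C \<noteq> 0\<close> by (simp add: theta_ratio_def)
    finally show "g w = 0" by (simp add: g_def)
  qed
  thus ?thesis by (simp add: g_def)
qed

lemma theta_ratio_periodic: "theta_ratio (z + 1) = theta_ratio z"
proof -
  have "theta (z + 1) = theta z"
    unfolding theta_def
  proof (rule infsum_cong)
    fix n :: int
    have "exp (2 * of_real pi * \<i> * of_int (n\<^sup>2) :: complex) = 1"
      unfolding exp_eq_1 by (auto intro!: exI[of _ "n\<^sup>2"])
    thus "exp (2 * of_real pi * \<i> * of_int (n\<^sup>2) * (z + 1)) = exp (2 * of_real pi * \<i> * of_int (n\<^sup>2) * z)"
      by (simp add: distrib_left exp_add)
  qed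
  thus ?thesis by (simp add: theta_ratio_def trace_theta_periodic)
qed

lemma trace_theta_transform:
  assumes "\<gamma> \<in> Gamma0_4" "Im z > 0" "trace_theta z \<noteq> 0"
  shows "trace_theta (moebius_act \<gamma> z) / trace_theta z = (theta (moebius_act \<gamma> z) / theta z) ^ CARD('n)"
proof -
  have \<gamma>: "\<gamma> $ 1 $ 1 * \<gamma> $ 2 $ 2 - \<gamma> $ 1 $ 2 * \<gamma> $ 2 $ 1 = 1" "4 dvd \<gamma> $ 2 $ 1" "det \<gamma> = 1"
    using assms(1) by (auto simp: Gamma0_4_def det_2)
  have "theta_ratio (moebius_act \<gamma> z) = theta_ratio z"
    unfolding moebius_act_def moebius_denom_def
    by (rule Gamma0_4_invariant[OF theta_ratio_periodic theta_ratio_inversion \<gamma>(1,2) assms(2)])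
  moreover have "theta (moebius_act \<gamma> z) \<noteq> 0" "theta z \<noteq> 0"
    using theta_nonzero Im_moebius_act(1)[OF \<gamma>(3) assms(2)] assms(2) by auto
  ultimately show ?thesis using assms(3) by (simp add: theta_ratio_def field_simps)
qed

section \<open>Lifting integer matrices to the field\<close>

definition diag :: "complex \<Rightarrow> complex ^ 'n" where
  "diag z = (\<chi> i. z / of_real (\<iota> i \<delta>))"

lemma diag_in_upper_half_space: "Im z > 0 \<Longrightarrow> diag z \<in> upper_half_space"
  using iota_delta_pos by (auto simp: diag_def upper_half_space_def upper_half_plane_def)

lemma hilbert_theta_diag: "hilbert_theta \<iota> (diag z) = trace_theta z"
proof -
  have "(\<Sum>i\<in>UNIV. diag z $ i * of_real (\<iota> i (\<xi>\<^sup>2))) = of_real (pairing \<xi> \<xi>) * z" for \<xi>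
    unfolding pairing_def of_real_sum sum_distrib_right
    by (rule sum.cong[OF refl]) (simp add: diag_def iota_mult power2_eq_square mult_ac)
  hence "hilbert_q \<iota> (diag z) (\<xi>\<^sup>2) = exp (2 * of_real pi * \<i> * of_real (pairing \<xi> \<xi>) * z)" for \<xi>
    by (simp add: hilbert_q_def mult.assoc)
  thus ?thesis by (simp add: hilbert_theta_def trace_theta_def)
qed

text \<open>Conjugation by the scaling z \<mapsto> z/\<delta>, so that \<open>diag\<close>
  intertwines the two actions. The factor \<delta> moves the lower left entry into the different,
  and its inverse moves the upper right entry into the codifferent.\<close>

definition lift_matrix :: "int ^ 2 ^ 2 \<Rightarrow> 'f ^ 2 ^ 2" where
  "lift_matrix \<gamma> = vector [vector [of_int (\<gamma> $ 1 $ 1), of_int (\<gamma> $ 1 $ 2) / \<delta>],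
     vector [of_int (\<gamma> $ 2 $ 1) * \<delta>, of_int (\<gamma> $ 2 $ 2)]]"

lemma det_lift_matrix: "det \<gamma> = 1 \<Longrightarrow> det (lift_matrix \<gamma>) = 1"
proof -
  assume "det \<gamma> = 1"
  hence "of_int (\<gamma> $ 1 $ 1 * \<gamma> $ 2 $ 2 - \<gamma> $ 1 $ 2 * \<gamma> $ 2 $ 1) = (1 :: 'f)" by (simp add: det_2)
  thus ?thesis using delta_nonzero by (simp add: det_2 lift_matrix_def)
qed

lemma lift_matrix_in_hilbert_Gamma:
  assumes "\<gamma> \<in> Gamma0_4"
  shows "lift_matrix \<gamma> \<in> hilbert_Gamma"
proof -
  have \<gamma>: "det \<gamma> = 1" "4 dvd \<gamma> $ 2 $ 1" using assms by (auto simp: Gamma0_4_def)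
  obtain k where k: "\<gamma> $ 2 $ 1 = 4 * k" using \<gamma>(2) by blast
  have "\<delta> * of_int k \<in> different"
    unfolding different_eq principal_ideal_def using ring_of_integers_of_int by blast
  moreover have "of_int (\<gamma> $ 2 $ 1) * \<delta> = 4 * (\<delta> * of_int k)" by (simp add: k)
  ultimately have "of_int (\<gamma> $ 2 $ 1) * \<delta> \<in> (\<lambda>x. 4 * x) ` different" by blast
  thus ?thesis
    using det_lift_matrix[OF \<gamma>(1)]
    by (simp add: hilbert_Gamma_def lift_matrix_def ring_of_integers_of_int inverse_delta_mult)
qed

text \<open>All m denominators coincide on the diagonal, so their product of square roots is an m-th
  power; this multiplies the weight by m in the expansions at the cusps.\<close>

lemma hilbert_denom_diag: "hilbert_denom \<iota> (lift_matrix \<gamma>) (diag z) i = moebius_denom \<gamma> z"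
  using delta_nonzero by (simp add: hilbert_denom_def lift_matrix_def diag_def moebius_denom_def iota_mult)

lemma hilbert_act_diag: "hilbert_act \<iota> (lift_matrix \<gamma>) (diag z) = diag (moebius_act \<gamma> z)"
  unfolding hilbert_act_def hilbert_denom_diag
  by (simp add: vec_eq_iff lift_matrix_def diag_def moebius_act_def iota_divide divide_simps)

section \<open>The factor of automorphy on the diagonal\<close>

lemma open_upper_half_space: "open (upper_half_space :: (complex ^ 'n) set)"
proof -
  have "upper_half_space = (\<Inter>i. {z :: complex ^ 'n. Im (z $ i) > 0})"
    by (auto simp: upper_half_space_def upper_half_plane_def)
  moreover have "open (\<Inter>i. {z :: complex ^ 'n. Im (z $ i) > 0})"
    by (intro open_INT ballI open_Collect_less continuous_intros) auto
  ultimately show ?thesis by simp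
qed

text \<open>Continuity in all m variables is what evaluates the limit in \<open>hilbert_j\<close>,
  whose approach is not confined to the diagonal.\<close>

lemma hilbert_theta_continuous: "continuous_on upper_half_space (hilbert_theta \<iota>)"
proof (rule continuous_at_imp_continuous_on, intro ballI)
  fix z :: "complex ^ 'n" assume z: "z \<in> upper_half_space"
  define \<epsilon> where "\<epsilon> = Min (range (\<lambda>i. Im (z $ i))) / 2"
  have \<epsilon>: "\<epsilon> > 0" "\<And>i. \<epsilon> < Im (z $ i)"
  proof -
    have pos: "Min (range (\<lambda>i. Im (z $ i))) > 0"
      using z by (subst Min_gr_iff) (auto simp: upper_half_space_def upper_half_plane_def)
    thus "\<epsilon> > 0" by (simp add: \<epsilon>_def)
    fix i
    have "Min (range (\<lambda>i. Im (z $ i))) \<le> Im (z $ i)" by (rule Min_le) auto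
    thus "\<epsilon> < Im (z $ i)" using pos unfolding \<epsilon>_def by linarith
  qed
  \<comment> \<open>Chosen so that c / \<iota> i \<delta> \<le> \<epsilon> for every i: the terms on
    \<open>S\<close> are then dominated by those of the diagonal series at height c.\<close>
  define c where "c = \<epsilon> * Min (range (\<lambda>i. \<iota> i \<delta>))"
  have c: "c > 0" unfolding c_def using \<epsilon>(1) iota_delta_pos by (intro mult_pos_pos) (auto simp: Min_gr_iff)
  have c_le: "c / \<iota> i \<delta> \<le> \<epsilon>" for i
  proof -
    have "Min (range (\<lambda>i. \<iota> i \<delta>)) \<le> \<iota> i \<delta>" by (rule Min_le) auto
    hence "c \<le> \<epsilon> * \<iota> i \<delta>" unfolding c_def using \<epsilon>(1) by (intro mult_left_mono) auto
    thus ?thesis using iota_delta_pos[of i] by (simp add: divide_le_eq)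
  qed
  define S where "S = {w :: complex ^ 'n. \<forall>i. Im (w $ i) > \<epsilon>}"
  have openS: "open S"
  proof -
    have "S = (\<Inter>i. {w. Im (w $ i) > \<epsilon>})" by (auto simp: S_def)
    thus ?thesis by (auto intro!: open_INT open_Collect_less continuous_intros)
  qed
  have "continuous_on S (\<lambda>w. \<Sum>\<^sub>\<infinity>\<xi>\<in>ring_of_integers. hilbert_q \<iota> w (\<xi>\<^sup>2))"
  proof (rule continuous_on_infsum[OF pairing_summable[of "2 * pi * c"]])
    show "2 * pi * c > 0" using c by simp
    fix \<xi> :: 'f
    show "continuous_on S (\<lambda>w. hilbert_q \<iota> w (\<xi>\<^sup>2))"
      unfolding hilbert_q_def by (intro continuous_intros)
    fix w assume w: "w \<in> S"
    have "c * pairing \<xi> \<xi> \<le> (\<Sum>i\<in>UNIV. Im (w $ i) * \<iota> i (\<xi>\<^sup>2))"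
      unfolding pairing_def sum_distrib_left
    proof (rule sum_mono)
      fix i
      have "c / \<iota> i \<delta> * (\<iota> i \<xi>)\<^sup>2 \<le> Im (w $ i) * (\<iota> i \<xi>)\<^sup>2"
        using c_le[of i] w by (intro mult_right_mono) (auto simp: S_def intro: order.trans less_imp_le)
      thus "c * (\<iota> i \<xi> * \<iota> i \<xi> / \<iota> i \<delta>) \<le> Im (w $ i) * \<iota> i (\<xi>\<^sup>2)"
        by (simp add: iota_mult power2_eq_square)
    qed
    hence "2 * pi * (c * pairing \<xi> \<xi>) \<le> 2 * pi * (\<Sum>i\<in>UNIV. Im (w $ i) * \<iota> i (\<xi>\<^sup>2))"
      by (intro mult_left_mono) auto
    thus "norm (hilbert_q \<iota> w (\<xi>\<^sup>2)) \<le> exp (- (2 * pi * c) * pairing \<xi> \<xi>)"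
      by (simp add: hilbert_q_def mult_ac)
  qed
  hence "continuous_on S (hilbert_theta \<iota>)" by (simp add: hilbert_theta_def[abs_def])
  thus "isCont (hilbert_theta \<iota>) z"
    using \<epsilon>(2) openS by (auto simp: continuous_on_eq_continuous_at S_def)
qed

text \<open>When the series is nonzero at the diagonal point, the set in the limit is an open
  neighbourhood of it and the quotient is continuous there, so the limit is the value.\<close>

lemma hilbert_j_diag:
  assumes \<gamma>: "det \<gamma> = 1" and z: "Im z > 0" and nz: "trace_theta z \<noteq> 0"
  shows "hilbert_j \<iota> (lift_matrix \<gamma>) (diag z) = trace_theta (moebius_act \<gamma> z) / trace_theta z"
proof -
  define S where "S = {w \<in> upper_half_space. hilbert_theta \<iota> w \<noteq> 0}"
  have "open S"
  proof -
    have "S = upper_half_space \<inter> hilbert_theta \<iota> -` (- {0})" by (auto simp: S_def)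
    thus ?thesis
      using continuous_on_open_vimage[OF open_upper_half_space, THEN iffD1, OF hilbert_theta_continuous] by (metis open_Compl closed_singleton inf_commute)
  qed
  moreover have "diag z \<in> S"
    using nz diag_in_upper_half_space[OF z] by (simp add: S_def hilbert_theta_diag)
  ultimately have at_S: "at (diag z) within S = at (diag z)" by (rule at_within_open[rotated])
  have cont: "isCont (hilbert_theta \<iota>) (diag w)" if "Im w > 0" for w
    using hilbert_theta_continuous diag_in_upper_half_space[OF that]
    by (simp add: continuous_on_eq_continuous_at[OF open_upper_half_space])
  have "isCont (hilbert_act \<iota> (lift_matrix \<gamma>)) (diag z)"
    unfolding isCont_def hilbert_act_def
  proof (intro tendsto_vec_lambda tendsto_divide)
    fix i
    show "hilbert_denom \<iota> (lift_matrix \<gamma>) (diag z) i \<noteq> 0"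
      using Im_moebius_act(2)[OF \<gamma> z] by (simp add: hilbert_denom_diag)
    show "((\<lambda>x. hilbert_denom \<iota> (lift_matrix \<gamma>) x i) \<longlongrightarrow> hilbert_denom \<iota> (lift_matrix \<gamma>) (diag z) i) (at (diag z))"
      unfolding hilbert_denom_def by (intro tendsto_intros)
  qed (intro tendsto_intros)
  hence "((\<lambda>w. hilbert_theta \<iota> (hilbert_act \<iota> (lift_matrix \<gamma>) w)) \<longlongrightarrow> hilbert_theta \<iota> (diag (moebius_act \<gamma> z))) (at (diag z))"
    unfolding isCont_def hilbert_act_diag
    by (rule isCont_tendsto_compose[OF cont[OF Im_moebius_act(1)[OF \<gamma> z]]])
  moreover have "(hilbert_theta \<iota> \<longlongrightarrow> hilbert_theta \<iota> (diag z)) (at (diag z))"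
    using cont[OF z] by (simp add: isCont_def)
  ultimately have "((\<lambda>w. hilbert_theta \<iota> (hilbert_act \<iota> (lift_matrix \<gamma>) w) / hilbert_theta \<iota> w) \<longlongrightarrow>
      trace_theta (moebius_act \<gamma> z) / trace_theta z) (at (diag z))"
    using nz unfolding hilbert_theta_diag by (rule tendsto_divide)
  thus ?thesis
    unfolding hilbert_j_def S_def[symmetric] at_S by (intro tendsto_Lim) auto
qed

section \<open>The restricted form\<close>

lemma diagonal_restriction_eq: "diagonal_restriction \<iota> \<delta> f z = f (diag z)"
  by (simp add: diagonal_restriction_def diag_def)

lemma diagonal_restriction_holomorphic:
  assumes "holomorphic_several_on f upper_half_space"
  shows "diagonal_restriction \<iota> \<delta> f holomorphic_on upper_half_plane"
  unfolding holomorphic_on_def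
proof
  fix z assume "z \<in> upper_half_plane"
  hence z: "diag z \<in> upper_half_space" by (auto simp: upper_half_plane_def intro: diag_in_upper_half_space)
  then obtain D where D: "(f has_derivative D) (at (diag z) within upper_half_space)"
    "\<And>c v. D (c *s v) = c * D v"
    using assms by (auto simp: holomorphic_several_on_def)
  have "bounded_linear diag"
    unfolding linear_conv_bounded_linear[symmetric]
  proof (rule linearI)
    show "diag (x + y) = diag x + diag y" for x y
      by (simp add: diag_def vec_eq_iff add_divide_distrib)
    show "diag (r *\<^sub>R x) = r *\<^sub>R diag x" for r x
      unfolding diag_def vec_eq_iff vec_lambda_beta vector_scaleR_component
      by (simp only: scaleR_conv_of_real times_divide_eq_right simp_thms)
  qed
  hence diag': "(diag has_derivative diag) (at z within upper_half_plane)"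
    by (rule bounded_linear_imp_has_derivative)
  have "(f has_derivative D) (at (diag z) within diag ` upper_half_plane)"
    by (rule has_derivative_subset[OF D(1)]) (auto simp: upper_half_plane_def intro: diag_in_upper_half_space)
  from has_derivative_in_compose[OF diag' this]
  have "((\<lambda>z. f (diag z)) has_derivative (\<lambda>v. D (diag v))) (at z within upper_half_plane)" .
  \<comment> \<open>Complex linearity of \<open>D\<close> turns the real chain rule into a complex
    derivative.\<close>
  moreover have "(\<lambda>v. D (diag v)) = (*) (D (diag 1))"
  proof
    fix v
    have "diag v = v *s diag 1" by (simp add: diag_def vec_eq_iff)
    thus "D (diag v) = D (diag 1) * v" by (metis D(2) mult.commute)
  qed
  ultimately have "((\<lambda>z. f (diag z)) has_field_derivative D (diag 1)) (at z within upper_half_plane)"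
    by (simp only: has_field_derivative_def)
  thus "diagonal_restriction \<iota> \<delta> f field_differentiable at z within upper_half_plane"
    unfolding field_differentiable_def by (auto simp: diagonal_restriction_eq[abs_def])
qed

lemma diagonal_restriction_transform:
  assumes f: "f \<in> hilbert_modular_forms \<iota> \<kappa>" and \<gamma>: "\<gamma> \<in> Gamma0_4" and z: "z \<in> upper_half_plane"
  shows "diagonal_restriction \<iota> \<delta> f (moebius_act \<gamma> z)
    = (theta (moebius_act \<gamma> z) / theta z) ^ (CARD('n) * (2 * \<kappa> + 1)) * diagonal_restriction \<iota> \<delta> f z"
proof -
  define g where "g = diagonal_restriction \<iota> \<delta> f"
  define H where "H = {z. Im z > 0}"
  have det: "det \<gamma> = 1" using \<gamma> by (simp add: Gamma0_4_def)
  have g_hol: "g holomorphic_on H"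
    using f diagonal_restriction_holomorphic
    by (simp add: hilbert_modular_forms_def g_def H_def upper_half_plane_def)
  define E where "E w = g (moebius_act \<gamma> w) - (theta (moebius_act \<gamma> w) / theta w) ^ (CARD('n) * (2 * \<kappa> + 1)) * g w" for w
  have act: "moebius_act \<gamma> w \<in> H" "moebius_denom \<gamma> w \<noteq> 0" if "w \<in> H" for w
    using Im_moebius_act[OF det] that by (auto simp: H_def)
  have act_hol: "moebius_act \<gamma> holomorphic_on H"
    unfolding moebius_act_def[abs_def] using act(2)
    by (intro holomorphic_intros) (auto simp: moebius_denom_def intro!: holomorphic_intros)
  have comp: "(\<lambda>w. h (moebius_act \<gamma> w)) holomorphic_on H" if "h holomorphic_on H" for h
    using holomorphic_on_compose_gen[OF act_hol that] act(1) by (auto simp: o_def)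
  have theta_hol: "theta holomorphic_on H" unfolding H_def by (rule theta_holomorphic)
  \<comment> \<open>Here the factor of automorphy is an honest quotient. The set is open and
    contains \<i>, so it has a limit point in the half-plane.\<close>
  define U where "U = {w \<in> H. trace_theta w \<noteq> 0}"
  have "open H" unfolding H_def by (rule open_halfspace_Im_gt)
  have openU: "open U"
  proof -
    have "U = H \<inter> trace_theta -` (- {0})" by (auto simp: U_def)
    moreover have "continuous_on H trace_theta"
      unfolding H_def by (rule holomorphic_on_imp_continuous_on[OF trace_theta_holomorphic])
    hence "open (H \<inter> trace_theta -` (- {0}))"
      by (rule continuous_open_preimage[OF _ \<open>open H\<close>]) auto
    ultimately show ?thesis by (simp only:)
  qed
  have "E z = 0"
  proof (rule analytic_continuation[where f = E and S = H and U = U and \<xi> = \<i>])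
    show "E holomorphic_on H"
      unfolding E_def[abs_def]
      by (intro holomorphic_intros comp theta_hol g_hol) (auto simp: H_def theta_nonzero)
    show "open H" by fact
    show "connected H" unfolding H_def by (intro convex_connected convex_halfspace_Im_gt)
    show "U \<subseteq> H" by (auto simp: U_def)
    show "\<i> \<in> H" by (simp add: H_def)
    show "z \<in> H" using z by (simp add: H_def upper_half_plane_def)
    have "\<i> \<in> U" by (simp add: U_def H_def trace_theta_ii_nonzero)
    with openU show "\<i> islimpt U"
      by (metis interior_limit_point interior_open)
    fix w assume "w \<in> U"
    hence w: "Im w > 0" "trace_theta w \<noteq> 0" by (auto simp: U_def H_def)
    have "f (hilbert_act \<iota> (lift_matrix \<gamma>) (diag w)) = hilbert_j \<iota> (lift_matrix \<gamma>) (diag w) ^ (2 * \<kappa> + 1) * f (diag w)"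
      using f lift_matrix_in_hilbert_Gamma[OF \<gamma>] diag_in_upper_half_space[OF w(1)]
      by (auto simp: hilbert_modular_forms_def)
    thus "E w = 0"
      unfolding hilbert_act_diag hilbert_j_diag[OF det w] trace_theta_transform[OF \<gamma> w]
      by (simp only: E_def g_def diagonal_restriction_eq power_mult right_minus_eq)
  qed
  thus ?thesis by (simp add: E_def g_def)
qed

text \<open>The expansion at the lifted matrix is grouped by Tr(\<xi>/\<delta>), the only quantity
  on which a diagonal exponential depends. Self-duality makes this an integer, and total
  nonnegativity of \<xi> makes it nonnegative.\<close>

lemma diagonal_restriction_cusps:
  assumes f: "hilbert_holomorphic_at_cusps \<iota> \<kappa> f"
  shows "holomorphic_at_cusps (CARD('n) * (2 * \<kappa> + 1)) (diagonal_restriction \<iota> \<delta> f)"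
  unfolding holomorphic_at_cusps_def
proof (intro allI impI)
  fix \<alpha> :: "int ^ 2 ^ 2" assume \<alpha>: "det \<alpha> = 1"
  define S where "S = {\<xi> \<in> (ring_of_integers :: 'f set). \<forall>i. \<iota> i \<xi> \<ge> 0}"
  from f[unfolded hilbert_holomorphic_at_cusps_def, rule_format, OF det_lift_matrix[OF \<alpha>], folded S_def]
  obtain N :: nat and a where N: "N > 0" and a: "\<And>z. z \<in> upper_half_space \<Longrightarrow>
      ((\<lambda>\<xi>. a \<xi> * hilbert_q \<iota> z (\<xi> / of_nat N)) has_sum
        (f (hilbert_act \<iota> (lift_matrix \<alpha>) z) / (\<Prod>i\<in>UNIV. csqrt (hilbert_denom \<iota> (lift_matrix \<alpha>) z i)) ^ (2 * \<kappa> + 1))) S"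
    by blast
  define tr where "tr \<xi> = nat \<lfloor>pairing \<xi> 1\<rfloor>" for \<xi>
  have tr: "real (tr \<xi>) = pairing \<xi> 1" if "\<xi> \<in> S" for \<xi>
  proof -
    have "pairing \<xi> 1 \<in> \<int>" using that integral_iff_pairing[of \<xi>] ring_of_integers_1 by (auto simp: S_def)
    moreover have "pairing \<xi> 1 \<ge> 0"
      using that iota_delta_pos by (auto simp: S_def pairing_def intro!: sum_nonneg divide_nonneg_pos)
    ultimately show ?thesis by (auto simp: tr_def elim!: Ints_cases)
  qed
  define e where "e z n = exp (2 * of_real pi * \<i> * of_nat n * z / of_nat N)" for z :: complex and n :: nat
  have q_eq: "hilbert_q \<iota> (diag z) (\<xi> / of_nat N) = e z (tr \<xi>)" if "\<xi> \<in> S" for z \<xi>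
  proof -
    have "(\<Sum>i\<in>UNIV. diag z $ i * of_real (\<iota> i (\<xi> / of_nat N))) = of_real (pairing \<xi> 1) * z / of_nat N"
      by (simp add: diag_def pairing_def iota_divide sum_distrib_left sum_distrib_right sum_divide_distrib mult_ac)
    also have "of_real (pairing \<xi> 1) = (of_nat (tr \<xi>) :: complex)" by (simp add: tr[OF that, symmetric])
    finally show ?thesis by (simp add: hilbert_q_def e_def mult_ac)
  qed
  define fib where "fib n = {\<xi> \<in> S. tr \<xi> = n}" for n
  define b where "b n = (\<Sum>\<^sub>\<infinity>\<xi>\<in>fib n. a \<xi>)" for n
  show "\<exists>N>0. \<exists>a. \<forall>z\<in>upper_half_plane.
      (\<lambda>n. a n * exp (2 * of_real pi * \<i> * of_nat n * z / of_nat N)) sums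
        (diagonal_restriction \<iota> \<delta> f (moebius_act \<alpha> z) / csqrt (moebius_denom \<alpha> z) ^ (CARD('n) * (2 * \<kappa> + 1)))"
  proof (intro exI[of _ N] conjI exI[of _ b] ballI N)
    fix z assume "z \<in> upper_half_plane"
    hence z: "diag z \<in> upper_half_space" by (auto simp: upper_half_plane_def intro: diag_in_upper_half_space)
    define T where "T = diagonal_restriction \<iota> \<delta> f (moebius_act \<alpha> z) / csqrt (moebius_denom \<alpha> z) ^ (CARD('n) * (2 * \<kappa> + 1))"
    have "((\<lambda>\<xi>. a \<xi> * hilbert_q \<iota> (diag z) (\<xi> / of_nat N)) has_sum T) S"
      using a[OF z] unfolding T_def hilbert_act_diag hilbert_denom_diag diagonal_restriction_eq power_mult prod_constant .
    hence sum: "((\<lambda>\<xi>. a \<xi> * e z (tr \<xi>)) has_sum T) S"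
      by (rule has_sum_cong[THEN iffD1, rotated]) (simp add: q_eq)
    have "bij_betw snd (Sigma UNIV fib) S"
      by (rule bij_betw_byWitness[where f' = "\<lambda>\<xi>. (tr \<xi>, \<xi>)"]) (auto simp: fib_def)
    with sum have "((\<lambda>p. a (snd p) * e z (tr (snd p))) has_sum T) (Sigma UNIV fib)"
      by (simp add: has_sum_reindex_bij_betw[of snd "Sigma UNIV fib" S "\<lambda>\<xi>. a \<xi> * e z (tr \<xi>)"])
    hence "((\<lambda>n. b n * e z n) has_sum T) UNIV"
    proof (rule has_sum_Sigma')
      fix n :: nat
      \<comment> \<open>The exponential is a nonzero constant on the fibre, so summability of the
        whole series descends to \<open>a\<close> there. This makes \<open>b n\<close> a genuine sum
        and not the default value of \<open>infsum\<close>.\<close>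
      have "(\<lambda>\<xi>. a \<xi> * e z (tr \<xi>)) summable_on fib n"
        by (rule summable_on_subset_banach[OF has_sum_imp_summable[OF sum]]) (auto simp: fib_def)
      hence "(\<lambda>\<xi>. a \<xi> * e z n) summable_on fib n"
        by (rule summable_on_cong[THEN iffD1, rotated]) (simp add: fib_def)
      hence "a summable_on fib n"
        by (subst (asm) summable_on_cmult_left') (auto simp: e_def)
      hence "((\<lambda>\<xi>. a \<xi> * e z n) has_sum b n * e z n) (fib n)"
        unfolding b_def by (intro has_sum_cmult_left has_sum_infsum)
      thus "((\<lambda>\<xi>. a (snd (n, \<xi>)) * e z (tr (snd (n, \<xi>)))) has_sum b n * e z n) (fib n)"
        by (rule has_sum_cong[THEN iffD1, rotated]) (simp add: fib_def)
    qed
    from has_sum_imp_sums[OF this]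
    show "(\<lambda>n. b n * exp (2 * of_real pi * \<i> * of_nat n * z / of_nat N)) sums
        (diagonal_restriction \<iota> \<delta> f (moebius_act \<alpha> z) / csqrt (moebius_denom \<alpha> z) ^ (CARD('n) * (2 * \<kappa> + 1)))"
      by (simp add: T_def e_def)
  qed
qed

end

theorem theorem2p1:
  fixes \<iota> :: "'n::finite \<Rightarrow> 'f::field_char_0 \<Rightarrow> real"
    and \<delta> :: 'f and \<kappa> :: nat and f :: "complex ^ 'n \<Rightarrow> complex"
  assumes "number_field TYPE('f)"
    and "field_degree TYPE('f) = CARD('n)"
    and "totally_real TYPE('f)"
    and "bij_betw \<iota> UNIV {\<sigma>. field_embedding \<sigma>}"
    and "different = principal_ideal \<delta>"
    and "\<forall>i. \<iota> i \<delta> > 0"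
    and "f \<in> hilbert_modular_forms \<iota> \<kappa>"
  shows "diagonal_restriction \<iota> \<delta> f \<in> modular_forms_Gamma0_4 (CARD('n) * (2 * \<kappa> + 1))"
proof -
  interpret principal_different \<iota> \<delta>
    using assms(1-6) by unfold_locales auto
  show ?thesis
    using assms(7) diagonal_restriction_holomorphic diagonal_restriction_transform[OF assms(7)]
      diagonal_restriction_cusps
    by (auto simp: modular_forms_Gamma0_4_def hilbert_modular_forms_def)
qed

end
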